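(* Let $\Gamma((r^S)_{S\subseteq I})$ be a quitting game satisfying $r^i_i=0$ for all $i\in I$. Suppose that $I_*\neq\emptyset$ and that the problem $\mathrm{LCP}((\hat r^i)_{i=1}^n,\vec0)$ has no nontrivial solution, i.e. no solution $(w,z)$ with $z_0<1$. (1) If $\hat R$ is not a $Q$-matrix, then for every $\varepsilon>0$ the game has a stationary $\varepsilon$-equilibrium. (2) If $\hat R$ is a $Q$-matrix, then for every $\varepsilon>0$ the game has a sunspot $\varepsilon$-equilibrium in which at every stage at most one player quits with positive probability.
   Context: A quitting game $\Gamma((r^S)_{S\subseteq I})$: finite player set $I=[N]$, vectors $r^S\in[-1,1]^N$ for all $S\subseteq I$; at each stage $t\in\mathbb N$ each player chooses to continue or quit; with $t^*$ the first stage at which some player quits and $S^*$ the set of players quitting then ($S^*=\emptyset$ if nobody ever quits), the payoff is $r^{S^*}$. Write $r^i:=r^{\{i\}}$. Strategies (without signals) are sequences $x_i=(x_i^t)_t\subset[0,1]$ of conditional quitting probabilities; stationary if constant in $t$. $\gamma(x):=\mathbb E_x[r^{S^*}]$; $x$ is an $\varepsilon$-equilibrium if $\gamma_i(x)\ge\gamma_i(x_i',x_{-i})-\varepsilon$ for all $i,x_i'$. Sunspot version: at each stage the players publicly observe a signal uniform on $[0,1]$, independent of everything before; strategies are measurable maps $\xi_i^t:[0,1]^t\to[0,1]$ giving the quitting probability at stage $t$ given the signals so far; a sunspot $\varepsilon$-equilibrium is an $\varepsilon$-equilibrium of this extended game (no player gains more than $\varepsilon$ by any deviation in the extended game). Normal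 players: $I_0:=I$, $I_{l+1}:=\{i\in I_l:\ \exists j\in I_l,\ j\neq i,\ r^j_i\le0\}$, $I_*:=\bigcap_l I_l$; $n:=|I_*|$, players renamed so that $I_*=[n]$. $\hat r^i\in\mathbb R^n$ is the restriction of $r^i$ ($i\in[n]$) to coordinates in $I_*$, and $\hat R$ is the $n\times n$ matrix whose $i$-th column is $\hat r^i$. $\mathrm{LCP}((\hat r^i)_{i=1}^n,q)$: find $w\in\mathbb R^n_{\ge0}$ and $z\in\Delta(\{0,\dots,n\})$ with $w=z_0q+\sum_i z_i\hat r^i$ and $z_i=0$ or $w_i=0$ for each $i\in[n]$. An $n\times n$ matrix $R$ is a $Q$-matrix if for every $q\in\mathbb R^n$ there exist $z,w\in\mathbb R^n_{\ge0}$ with $w=q+Rz$ and $z_iw_i=0$ for all $i\in[n]$. *)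

theory Defs
  imports "HOL-Probability.Probability"
begin

text \<open>Players are the naturals 0..N-1 (I = {..<N}); stages are the naturals 0,1,2,...
  A payoff system is r :: nat set => nat => real, r S j = payoff of player j when S is
  the set of players quitting first. A strategy profile without signals is
  x :: nat => nat => real, x i t = probability that player i quits at stage t.\<close>

definition payoffs_ok :: "nat \<Rightarrow> (nat set \<Rightarrow> nat \<Rightarrow> real) \<Rightarrow> bool" where
  "payoffs_ok N r \<longleftrightarrow> (\<forall>S\<subseteq>{..<N}. \<forall>j<N. -1 \<le> r S j \<and> r S j \<le> 1)"

definition strat :: "(nat \<Rightarrow> real) \<Rightarrow> bool" where
  "strat y \<longleftrightarrow> (\<forall>t. 0 \<le> y t \<and> y t \<le> 1)"

definition profile :: "nat \<Rightarrow> (nat \<Rightarrow> nat \<Rightarrow> real) \<Rightarrow> bool" where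
  "profile N x \<longleftrightarrow> (\<forall>i<N. strat (x i))"

definition stationary :: "nat \<Rightarrow> (nat \<Rightarrow> nat \<Rightarrow> real) \<Rightarrow> bool" where
  "stationary N x \<longleftrightarrow> (\<forall>i<N. \<forall>t. x i t = x i 0)"

definition cont_prob :: "nat \<Rightarrow> (nat \<Rightarrow> nat \<Rightarrow> real) \<Rightarrow> nat \<Rightarrow> real" where
  "cont_prob N x t = (\<Prod>s<t. \<Prod>i<N. (1 - x i s))"

definition quit_prob :: "nat \<Rightarrow> (nat \<Rightarrow> nat \<Rightarrow> real) \<Rightarrow> nat \<Rightarrow> nat set \<Rightarrow> real" where
  "quit_prob N x t S =
     cont_prob N x t * (\<Prod>i\<in>S. x i t) * (\<Prod>i\<in>{..<N} - S. (1 - x i t))"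

definition gamma :: "nat \<Rightarrow> (nat set \<Rightarrow> nat \<Rightarrow> real) \<Rightarrow> (nat \<Rightarrow> nat \<Rightarrow> real) \<Rightarrow> nat \<Rightarrow> real" where
  "gamma N r x j =
     (\<Sum>t. \<Sum>S\<in>Pow {..<N} - {{}}. quit_prob N x t S * r S j)
     + lim (cont_prob N x) * r {} j"

definition eps_equilibrium ::
  "nat \<Rightarrow> (nat set \<Rightarrow> nat \<Rightarrow> real) \<Rightarrow> real \<Rightarrow> (nat \<Rightarrow> nat \<Rightarrow> real) \<Rightarrow> bool" where
  "eps_equilibrium N r \<epsilon> x \<longleftrightarrow> profile N x \<and>
     (\<forall>i<N. \<forall>y. strat y \<longrightarrow> gamma N r (x(i := y)) i \<le> gamma N r x i + \<epsilon>)"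

text \<open>Sunspot version. The signal sequence is omega :: nat => real, i.i.d. uniform on [0,1];
  at stage t (0-based) the signals omega 0, ..., omega t have been observed.
  A sunspot strategy of a player is xi :: nat => (nat => real) => real, xi t omega being
  the quitting probability at stage t; it must be measurable and depend only on
  omega 0, ..., omega t.\<close>

definition signal_space :: "(nat \<Rightarrow> real) measure" where
  "signal_space = PiM UNIV (\<lambda>_. uniform_measure lborel {0..1})"

definition sunspot_strat :: "(nat \<Rightarrow> (nat \<Rightarrow> real) \<Rightarrow> real) \<Rightarrow> bool" where
  "sunspot_strat \<xi> \<longleftrightarrow>
     (\<forall>t. \<xi> t \<in> borel_measurable signal_space
        \<and> (\<forall>\<omega>. 0 \<le> \<xi> t \<omega> \<and> \<xi> t \<omega> \<le> 1)
        \<and> (\<forall>\<omega> \<omega>'. (\<forall>s\<le>t. \<omega> s = \<omega>' s) \<longrightarrow> \<xi> t \<omega> = \<xi> t \<omega>'))"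

definition sunspot_profile :: "nat \<Rightarrow> (nat \<Rightarrow> nat \<Rightarrow> (nat \<Rightarrow> real) \<Rightarrow> real) \<Rightarrow> bool" where
  "sunspot_profile N \<xi> \<longleftrightarrow> (\<forall>i<N. sunspot_strat (\<xi> i))"

definition gamma_sunspot ::
  "nat \<Rightarrow> (nat set \<Rightarrow> nat \<Rightarrow> real) \<Rightarrow> (nat \<Rightarrow> nat \<Rightarrow> (nat \<Rightarrow> real) \<Rightarrow> real) \<Rightarrow> nat \<Rightarrow> real" where
  "gamma_sunspot N r \<xi> j = (\<integral>\<omega>. gamma N r (\<lambda>i t. \<xi> i t \<omega>) j \<partial>signal_space)"

definition sunspot_eps_equilibrium ::
  "nat \<Rightarrow> (nat set \<Rightarrow> nat \<Rightarrow> real) \<Rightarrow> real \<Rightarrow> (nat \<Rightarrow> nat \<Rightarrow> (nat \<Rightarrow> real) \<Rightarrow> real) \<Rightarrow> bool" where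
  "sunspot_eps_equilibrium N r \<epsilon> \<xi> \<longleftrightarrow> sunspot_profile N \<xi> \<and>
     (\<forall>i<N. \<forall>\<eta>. sunspot_strat \<eta> \<longrightarrow>
        gamma_sunspot N r (\<xi>(i := \<eta>)) i \<le> gamma_sunspot N r \<xi> i + \<epsilon>)"

definition at_most_one_quits :: "nat \<Rightarrow> (nat \<Rightarrow> nat \<Rightarrow> (nat \<Rightarrow> real) \<Rightarrow> real) \<Rightarrow> bool" where
  "at_most_one_quits N \<xi> \<longleftrightarrow> (\<forall>t \<omega>. card {i\<in>{..<N}. \<xi> i t \<omega> > 0} \<le> 1)"

definition normal_step :: "(nat set \<Rightarrow> nat \<Rightarrow> real) \<Rightarrow> nat set \<Rightarrow> nat set" where
  "normal_step r A = {i\<in>A. \<exists>j\<in>A. j \<noteq> i \<and> r {j} i \<le> 0}"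

definition I_l :: "nat \<Rightarrow> (nat set \<Rightarrow> nat \<Rightarrow> real) \<Rightarrow> nat \<Rightarrow> nat set" where
  "I_l N r l = (normal_step r ^^ l) {..<N}"

definition I_star :: "nat \<Rightarrow> (nat set \<Rightarrow> nat \<Rightarrow> real) \<Rightarrow> nat set" where
  "I_star N r = (\<Inter>l. I_l N r l)"

text \<open>LCP((rh^i)_{i in K}, q), vectors indexed by the finite index set K
  (rh i j = j-th coordinate of the i-th vector).\<close>
definition lcp_solution ::
  "nat set \<Rightarrow> (nat \<Rightarrow> nat \<Rightarrow> real) \<Rightarrow> (nat \<Rightarrow> real) \<Rightarrow> (nat \<Rightarrow> real) \<Rightarrow> real \<Rightarrow> (nat \<Rightarrow> real) \<Rightarrow> bool" where
  "lcp_solution K rh q w z0 z \<longleftrightarrow>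
     (\<forall>j\<in>K. 0 \<le> w j) \<and> 0 \<le> z0 \<and> (\<forall>i\<in>K. 0 \<le> z i) \<and> z0 + (\<Sum>i\<in>K. z i) = 1 \<and>
     (\<forall>j\<in>K. w j = z0 * q j + (\<Sum>i\<in>K. z i * rh i j)) \<and>
     (\<forall>i\<in>K. z i = 0 \<or> w i = 0)"

definition Q_matrix :: "nat set \<Rightarrow> (nat \<Rightarrow> nat \<Rightarrow> real) \<Rightarrow> bool" where
  "Q_matrix K M \<longleftrightarrow> (\<forall>q. \<exists>z w.
     (\<forall>i\<in>K. 0 \<le> z i \<and> 0 \<le> w i \<and> z i * w i = 0) \<and>
     (\<forall>j\<in>K. w j = q j + (\<Sum>i\<in>K. M j i * z i)))"

text \<open>hat r^i restricted to normal players, and hat R whose i-th column is hat r^i.\<close>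
definition r_hat :: "(nat set \<Rightarrow> nat \<Rightarrow> real) \<Rightarrow> nat \<Rightarrow> nat \<Rightarrow> real" where
  "r_hat r i j = r {i} j"

definition R_hat :: "(nat set \<Rightarrow> nat \<Rightarrow> real) \<Rightarrow> nat \<Rightarrow> nat \<Rightarrow> real" where
  "R_hat r j i = r_hat r i j"

end

theory Submission
  imports Defs
begin

text \<open>
  (1) Let \<open>q\<close> be a vector for which the linear complementarity problem on the normal players has no solution,
  extended by \<open>1\<close> to the other players. Stop the game in addition at rate \<open>l\<close> with payoff \<open>q\<close>; Brouwer's
  theorem yields a stationary equilibrium of this game. Let \<open>l\<close> tend to \<open>0\<close>. If the
  equilibria tend to \<open>0\<close>, the ratios of the quitting probabilities converge to a solution of the problem with
  right-hand side \<open>q\<close> or of the homogeneous problem, and both are excluded. If two players quit in the limit, the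
  limit is an equilibrium. If only player \<open>i\<close> does, let some \<open>j\<close> with \<open>r {j} i \<le> 0\<close> quit with a small probability.

  (2) The Q-property yields, from the origin, a walk in the boundary of the orthant of large total
  weight and small total perturbation, each of whose increments is a nonnegative combination of
  the columns \<open>r {i}\<close> with \<open>i\<close> in the zero set of the point reached. The game is played along this walk
  backwards: in each phase the sunspot draws a player proportionally to the weights, who quits with small
  probability, or it lets the play pass to the preceding phase. Divided by the total weight, the walk is
  up to small errors the vector of continuation payoffs, a player who is asked to quit has continuation payoff
  close to \<open>0\<close>, and no weight pattern is concentrated on one player, because every column has a negative entry.
\<close>

section \<open>Paths of complementary solutions\<close>

text \<open>In the first part the extra stopping is needed because without it \<open>x = 0\<close>
  always satisfies the complementarity conditions, although it leaves everybody with the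
  uncontrolled payoff \<open>r {}\<close>. Prescribing \<open>1\<close> for the other players makes
  waiting attractive to them, which keeps their weights out of the limiting ratios. The same payoff
  \<open>r {} i\<close> is the obstacle when only \<open>i\<close> quits: by never quitting,
  \<open>i\<close> would obtain it. Hence the additional rare quitter \<open>j\<close>.

  In the second part a walk may stall, since at a boundary point there need not be a solution of
  positive weight; perturbations get it moving again. Their sum enters the gain from deviating, so
  it must be small although the total weight is large. Errors are therefore measured relative to the
  weight gained, and long walks come from a supremum argument. The walk is played backwards because
  its origin stands for the phase in which nobody quits and the payoff is unknown. That phase gets
  weight \<open>1\<close>, and it has to be reached rarely even if one player refuses to quit. This
  is what the large total weight and the negative entries are for.\<close>

lemma finite_subseq_convergent:
  fixes f :: "nat \<Rightarrow> 'a \<Rightarrow> real"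
  assumes "finite K" "\<And>n i. i \<in> K \<Longrightarrow> \<bar>f n i\<bar> \<le> B"
  obtains s l where "strict_mono s" "\<And>i. i \<in> K \<Longrightarrow> (\<lambda>n. f (s n) i) \<longlonglongrightarrow> l i"
proof -
  have "\<exists>s l. strict_mono (s::nat\<Rightarrow>nat) \<and> (\<forall>i\<in>K. (\<lambda>n. f (s n) i) \<longlonglongrightarrow> l i)"
    using assms
  proof (induction K rule: finite_induct)
    case empty
    have "strict_mono (id::nat\<Rightarrow>nat)" by (simp add: strict_mono_def)
    then show ?case by blast
  next
    case (insert a A)
    then obtain s l where s: "strict_mono (s::nat\<Rightarrow>nat)"
      and l: "\<forall>i\<in>A. (\<lambda>n. f (s n) i) \<longlonglongrightarrow> l i" by (metis insertCI)
    have "bounded (range (\<lambda>n. f (s n) a))"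
      using insert.prems by (auto simp: bounded_iff intro!: exI[of _ B])
    then obtain c t where t: "strict_mono (t::nat\<Rightarrow>nat)" "((\<lambda>n. f (s n) a) \<circ> t) \<longlonglongrightarrow> c"
      using bounded_imp_convergent_subsequence by blast
    have "(\<lambda>n. f ((s \<circ> t) n) i) \<longlonglongrightarrow> (l(a := c)) i" if "i \<in> insert a A" for i
    proof (cases "i = a")
      case True
      then show ?thesis using t(2) by (simp add: o_def)
    next
      case False
      then have "((\<lambda>n. f (s n) i) \<circ> t) \<longlonglongrightarrow> l i"
        using that l t(1) LIMSEQ_subseq_LIMSEQ by blast
      then show ?thesis using False by (simp add: o_def)
    qed
    moreover have "strict_mono (s \<circ> t)" using s t(1) by (rule strict_mono_o)
    ultimately show ?case by blast
  qed
  then show ?thesis using that by blast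
qed

text \<open>\<open>R i j\<close> is coordinate \<open>j\<close> of column \<open>i\<close>, so the
  indices are swapped against \<open>R_hat\<close>. Unlike in \<open>lcp_solution\<close>, the
  weight of \<open>q\<close> is \<open>1\<close> and \<open>z\<close> is not normalised.\<close>

definition lcp_sol :: "'a set \<Rightarrow> ('a \<Rightarrow> 'a \<Rightarrow> real) \<Rightarrow> ('a \<Rightarrow> real) \<Rightarrow> ('a \<Rightarrow> real) \<Rightarrow> ('a \<Rightarrow> real) \<Rightarrow> bool" where
  "lcp_sol K R q z w \<longleftrightarrow>
     (\<forall>j\<in>K. 0 \<le> z j \<and> 0 \<le> w j \<and> z j * w j = 0 \<and> w j = q j + (\<Sum>i\<in>K. z i * R i j))"

definition orthant_bd :: "'a set \<Rightarrow> ('a \<Rightarrow> real) \<Rightarrow> bool" where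
  "orthant_bd K p \<longleftrightarrow> (\<forall>j\<in>K. 0 \<le> p j) \<and> (\<exists>j\<in>K. p j = 0)"

lemma positive_off_zero_set:
  assumes "finite K" "orthant_bd K p"
  shows "\<exists>\<delta>>0. \<forall>j\<in>K - {j\<in>K. p j = 0}. \<delta> \<le> p j"
proof -
  define \<delta> where "\<delta> = Min (insert 1 (p ` (K - {j\<in>K. p j = 0})))"
  have "0 < \<delta>" unfolding \<delta>_def using assms
    by (subst Min_gr_iff) (auto simp: orthant_bd_def less_le)
  moreover have "\<delta> \<le> p j" if "j \<in> K - {j\<in>K. p j = 0}" for j
    unfolding \<delta>_def using assms(1) that by (intro Min_le) auto
  ultimately show ?thesis by blast
qed

text \<open>\<open>lcp_path K R p Z e u\<close>: a discretised path from \<open>p\<close> to \<open>u\<close> in the boundary of the orthant. A step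
  perturbs the current point by at most \<open>\<delta>\<close> and then moves to a solution of the complementarity problem at
  the perturbed point; \<open>Z\<close> accumulates the column weights used and \<open>e\<close> the perturbations.\<close>
inductive lcp_path ::
  "'a set \<Rightarrow> ('a \<Rightarrow> 'a \<Rightarrow> real) \<Rightarrow> ('a \<Rightarrow> real) \<Rightarrow> ('a \<Rightarrow> real) \<Rightarrow> real \<Rightarrow> ('a \<Rightarrow> real) \<Rightarrow> bool"
  for K R where
  nil: "lcp_path K R p (\<lambda>_. 0) 0 p"
| step: "\<lbrakk>lcp_path K R p Z e u; 0 \<le> \<delta>; \<forall>j\<in>K. \<bar>d j\<bar> \<le> \<delta>; orthant_bd K w;
     lcp_sol K R (\<lambda>j. u j + d j) z w\<rbrakk>
   \<Longrightarrow> lcp_path K R p (\<lambda>i. Z i + z i) (e + \<delta>) w"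

lemma lcp_path_trans:
  assumes "lcp_path K R u Z' e' v" "lcp_path K R p Z e u"
  shows "lcp_path K R p (\<lambda>i. Z i + Z' i) (e + e') v"
  using assms
proof (induction rule: lcp_path.induct)
  case (nil q)
  then show ?case by simp
next
  case (step q Z' e' u \<delta> d w z)
  from lcp_path.step[OF step.IH[OF step.prems] step.hyps(2-)]
  show ?case by (simp add: add.assoc)
qed

lemma lcp_path_single:
  assumes "lcp_sol K R (\<lambda>j. p j + d j) z w" "orthant_bd K w" "0 \<le> \<delta>" "\<forall>j\<in>K. \<bar>d j\<bar> \<le> \<delta>"
  shows "lcp_path K R p z \<delta> w"
  using lcp_path.step[OF lcp_path.nil assms(3,4,2,1)] by simp

text \<open>With \<open>z = 0\<close> every boundary point solves the problem at itself, so a pure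
  perturbation may land on any nearby boundary point. Limits of endpoints are reached in this
  way.\<close>

lemma lcp_path_jump:
  assumes "orthant_bd K w" "0 \<le> \<delta>" "\<forall>j\<in>K. \<bar>w j - p j\<bar> \<le> \<delta>"
  shows "lcp_path K R p (\<lambda>_. 0) \<delta> w"
  using assms by (intro lcp_path_single[where d = "\<lambda>j. w j - p j"]) (auto simp: lcp_sol_def orthant_bd_def)

lemma lcp_path_nonneg:
  assumes "lcp_path K R p Z e u"
  shows "0 \<le> e" "\<forall>j\<in>K. 0 \<le> Z j" "0 \<le> sum Z K"
proof -
  have "0 \<le> e \<and> (\<forall>j\<in>K. 0 \<le> Z j)"
    using assms by induction (auto simp: lcp_sol_def)
  then show "0 \<le> e" "\<forall>j\<in>K. 0 \<le> Z j" "0 \<le> sum Z K" by (auto intro: sum_nonneg)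
qed

lemma lcp_path_end:
  assumes "lcp_path K R p Z e u"
  shows "\<exists>D. \<forall>j\<in>K. \<bar>D j\<bar> \<le> e \<and> u j = p j + D j + (\<Sum>i\<in>K. Z i * R i j)"
  using assms
proof induction
  case (nil p)
  show ?case by (intro exI[of _ "\<lambda>_. 0"]) simp
next
  case (step p Z e u \<delta> d w z)
  then obtain D where D: "\<forall>j\<in>K. \<bar>D j\<bar> \<le> e \<and> u j = p j + D j + (\<Sum>i\<in>K. Z i * R i j)" by blast
  have "\<bar>D j + d j\<bar> \<le> e + \<delta> \<and> w j = p j + (D j + d j) + (\<Sum>i\<in>K. (Z i + z i) * R i j)"
    if "j \<in> K" for j
  proof -
    have "w j = u j + d j + (\<Sum>i\<in>K. z i * R i j)" "\<bar>D j\<bar> \<le> e" "\<bar>d j\<bar> \<le> \<delta>"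
      "u j = p j + D j + (\<Sum>i\<in>K. Z i * R i j)"
      using step.hyps D that by (auto simp: lcp_sol_def)
    then show ?thesis by (auto simp: sum.distrib distrib_right)
  qed
  then show ?case by (intro exI[of _ "\<lambda>j. D j + d j"]) blast
qed

lemma lcp_path_orthant_bd:
  assumes "lcp_path K R p Z e u" "orthant_bd K p"
  shows "orthant_bd K u"
  using assms by induction auto

lemma abs_column_sum_le:
  fixes z :: "'a \<Rightarrow> real"
  assumes "\<And>i. i \<in> K \<Longrightarrow> \<bar>R i j\<bar> \<le> 1" "\<forall>i\<in>K. 0 \<le> z i"
  shows "\<bar>\<Sum>i\<in>K. z i * R i j\<bar> \<le> sum z K"
proof -
  have "\<bar>\<Sum>i\<in>K. z i * R i j\<bar> \<le> (\<Sum>i\<in>K. \<bar>z i * R i j\<bar>)" by (rule sum_abs)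
  also have "\<dots> \<le> sum z K"
    using assms by (intro sum_mono) (auto simp: abs_mult intro: mult_left_le)
  finally show ?thesis .
qed

section \<open>Extending paths at small relative error\<close>

text \<open>The bound relative to the mass lets the errors of concatenated pieces add up to a small
  multiple of the total mass. The absolute bound controls the last piece, whose mass may overshoot a
  prescribed target by any amount.\<close>

definition extendable :: "'a set \<Rightarrow> ('a \<Rightarrow> 'a \<Rightarrow> real) \<Rightarrow> ('a \<Rightarrow> real) \<Rightarrow> bool" where
  "extendable K R p \<longleftrightarrow> (\<forall>\<epsilon>>0. \<exists>Z e u. lcp_path K R p Z e u \<and> 0 < sum Z K
      \<and> e \<le> \<epsilon> * sum Z K \<and> e \<le> \<epsilon>)"

locale R0_matrix =
  fixes K :: "'a set" and R :: "'a \<Rightarrow> 'a \<Rightarrow> real"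
  assumes fin: "finite K"
    and R_le: "\<And>i j. i \<in> K \<Longrightarrow> j \<in> K \<Longrightarrow> \<bar>R i j\<bar> \<le> 1"
    and R_diag: "\<And>i. i \<in> K \<Longrightarrow> R i i = 0"
    and R0: "\<And>z w. lcp_sol K R (\<lambda>_. 0) z w \<Longrightarrow> \<forall>i\<in>K. z i = 0"
begin

lemma path_dist:
  assumes "lcp_path K R p Z e u" "j \<in> K"
  shows "\<bar>u j - p j\<bar> \<le> e + sum Z K"
proof -
  obtain D where "\<bar>D j\<bar> \<le> e" "u j = p j + D j + (\<Sum>i\<in>K. Z i * R i j)"
    using lcp_path_end[OF assms(1)] assms(2) by blast
  moreover have "\<bar>\<Sum>i\<in>K. Z i * R i j\<bar> \<le> sum Z K"
    using R_le assms(2) lcp_path_nonneg(2)[OF assms(1)] by (intro abs_column_sum_le) auto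
  ultimately show ?thesis by linarith
qed

text \<open>The path moves a coordinate by at most \<open>e + sum Z K\<close>, so coordinate
  \<open>j\<close> stays positive throughout and complementarity forbids column
  \<open>j\<close>.\<close>

lemma path_support:
  assumes "lcp_path K R p Z e u" "j \<in> K" "e + sum Z K < p j"
  shows "Z j = 0"
  using assms
proof induction
  case (nil p)
  show ?case by simp
next
  case (step p Z e u \<delta> d w z)
  have z: "\<forall>i\<in>K. 0 \<le> z i" using step.hyps by (auto simp: lcp_sol_def)
  then have "0 \<le> sum z K" by (auto intro: sum_nonneg)
  then have "Z j = 0" using step by (auto simp: sum.distrib)
  moreover have "\<bar>w j - p j\<bar> \<le> e + \<delta> + (\<Sum>i\<in>K. Z i + z i)"
    using path_dist[OF lcp_path.step[OF step.hyps]] step.prems by simp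
  then have "w j > 0" using step.prems by linarith
  then have "z j = 0" using step.hyps \<open>j \<in> K\<close> by (auto simp: lcp_sol_def)
  ultimately show ?case by simp
qed

text \<open>A greedy walk could make ever smaller steps, so a supremum is used. Paths whose masses
  approach the supremum have bounded endpoints, hence a limit point. If that point is extendable,
  the extension must pass \<open>L\<close>, or it would beat the supremum; if not, it is the blocked
  endpoint, and \<open>\<tau>\<close> pays for the jump to it.\<close>

lemma maximal_path:
  assumes a: "orthant_bd K a" and pos: "0 < \<epsilon>" "0 < \<tau>" "0 < L"
  shows "\<exists>Z e u. lcp_path K R a Z e u \<and>
     ((sum Z K \<ge> L \<and> e \<le> \<epsilon> * sum Z K \<and> e \<le> \<epsilon> * (L + 1)) \<or>
      (sum Z K < L \<and> e \<le> \<epsilon> * sum Z K + \<tau> \<and> \<not> extendable K R u))"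
proof -
  define P where "P Z e u \<longleftrightarrow> lcp_path K R a Z e u \<and> sum Z K < L \<and> e \<le> \<epsilon> * sum Z K" for Z e u
  define T where "T = {sum Z K | Z e u. P Z e u}"
  have T0: "0 \<in> T" unfolding T_def P_def using pos lcp_path.nil[of K R a] by force
  have Tbd: "bdd_above T" unfolding T_def P_def by (auto intro!: bdd_aboveI[of _ L])
  have "\<exists>Z e u. P Z e u \<and> Sup T - 1 / real (Suc n) < sum Z K" for n
  proof -
    have "Sup T - 1 / real (Suc n) < Sup T" by simp
    then obtain x where "x \<in> T" "Sup T - 1 / real (Suc n) < x"
      using less_cSup_iff[of T] T0 Tbd by blast
    then show ?thesis unfolding T_def by blast
  qed
  then obtain Z e u where P: "\<And>n. P (Z n) (e n) (u n)"
    and near: "\<And>n. Sup T - 1 / real (Suc n) < sum (Z n) K" by metis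
  have path: "lcp_path K R a (Z n) (e n) (u n)" and mass: "(sum (Z n) K) < L"
    and err: "e n \<le> \<epsilon> * sum (Z n) K" for n
    using P by (auto simp: P_def)
  obtain B where B: "\<And>i. i \<in> K \<Longrightarrow> \<bar>a i\<bar> \<le> B"
    using fin by (metis finite_imageI Max_ge image_eqI)
  have "\<bar>u n i\<bar> \<le> B + (\<epsilon> + 1) * L" if "i \<in> K" for n i
  proof -
    have "\<bar>u n i - a i\<bar> \<le> e n + sum (Z n) K" using path_dist[OF path that] .
    also have "\<dots> \<le> (\<epsilon> + 1) * sum (Z n) K" using err[of n] by (simp add: algebra_simps)
    also have "\<dots> \<le> (\<epsilon> + 1) * L" using mass[of n] pos by (intro mult_left_mono) auto
    finally show ?thesis using B[OF that] by linarith
  qed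
  then obtain s l where s: "strict_mono s" and l: "\<And>i. i \<in> K \<Longrightarrow> (\<lambda>n. u (s n) i) \<longlonglongrightarrow> l i"
    using finite_subseq_convergent[OF fin] by metis
  have ubd: "orthant_bd K (u n)" for n using lcp_path_orthant_bd path a by blast
  have lbd: "orthant_bd K l"
  proof -
    have nn: "\<forall>j\<in>K. 0 \<le> l j"
    proof
      fix j assume "j \<in> K"
      then have "\<forall>n\<ge>0. 0 \<le> u (s n) j" using ubd by (simp add: orthant_bd_def)
      then show "0 \<le> l j" using LIMSEQ_le_const[OF l[OF \<open>j \<in> K\<close>]] by blast
    qed
    have "\<exists>j\<in>K. l j = 0"
    proof (rule ccontr)
      assume "\<not> ?thesis"
      then have lp: "\<And>j. j \<in> K \<Longrightarrow> l j > 0" using nn by force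
      have "\<forall>j\<in>K. \<forall>\<^sub>F n in sequentially. u (s n) j > 0"
        using l lp order_tendstoD(1) by blast
      then have "\<forall>\<^sub>F n in sequentially. \<forall>j\<in>K. u (s n) j > 0"
        using fin by (simp add: eventually_ball_finite_distrib)
      then obtain n where "\<forall>j\<in>K. u (s n) j > 0" by (auto simp: eventually_sequentially)
      then show False using ubd[of "s n"] by (force simp: orthant_bd_def)
    qed
    with nn show ?thesis by (simp add: orthant_bd_def)
  qed
  have close: "\<forall>\<^sub>F n in sequentially. \<forall>j\<in>K. \<bar>l j - u (s n) j\<bar> \<le> \<eta>" if "\<eta> > 0" for \<eta>
  proof -
    have "\<forall>j\<in>K. \<forall>\<^sub>F n in sequentially. \<bar>l j - u (s n) j\<bar> \<le> \<eta>"
    proof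
      fix j assume "j \<in> K"
      then have "\<forall>\<^sub>F n in sequentially. dist (u (s n) j) (l j) < \<eta>" using l that tendstoD by blast
      then show "\<forall>\<^sub>F n in sequentially. \<bar>l j - u (s n) j\<bar> \<le> \<eta>"
        by (rule eventually_mono) (auto simp: dist_real_def)
    qed
    then show ?thesis using fin by (simp add: eventually_ball_finite_distrib)
  qed
  show ?thesis
  proof (cases "extendable K R l")
    case False
    obtain n where n: "\<forall>j\<in>K. \<bar>l j - u (s n) j\<bar> \<le> \<tau>"
      using close[OF pos(2)] by (auto simp: eventually_sequentially)
    have "lcp_path K R a (\<lambda>i. Z (s n) i + 0) (e (s n) + \<tau>) l"
      using lcp_path_trans[OF lcp_path_jump[OF lbd _ n] path] pos by simp
    moreover have "e (s n) + \<tau> \<le> \<epsilon> * sum (Z (s n)) K + \<tau>" using err[of "s n"] by simp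
    ultimately show ?thesis using False mass[of "s n"]
      by (intro exI[of _ "Z (s n)"] exI[of _ "e (s n) + \<tau>"] exI[of _ l]) simp
  next
    case True
    then obtain Y f v where Y: "lcp_path K R l Y f v" "0 < sum Y K"
      "f \<le> \<epsilon>/2 * sum Y K" "f \<le> \<epsilon>/2"
      unfolding extendable_def using pos(1) half_gt_zero by blast
    define y where "y = sum Y K"
    \<comment> \<open>Half of the error budget goes to the jump from \<open>u (s n)\<close> to
      \<open>l\<close>, the other half to the extension \<open>Y\<close> from \<open>l\<close>. The
      minimum serves the relative and the absolute bound at once.\<close>
    define \<eta> where "\<eta> = \<epsilon>/2 * min 1 y"
    have \<eta>: "\<eta> > 0" using pos Y by (simp add: \<eta>_def y_def)
    have "\<forall>\<^sub>F n in sequentially. 1 / real (Suc n) < y"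
      using order_tendstoD(2)[OF LIMSEQ_inverse_real_of_nat Y(2)]
      by (simp add: y_def inverse_eq_divide)
    from eventually_happens'[OF sequentially_bot eventually_conj[OF close[OF \<eta>] this]]
    obtain n where n: "\<forall>j\<in>K. \<bar>l j - u (s n) j\<bar> \<le> \<eta>" "1 / real (Suc n) < y"
      by blast
    have "lcp_path K R (u (s n)) (\<lambda>i. 0 + Y i) (\<eta> + f) v"
      using lcp_path_trans[OF Y(1) lcp_path_jump[OF lbd _ n(1)]] \<eta> by simp
    from lcp_path_trans[OF this path[of "s n"]]
    have p: "lcp_path K R a (\<lambda>i. Z (s n) i + Y i) (e (s n) + (\<eta> + f)) v" by simp
    have m: "(\<Sum>i\<in>K. Z (s n) i + Y i) = sum (Z (s n)) K + y" by (simp add: sum.distrib y_def)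
    have "\<eta> \<le> \<epsilon>/2 * y" unfolding \<eta>_def using pos(1) by (intro mult_left_mono) auto
    moreover have "\<eta> \<le> \<epsilon>/2" unfolding \<eta>_def using pos(1) mult_left_mono[of "min 1 y" 1 "\<epsilon>/2"] by simp
    ultimately have e1: "\<eta> + f \<le> \<epsilon> * y" "\<eta> + f \<le> \<epsilon>" using Y unfolding y_def by linarith+
    have e2: "e (s n) + (\<eta> + f) \<le> \<epsilon> * (\<Sum>i\<in>K. Z (s n) i + Y i)"
      unfolding m using e1 err[of "s n"] by (simp add: algebra_simps)
    \<comment> \<open>Below \<open>L\<close> the prolonged path would belong to \<open>T\<close>,
      although the fixed gain \<open>y\<close> exceeds the defect \<open>1 / Suc (s n)\<close> from
      the supremum.\<close>
    have "(\<Sum>i\<in>K. Z (s n) i + Y i) \<ge> L"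
    proof (rule ccontr)
      assume "\<not> ?thesis"
      then have "P (\<lambda>i. Z (s n) i + Y i) (e (s n) + (\<eta> + f)) v" using p e2 by (simp add: P_def)
      then have "(sum (Z (s n)) K) + y \<in> T" unfolding T_def using m by (auto intro!: exI)
      then have "(sum (Z (s n)) K) + y \<le> Sup T" using Tbd by (rule cSup_upper)
      moreover have "1 / real (Suc (s n)) \<le> 1 / real (Suc n)"
        using seq_suble[OF s, of n] by (simp add: frac_le)
      ultimately show False using near[of "s n"] n(2) by linarith
    qed
    moreover have "\<epsilon> * sum (Z (s n)) K \<le> \<epsilon> * L"
      using mass[of "s n"] pos by (intro mult_left_mono) auto
    then have "e (s n) + (\<eta> + f) \<le> \<epsilon> * (L + 1)"
      using err[of "s n"] e1 by (simp add: algebra_simps)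
    ultimately show ?thesis using p e2 by blast
  qed
qed

text \<open>The masses of the solutions need not be bounded, so the solutions are divided by their
  masses before passing to the limit. The reciprocal masses are at most \<open>1 / \<rho>\<close>
  and have a limit \<open>\<theta>\<close> along a subsequence.\<close>

lemma lcp_sol_closed:
  assumes sol: "\<And>n. lcp_sol K R (q n) (z n) (w n)"
    and q: "\<And>j. j \<in> K \<Longrightarrow> (\<lambda>n. q n j) \<longlonglongrightarrow> q' j"
    and \<rho>: "0 < \<rho>" "\<And>n. \<rho> \<le> sum (z n) K"
  shows "\<exists>z' w'. lcp_sol K R q' z' w' \<and> 0 < sum z' K"
proof -
  define m where "m n = sum (z n) K" for n
  have m: "m n > 0" "\<rho> \<le> m n" for n using \<rho>(1) \<rho>(2)[of n] by (auto simp: m_def)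
  have z0: "0 \<le> z n i" if "i \<in> K" for n i using sol[of n] that by (auto simp: lcp_sol_def)
  have z1: "z n i \<le> m n" if "i \<in> K" for n i
    unfolding m_def using that fin z0 by (intro member_le_sum) auto
  have "\<bar>z n i / m n\<bar> \<le> 1" if "i \<in> K" for n i
    using z0[OF that, of n] z1[OF that, of n] m[of n] by simp
  then obtain s \<zeta> where s: "strict_mono s" and \<zeta>: "\<And>i. i \<in> K \<Longrightarrow> (\<lambda>n. z (s n) i / m (s n)) \<longlonglongrightarrow> \<zeta> i"
    using finite_subseq_convergent[OF fin, of "\<lambda>n i. z n i / m n" 1] by metis
  have "\<bar>1 / m n\<bar> \<le> 1 / \<rho>" for n using m[of n] \<rho>(1) by (simp add: frac_le)
  then obtain t l where t: "strict_mono (t::nat\<Rightarrow>nat)" and "\<And>i. i \<in> {()} \<Longrightarrow> (\<lambda>n. 1 / m (s (t n))) \<longlonglongrightarrow> l i"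
    using finite_subseq_convergent[of "{()}" "\<lambda>n _. 1 / m (s n)" "1 / \<rho>"] by (metis finite.simps)
  then obtain \<theta> where \<theta>: "(\<lambda>n. 1 / m (s (t n))) \<longlonglongrightarrow> \<theta>" by auto
  define \<sigma> where "\<sigma> = s \<circ> t"
  have \<sigma>: "strict_mono \<sigma>" unfolding \<sigma>_def using s t by (rule strict_mono_o)
  have \<zeta>': "(\<lambda>n. z (\<sigma> n) i / m (\<sigma> n)) \<longlonglongrightarrow> \<zeta> i" if "i \<in> K" for i
    using LIMSEQ_subseq_LIMSEQ[OF \<zeta>[OF that] t] by (simp add: \<sigma>_def o_def)
  have \<theta>': "(\<lambda>n. 1 / m (\<sigma> n)) \<longlonglongrightarrow> \<theta>" using \<theta> by (simp add: \<sigma>_def)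
  have q': "(\<lambda>n. q (\<sigma> n) j) \<longlonglongrightarrow> q' j" if "j \<in> K" for j
    using LIMSEQ_subseq_LIMSEQ[OF q[OF that] \<sigma>] by (simp add: o_def)
  define \<omega> where "\<omega> j = \<theta> * q' j + (\<Sum>i\<in>K. \<zeta> i * R i j)" for j
  have \<omega>: "(\<lambda>n. w (\<sigma> n) j / m (\<sigma> n)) \<longlonglongrightarrow> \<omega> j" if "j \<in> K" for j
  proof -
    have "(\<lambda>n. 1 / m (\<sigma> n) * q (\<sigma> n) j + (\<Sum>i\<in>K. z (\<sigma> n) i / m (\<sigma> n) * R i j)) \<longlonglongrightarrow> \<omega> j"
      unfolding \<omega>_def using that by (intro tendsto_intros \<theta>' q' \<zeta>') auto
    moreover have "w (\<sigma> n) j / m (\<sigma> n)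
        = 1 / m (\<sigma> n) * q (\<sigma> n) j + (\<Sum>i\<in>K. z (\<sigma> n) i / m (\<sigma> n) * R i j)" for n
      using sol[of "\<sigma> n"] that by (simp add: lcp_sol_def add_divide_distrib sum_divide_distrib)
    ultimately show ?thesis by simp
  qed
  have \<theta>0: "0 \<le> \<theta>" using m(1) by (intro LIMSEQ_le_const[OF \<theta>']) (auto intro!: exI[of _ 0] less_imp_le)
  have base: "0 \<le> \<zeta> j \<and> 0 \<le> \<omega> j \<and> \<zeta> j * \<omega> j = 0" if "j \<in> K" for j
  proof (intro conjI)
    have "0 \<le> z (\<sigma> n) j" "0 \<le> w (\<sigma> n) j" "z (\<sigma> n) j * w (\<sigma> n) j = 0" for n
      using sol[of "\<sigma> n"] that by (auto simp: lcp_sol_def)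
    then have *: "0 \<le> z (\<sigma> n) j / m (\<sigma> n)" "0 \<le> w (\<sigma> n) j / m (\<sigma> n)"
      "(z (\<sigma> n) j / m (\<sigma> n)) * (w (\<sigma> n) j / m (\<sigma> n)) = 0" for n
      using m(1)[of "\<sigma> n"] by simp_all
    show "0 \<le> \<zeta> j" using * by (intro LIMSEQ_le_const[OF \<zeta>'[OF that]]) auto
    show "0 \<le> \<omega> j" using * by (intro LIMSEQ_le_const[OF \<omega>[OF that]]) auto
    show "\<zeta> j * \<omega> j = 0"
      using tendsto_mult[OF \<zeta>'[OF that] \<omega>[OF that]] unfolding *(3) by (simp add: LIMSEQ_const_iff)
  qed
  have "(\<Sum>i\<in>K. z (\<sigma> n) i / m (\<sigma> n)) = 1" for n
    using m(1)[of "\<sigma> n"] by (simp add: sum_divide_distrib[symmetric] m_def)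
  moreover have "(\<lambda>n. \<Sum>i\<in>K. z (\<sigma> n) i / m (\<sigma> n)) \<longlonglongrightarrow> (sum \<zeta> K)"
    by (intro tendsto_sum \<zeta>')
  ultimately have one: "(sum \<zeta> K) = 1" by (simp add: LIMSEQ_const_iff)
  \<comment> \<open>\<open>\<theta> = 0\<close> means that the right-hand side drops out in the
    limit, leaving a homogeneous solution of mass \<open>1\<close>. Otherwise division by
    \<open>\<theta>\<close> undoes the normalisation.\<close>
  have "\<theta> \<noteq> 0"
  proof
    assume "\<theta> = 0"
    then have "lcp_sol K R (\<lambda>_. 0) \<zeta> \<omega>" using base by (simp add: lcp_sol_def \<omega>_def)
    then have "\<forall>i\<in>K. \<zeta> i = 0" by (rule R0)
    then show False using one by simp
  qed
  then have "\<theta> > 0" using \<theta>0 by simp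
  have "lcp_sol K R q' (\<lambda>i. \<zeta> i / \<theta>) (\<lambda>i. \<omega> i / \<theta>)"
    unfolding lcp_sol_def
  proof (intro ballI conjI)
    fix j assume j: "j \<in> K"
    show "0 \<le> \<zeta> j / \<theta>" "0 \<le> \<omega> j / \<theta>" "\<zeta> j / \<theta> * (\<omega> j / \<theta>) = 0"
      using base[OF j] \<open>\<theta> > 0\<close> by auto
    show "\<omega> j / \<theta> = q' j + (\<Sum>i\<in>K. \<zeta> i / \<theta> * R i j)"
      using \<open>\<theta> > 0\<close> by (simp add: \<omega>_def add_divide_distrib sum_divide_distrib)
  qed
  moreover have "(\<Sum>i\<in>K. \<zeta> i / \<theta>) > 0"
    using one \<open>\<theta> > 0\<close> by (simp add: sum_divide_distrib[symmetric])
  ultimately show ?thesis by blast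
qed

text \<open>One unperturbed step has error \<open>0\<close>, which meets every bound. Positive mass
  gives some \<open>z i > 0\<close>, hence \<open>w i = 0\<close>, and the endpoint lies in the
  boundary.\<close>

lemma extendable_of_sol:
  assumes "lcp_sol K R p z w" "0 < sum z K"
  shows "extendable K R p"
proof -
  obtain i where "i \<in> K" "z i > 0" using assms(2) by (meson not_less sum_nonpos)
  then have "orthant_bd K w" using assms(1) by (fastforce simp: lcp_sol_def orthant_bd_def)
  then have "lcp_path K R p z 0 w"
    using assms(1) by (intro lcp_path_single[where d = "\<lambda>_. 0"]) auto
  then show ?thesis using assms(2) unfolding extendable_def
    by (intro allI impI exI[of _ z] exI[of _ 0] exI[of _ w]) auto
qed

text \<open>A mixture of columns indexed by the zero set \<open>A\<close> of \<open>p\<close> that vanishes on \<open>A\<close> could be added to \<open>p\<close>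
  with a small weight; compactness makes its absence quantitative.\<close>
lemma not_extendable_gap:
  assumes p: "orthant_bd K p" and ne: "\<not> extendable K R p"
  defines "A \<equiv> {j\<in>K. p j = 0}"
  shows "\<exists>\<kappa>>0. \<forall>z. (\<forall>i\<in>K. 0 \<le> z i) \<longrightarrow> (\<forall>i\<in>K - A. z i = 0)
           \<longrightarrow> (\<exists>j\<in>A. \<kappa> * sum z K \<le> \<bar>\<Sum>i\<in>K. z i * R i j\<bar>)"
proof (rule ccontr)
  assume neg: "\<not> ?thesis"
  have AK: "A \<subseteq> K" by (auto simp: A_def)
  define P where "P n z \<longleftrightarrow> (\<forall>i\<in>K. 0 \<le> z i) \<and> (\<forall>i\<in>K - A. z i = 0)
      \<and> (\<forall>j\<in>A. \<bar>\<Sum>i\<in>K. z i * R i j\<bar> < 1 / real (Suc n) * sum z K)" for n z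
  have "\<exists>z. P n z" for n
  proof (rule ccontr)
    assume none: "\<not> ?thesis"
    have "\<exists>j\<in>A. 1 / real (Suc n) * sum z K \<le> \<bar>\<Sum>i\<in>K. z i * R i j\<bar>"
      if "\<forall>i\<in>K. 0 \<le> z i" "\<forall>i\<in>K - A. z i = 0" for z
    proof (rule ccontr)
      assume "\<not> ?thesis"
      then have "P n z" using that unfolding P_def by (simp add: not_le)
      with none show False by blast
    qed
    moreover have "0 < 1 / real (Suc n)" by simp
    ultimately show False using neg by blast
  qed
  then obtain z where "\<And>n. P n (z n)" by metis
  then have z: "\<And>n i. i \<in> K \<Longrightarrow> 0 \<le> z n i" "\<And>n i. i \<in> K - A \<Longrightarrow> z n i = 0"
    "\<And>n j. j \<in> A \<Longrightarrow> \<bar>\<Sum>i\<in>K. z n i * R i j\<bar> < 1 / real (Suc n) * sum (z n) K"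
    unfolding P_def by simp_all
  define m where "m n = sum (z n) K" for n
  obtain a where "a \<in> A" using p unfolding orthant_bd_def A_def by blast
  have m: "m n > 0" for n
  proof -
    have "0 < 1 / real (Suc n) * m n" unfolding m_def using abs_ge_zero z(3)[OF \<open>a \<in> A\<close>, of n] by (rule le_less_trans)
    then show ?thesis unfolding zero_less_mult_iff by (auto simp: not_less)
  qed
  have "z n i \<le> m n" if "i \<in> K" for n i
    unfolding m_def using that fin z(1) by (intro member_le_sum) auto
  then have "\<bar>z n i / m n\<bar> \<le> 1" if "i \<in> K" for n i
    using z(1)[OF that, of n] that m[of n] by simp
  then obtain s \<zeta> where s: "strict_mono s" and \<zeta>: "\<And>i. i \<in> K \<Longrightarrow> (\<lambda>n. z (s n) i / m (s n)) \<longlonglongrightarrow> \<zeta> i"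
    using finite_subseq_convergent[OF fin, of "\<lambda>n i. z n i / m n" 1] by metis
  have \<zeta>0: "0 \<le> \<zeta> i" if "i \<in> K" for i
    using z(1)[OF that] m by (intro LIMSEQ_le_const[OF \<zeta>[OF that]]) (auto intro!: exI[of _ 0] divide_nonneg_pos)
  have \<zeta>A: "\<zeta> i = 0" if "i \<in> K - A" for i
    using \<zeta>[of i] z(2)[OF that] that by (simp add: LIMSEQ_const_iff)
  have "(\<Sum>i\<in>K. z (s n) i / m (s n)) = 1" for n
    using m[of "s n"] by (simp add: sum_divide_distrib[symmetric] m_def)
  moreover have "(\<lambda>n. \<Sum>i\<in>K. z (s n) i / m (s n)) \<longlonglongrightarrow> (sum \<zeta> K)"
    by (intro tendsto_sum \<zeta>)
  ultimately have one: "(sum \<zeta> K) = 1" by (simp add: LIMSEQ_const_iff)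
  have \<zeta>R: "(\<Sum>i\<in>K. \<zeta> i * R i j) = 0" if "j \<in> A" for j
  proof -
    have "(\<lambda>n. \<Sum>i\<in>K. z (s n) i / m (s n) * R i j) \<longlonglongrightarrow> (\<Sum>i\<in>K. \<zeta> i * R i j)"
      by (intro tendsto_intros \<zeta>)
    moreover have "(\<lambda>n. \<Sum>i\<in>K. z (s n) i / m (s n) * R i j) \<longlonglongrightarrow> 0"
    proof (rule Lim_null_comparison[OF always_eventually])
      show "\<forall>n. norm (\<Sum>i\<in>K. z (s n) i / m (s n) * R i j) \<le> 1 / real (Suc n)"
      proof
        fix n
        have "(\<Sum>i\<in>K. z (s n) i / m (s n) * R i j) = (\<Sum>i\<in>K. z (s n) i * R i j) / m (s n)"
          by (simp add: sum_divide_distrib)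
        moreover have "\<bar>\<Sum>i\<in>K. z (s n) i * R i j\<bar> \<le> 1 / real (Suc (s n)) * m (s n)"
          using z(3)[OF that, of "s n"] by (simp add: m_def)
        then have "\<bar>\<Sum>i\<in>K. z (s n) i * R i j\<bar> / m (s n) \<le> 1 / real (Suc (s n))"
          using m[of "s n"] by (simp add: divide_le_eq)
        moreover have "1 / real (Suc (s n)) \<le> 1 / real (Suc n)"
          using seq_suble[OF s, of n] by (simp add: frac_le)
        ultimately show "norm (\<Sum>i\<in>K. z (s n) i / m (s n) * R i j) \<le> 1 / real (Suc n)"
          using m[of "s n"] by simp
      qed
      show "(\<lambda>n. 1 / real (Suc n)) \<longlonglongrightarrow> 0"
        using LIMSEQ_inverse_real_of_nat by (simp add: inverse_eq_divide)
    qed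
    ultimately show ?thesis using LIMSEQ_unique by blast
  qed
  obtain \<delta> where \<delta>: "\<delta> > 0" "\<And>j. j \<in> K - A \<Longrightarrow> \<delta> \<le> p j"
    using positive_off_zero_set[OF fin p] unfolding A_def by blast
  \<comment> \<open>Columns are bounded by \<open>1\<close> and \<open>\<zeta>\<close> has mass
    \<open>1\<close>, so adding the mixture with weight \<open>\<delta>\<close> lowers a coordinate
    outside \<open>A\<close> by at most \<open>\<delta>\<close> and leaves the zeros on
    \<open>A\<close> untouched.\<close>
  have "lcp_sol K R p (\<lambda>i. \<delta> * \<zeta> i) (\<lambda>j. p j + (\<Sum>i\<in>K. \<delta> * \<zeta> i * R i j))"
    unfolding lcp_sol_def
  proof (intro ballI conjI)
    fix j assume j: "j \<in> K"
    show "0 \<le> \<delta> * \<zeta> j" using \<delta> \<zeta>0[OF j] by simp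
    have eq: "(\<Sum>i\<in>K. \<delta> * \<zeta> i * R i j) = \<delta> * (\<Sum>i\<in>K. \<zeta> i * R i j)"
      by (simp add: sum_distrib_left mult.assoc)
    have "\<bar>\<Sum>i\<in>K. \<zeta> i * R i j\<bar> \<le> 1"
      using abs_column_sum_le[of K R j \<zeta>] R_le j \<zeta>0 one by auto
    then have b: "\<bar>\<delta> * (\<Sum>i\<in>K. \<zeta> i * R i j)\<bar> \<le> \<delta>" using \<delta>(1) by (simp add: abs_mult mult_left_le)
    show "0 \<le> p j + (\<Sum>i\<in>K. \<delta> * \<zeta> i * R i j)"
    proof (cases "j \<in> A")
      case True
      then show ?thesis unfolding eq using \<zeta>R[OF True] by (simp add: A_def)
    next
      case False
      then show ?thesis unfolding eq using b \<delta>(2)[of j] j by auto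
    qed
    show "\<delta> * \<zeta> j * (p j + (\<Sum>i\<in>K. \<delta> * \<zeta> i * R i j)) = 0"
      unfolding eq using \<zeta>R[of j] \<zeta>A[of j] j by (cases "j \<in> A") (auto simp: A_def)
  qed auto
  moreover have "0 < (\<Sum>i\<in>K. \<delta> * \<zeta> i)" using one \<delta>(1) by (simp add: sum_distrib_left[symmetric])
  ultimately show False using ne extendable_of_sol by blast
qed

end

section \<open>Q-matrices: every boundary point is extendable\<close>

locale QR0_matrix = R0_matrix +
  assumes Q: "\<And>q. \<exists>z w. lcp_sol K R q z w"
begin

text \<open>Perturb \<open>p\<close> by \<open>t v\<close> and by \<open>- t v\<close>, where \<open>v\<close> is a difference of two unit vectors of the zero set \<open>A\<close>, and
  continue from the solutions along maximal paths. If neither path becomes long, both end at points with zero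
  set \<open>A\<close>, and adding the two balance equations on \<open>A\<close> cancels \<open>v\<close>: the weights used form a mixture of
  columns of total weight at least \<open>2 t\<close> that almost vanishes on \<open>A\<close>, against the gap.\<close>
lemma extendable_if_smaller_zero_sets:
  assumes p: "orthant_bd K p"
    and IH: "\<And>u. orthant_bd K u \<Longrightarrow> card {j\<in>K. u j = 0} < card {j\<in>K. p j = 0} \<Longrightarrow> extendable K R u"
  shows "extendable K R p"
proof (rule ccontr)
  assume ne: "\<not> extendable K R p"
  define A where "A = {j\<in>K. p j = 0}"
  have AK: "A \<subseteq> K" and finA: "finite A" using fin by (auto simp: A_def)
  have pA: "p j = 0" if "j \<in> A" for j using that by (simp add: A_def)
  obtain \<kappa> where \<kappa>: "\<kappa> > 0" and gap: "\<And>z. \<lbrakk>\<forall>i\<in>K. 0 \<le> z i; \<forall>i\<in>K - A. z i = 0\<rbrakk>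
      \<Longrightarrow> \<exists>j\<in>A. \<kappa> * sum z K \<le> \<bar>\<Sum>i\<in>K. z i * R i j\<bar>"
    using not_extendable_gap[OF p ne] unfolding A_def[symmetric] by blast
  obtain a where a: "a \<in> A" using p unfolding orthant_bd_def A_def by blast
  \<comment> \<open>If \<open>A\<close> were \<open>{a}\<close>, column \<open>a\<close> alone would
    vanish on \<open>A\<close> because the diagonal is zero, against the gap.\<close>
  have "\<exists>b\<in>A. b \<noteq> a"
  proof (rule ccontr)
    assume "\<not> ?thesis"
    then have "A = {a}" using a by blast
    define z where "z i = (if i = a then 1 else 0 :: real)" for i
    have "\<exists>j\<in>A. \<kappa> * sum z K \<le> \<bar>\<Sum>i\<in>K. z i * R i j\<bar>"
      using \<open>A = {a}\<close> by (intro gap) (auto simp: z_def)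
    moreover have "a \<in> K" using a AK by blast
    then have "sum z K = 1" "(\<Sum>i\<in>K. z i * R i a) = R a a"
      using fin by (simp_all add: z_def if_distrib[of "\<lambda>x. x * _"] cong: if_cong)
    ultimately show False using \<open>A = {a}\<close> R_diag[OF \<open>a \<in> K\<close>] \<kappa> by simp
  qed
  then obtain b where b: "b \<in> A" "b \<noteq> a" by blast
  define v where "v j = (if j = a then 1 else if j = b then -1 else 0 :: real)" for j
  have blocked: "\<not> (0 < sum z K)" if "lcp_sol K R p z w" for z w
    using ne extendable_of_sol[OF that] by blast
  obtain \<epsilon> where \<epsilon>: "\<epsilon> > 0" and none: "\<And>Z e u. lcp_path K R p Z e u \<Longrightarrow> 0 < sum Z K
      \<Longrightarrow> e \<le> \<epsilon> * sum Z K \<Longrightarrow> \<not> e \<le> \<epsilon>"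
    using ne unfolding extendable_def by blast
  obtain \<delta> where \<delta>: "\<delta> > 0" "\<And>j. j \<in> K - A \<Longrightarrow> \<delta> \<le> p j"
    using positive_off_zero_set[OF fin p] unfolding A_def by blast
  \<comment> \<open>A continuation of mass at least \<open>L * t\<close> has
    \<open>8 * t \<le> \<epsilon> * sum Z K\<close>, so the initial perturbation \<open>t\<close>
    uses only an eighth of the error allowed. Of the two bounds in \<open>\<epsilon>'\<close>, one
    limits the error of the continuation to a quarter of it, the other keeps the errors of short
    continuations below the gap \<open>\<kappa>\<close>.\<close>
  define L where "L = 8 / \<epsilon>"
  define \<epsilon>' where "\<epsilon>' = min (\<epsilon> / 4) (\<kappa> / 2 / (L + 1))"
  have L: "L > 0" using \<epsilon> by (simp add: L_def)
  have \<epsilon>': "\<epsilon>' > 0" "\<epsilon>' \<le> \<epsilon> / 4"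
    using \<epsilon> \<kappa> L unfolding \<epsilon>'_def by (simp, intro min.cobounded1)
  have "\<epsilon>' \<le> \<kappa> / 2 / (L + 1)" unfolding \<epsilon>'_def by (rule min.cobounded2)
  then have \<epsilon>'\<kappa>: "\<epsilon>' * (L + 1) \<le> \<kappa> / 2" using L by (subst (asm) pos_le_divide_eq) auto
  \<comment> \<open>\<open>C * t\<close> bounds \<open>t + e + sum Z K\<close> for a short
    continuation. With \<open>t \<le> \<delta> / (2 * C)\<close> and
    \<open>sum z K < \<delta> / 4\<close> no coordinate outside \<open>A\<close> can be brought down
    to zero.\<close>
  define C where "C = 1 + \<epsilon>' * L + \<epsilon>' + L"
  have C: "C > 0" using L \<epsilon>' by (simp add: C_def add_pos_pos)
  \<comment> \<open>Solutions whose mass stays above \<open>\<delta> / 4\<close> as \<open>t\<close>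
    tends to \<open>0\<close> would leave in the limit a solution of positive mass at
    \<open>p\<close> itself, making \<open>p\<close> extendable.\<close>
  have "\<exists>t0>0. \<forall>t \<sigma> z w. 0 < t \<longrightarrow> t < t0 \<longrightarrow> \<sigma> \<in> {1, -1} \<longrightarrow>
      lcp_sol K R (\<lambda>j. p j + \<sigma> * t * v j) z w \<longrightarrow> sum z K < \<delta> / 4"
  proof (rule ccontr)
    assume neg: "\<not> ?thesis"
    define P where "P n t \<sigma> z w \<longleftrightarrow> 0 < t \<and> t < 1 / real (Suc n) \<and> \<sigma> \<in> {1, -1} \<and>
      lcp_sol K R (\<lambda>j. p j + \<sigma> * t * v j) z w \<and> \<delta> / 4 \<le> sum z K" for n t \<sigma> z w
    have "\<exists>t \<sigma> z w. P n t \<sigma> z w" for n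
    proof -
      have "1 / real (Suc n) > 0" by simp
      with neg obtain t \<sigma> z w where "0 < t" "t < 1 / real (Suc n)" "\<sigma> \<in> {1, -1}"
        "lcp_sol K R (\<lambda>j. p j + \<sigma> * t * v j) z w" "\<not> sum z K < \<delta> / 4" by blast
      then have "P n t \<sigma> z w" by (simp add: P_def not_less)
      then show ?thesis by blast
    qed
    then obtain t \<sigma> z w where P: "\<And>n. P n (t n) (\<sigma> n) (z n) (w n)" by metis
    have t0: "t \<longlonglongrightarrow> 0"
    proof (rule Lim_null_comparison[OF always_eventually])
      show "\<forall>n. norm (t n) \<le> 1 / real (Suc n)" using P by (auto simp: P_def less_imp_le)
      show "(\<lambda>n. 1 / real (Suc n)) \<longlonglongrightarrow> 0"
        using LIMSEQ_inverse_real_of_nat by (simp add: inverse_eq_divide)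
    qed
    have "\<exists>z' w'. lcp_sol K R p z' w' \<and> 0 < sum z' K"
    proof (rule lcp_sol_closed)
      show "lcp_sol K R (\<lambda>j. p j + \<sigma> n * t n * v j) (z n) (w n)" for n using P by (simp add: P_def)
      show "\<delta> / 4 \<le> sum (z n) K" for n using P by (simp add: P_def)
      show "0 < \<delta> / 4" using \<delta> by simp
      show "(\<lambda>n. p j + \<sigma> n * t n * v j) \<longlonglongrightarrow> p j" for j
      proof -
        have "(\<lambda>n. \<sigma> n * t n * v j) \<longlonglongrightarrow> 0"
        proof (rule Lim_null_comparison[OF always_eventually])
          have "\<bar>\<sigma> n\<bar> = 1" for n using P[of n] by (auto simp: P_def)
          then show "\<forall>n. norm (\<sigma> n * t n * v j) \<le> \<bar>t n\<bar> * \<bar>v j\<bar>" by (simp add: abs_mult)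
          show "(\<lambda>n. \<bar>t n\<bar> * \<bar>v j\<bar>) \<longlonglongrightarrow> 0"
            using tendsto_mult_left_zero[OF tendsto_rabs_zero[OF t0]] .
        qed
        then show ?thesis using tendsto_add[OF tendsto_const[of "p j"]] by fastforce
      qed
    qed
    then show False using blocked by blast
  qed
  then obtain t0 where t0: "t0 > 0" and small: "\<And>t \<sigma> z w. \<lbrakk>0 < t; t < t0; \<sigma> \<in> {1, -1};
      lcp_sol K R (\<lambda>j. p j + \<sigma> * t * v j) z w\<rbrakk> \<Longrightarrow> sum z K < \<delta> / 4"
    by blast
  define t where "t = min (t0 / 2) (min (\<epsilon> / 4) (\<delta> / (2 * C)))"
  have t: "0 < t" "t < t0" "t \<le> \<epsilon> / 4"
    using t0 \<epsilon> \<delta> C unfolding t_def by (simp, simp, intro min.coboundedI2 min.cobounded1)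
  have "t \<le> \<delta> / (2 * C)" unfolding t_def by (rule min.coboundedI2, rule min.cobounded2)
  then have "C * t \<le> C * (\<delta> / (2 * C))" using C by (intro mult_left_mono) auto
  then have tC: "C * t \<le> \<delta> / 2" using C by simp
  have branch: "\<exists>Y. (\<forall>i\<in>K. 0 \<le> Y i) \<and> (\<forall>i\<in>K - A. Y i = 0) \<and> t \<le> sum Y K \<and>
      (\<forall>j\<in>A. \<bar>\<sigma> * t * v j + (\<Sum>i\<in>K. Y i * R i j)\<bar> \<le> \<epsilon>' * (L + 1) * t)" if \<sigma>: "\<sigma> \<in> {1, -1}" for \<sigma>
  proof -
    obtain z w where zw: "lcp_sol K R (\<lambda>j. p j + \<sigma> * t * v j) z w" using Q by blast
    have z: "\<forall>i\<in>K. 0 \<le> z i" using zw by (simp add: lcp_sol_def)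
    have w: "w j = p j + \<sigma> * t * v j + (\<Sum>i\<in>K. z i * R i j)" if "j \<in> K" for j
      using zw that by (simp add: lcp_sol_def)
    have z_lt: "sum z K < \<delta> / 4" using small[OF t(1,2) \<sigma> zw] .
    have z_ge: "t \<le> sum z K"
    proof -
      \<comment> \<open>At coordinate \<open>c\<close> the perturbed point equals
        \<open>- t\<close>. Entries of absolute value at most \<open>1\<close> have to lift it to a
        nonnegative value, which costs mass at least \<open>t\<close>.\<close>
      define c where "c = (if \<sigma> = 1 then b else a)"
      have c: "c \<in> A" "c \<in> K" "\<sigma> * v c = -1" using a b \<sigma> AK by (auto simp: c_def v_def)
      have "\<bar>\<Sum>i\<in>K. z i * R i c\<bar> \<le> sum z K" using abs_column_sum_le[of K R c z] z R_le c by auto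
      moreover have "0 \<le> w c" using zw c(2) unfolding lcp_sol_def by blast
      moreover have "\<sigma> * t * v c = - t" using c(3) by (metis mult.commute mult.left_commute mult_minus1)
      ultimately show ?thesis using w[OF c(2)] pA[OF c(1)] by linarith
    qed
    obtain i where "i \<in> K" "z i > 0" using z_ge t(1) by (meson less_le_trans not_less sum_nonpos)
    then have wbd: "orthant_bd K w" using zw by (fastforce simp: lcp_sol_def orthant_bd_def)
    have "\<bar>\<sigma> * t * v j\<bar> \<le> t" for j using \<sigma> t(1) by (auto simp: v_def)
    then have path1: "lcp_path K R p z t w"
      using zw wbd t(1) by (intro lcp_path_single[where d = "\<lambda>j. \<sigma> * t * v j"]) auto
    obtain Z e u where path2: "lcp_path K R w Z e u" and alt:
      "(sum Z K \<ge> L * t \<and> e \<le> \<epsilon>' * sum Z K \<and> e \<le> \<epsilon>' * (L * t + 1)) \<or>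
      (sum Z K < L * t \<and> e \<le> \<epsilon>' * sum Z K + \<epsilon>' * t \<and> \<not> extendable K R u)"
      using maximal_path[OF wbd \<epsilon>'(1), of "\<epsilon>' * t" "L * t"] \<epsilon>' t L by auto
    define Y where "Y i = z i + Z i" for i
    have path: "lcp_path K R p Y (t + e) u"
      unfolding Y_def using lcp_path_trans[OF path2 path1] .
    have sumY: "sum Y K = sum z K + sum Z K" by (simp add: Y_def sum.distrib)
    note nn = lcp_path_nonneg[OF path] lcp_path_nonneg[OF path2]
    \<comment> \<open>A long continuation would be a path from \<open>p\<close> that meets the
      bounds for \<open>\<epsilon>\<close>, contrary to the choice of
      \<open>\<epsilon>\<close>.\<close>
    have notfar: "\<not> sum Z K \<ge> L * t"
    proof
      assume far: "sum Z K \<ge> L * t"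
      then have e: "e \<le> \<epsilon>' * sum Z K" "e \<le> \<epsilon>' * (L * t + 1)" using alt by linarith+
      have "8 * t \<le> \<epsilon> * sum Z K" using far \<epsilon> by (simp add: L_def field_simps)
      moreover have "\<epsilon>' * sum Z K \<le> \<epsilon> / 4 * sum Z K"
        using \<epsilon>'(2) nn by (intro mult_right_mono) auto
      moreover have "\<epsilon> * sum Z K \<ge> 0" "\<epsilon> * sum z K \<ge> 0" using \<epsilon> nn z_ge t by auto
      moreover have "\<epsilon> * sum Y K = \<epsilon> * sum z K + \<epsilon> * sum Z K"
        unfolding sumY by (simp add: distrib_left)
      moreover have "\<epsilon> / 4 * sum Z K = (\<epsilon> * sum Z K) / 4" by simp
      ultimately have "t + e \<le> \<epsilon> * sum Y K" using e(1) by linarith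
      moreover have "0 < sum Y K" using sumY z_ge t(1) nn by linarith
      moreover have "\<epsilon>' * (L * t + 1) \<le> \<epsilon> / 4 * (L * t + 1)"
        using \<epsilon>'(2) L t by (intro mult_right_mono) auto
      moreover have "\<epsilon> / 4 * (L * t + 1) = 2 * t + \<epsilon> / 4" using \<epsilon> by (simp add: L_def field_simps)
      ultimately show False using none[OF path] e(2) t(3) by linarith
    qed
    then have near: "sum Z K < L * t" "e \<le> \<epsilon>' * sum Z K + \<epsilon>' * t" and une: "\<not> extendable K R u"
      using alt by auto
    have "\<epsilon>' * sum Z K \<le> \<epsilon>' * (L * t)" using near \<epsilon>' by (intro mult_left_mono) auto
    then have e: "e \<le> \<epsilon>' * (L + 1) * t" using near(2) by (simp add: algebra_simps)
    have "t + e + sum Y K < \<delta>"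
    proof -
      have "t + \<epsilon>' * (L + 1) * t + L * t = C * t" by (simp add: C_def algebra_simps)
      then show ?thesis using e near(1) z_lt tC sumY \<delta>(1) by linarith
    qed
    then have lt: "t + e + sum Y K < p j" if "j \<in> K - A" for j using \<delta>(2)[OF that] by linarith
    have Y0: "\<forall>i\<in>K - A. Y i = 0" using path_support[OF path] lt by blast
    have "u j > 0" if "j \<in> K - A" for j using path_dist[OF path, of j] lt[OF that] that by auto
    then have sub: "{j\<in>K. u j = 0} \<subseteq> A" by force
    \<comment> \<open>A point with fewer zeros would be extendable by the induction hypothesis, but
      \<open>u\<close> is not; so its zero set is all of \<open>A\<close>.\<close>
    have "\<not> card {j\<in>K. u j = 0} < card A"
      using IH[of u] une lcp_path_orthant_bd[OF path p] unfolding A_def by blast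
    then have "{j\<in>K. u j = 0} = A" using sub finA by (meson card_seteq not_less)
    then have uA: "u j = 0" if "j \<in> A" for j using that by blast
    obtain D where D: "\<And>j. j \<in> K \<Longrightarrow> \<bar>D j\<bar> \<le> e \<and> u j = w j + D j + (\<Sum>i\<in>K. Z i * R i j)"
      using lcp_path_end[OF path2] by blast
    have "\<bar>\<sigma> * t * v j + (\<Sum>i\<in>K. Y i * R i j)\<bar> \<le> \<epsilon>' * (L + 1) * t" if "j \<in> A" for j
    proof -
      have "j \<in> K" using that AK by blast
      have "(\<Sum>i\<in>K. Y i * R i j) = (\<Sum>i\<in>K. z i * R i j) + (\<Sum>i\<in>K. Z i * R i j)"
        by (simp add: Y_def distrib_right sum.distrib)
      then have "\<sigma> * t * v j + (\<Sum>i\<in>K. Y i * R i j) = - D j"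
        using w[OF \<open>j \<in> K\<close>] D[OF \<open>j \<in> K\<close>] uA[OF that] pA[OF that] by linarith
      then show ?thesis using D[OF \<open>j \<in> K\<close>] e by simp
    qed
    moreover have "t \<le> sum Y K" using sumY z_ge nn by linarith
    ultimately show ?thesis using Y0 nn(2) by blast
  qed
  obtain Y1 where Y1: "\<forall>i\<in>K. 0 \<le> Y1 i" "\<forall>i\<in>K - A. Y1 i = 0" "t \<le> sum Y1 K"
      "\<And>j. j \<in> A \<Longrightarrow> \<bar>1 * t * v j + (\<Sum>i\<in>K. Y1 i * R i j)\<bar> \<le> \<epsilon>' * (L + 1) * t"
    using branch[of 1] by blast
  obtain Y2 where Y2: "\<forall>i\<in>K. 0 \<le> Y2 i" "\<forall>i\<in>K - A. Y2 i = 0" "t \<le> sum Y2 K"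
      "\<And>j. j \<in> A \<Longrightarrow> \<bar>-1 * t * v j + (\<Sum>i\<in>K. Y2 i * R i j)\<bar> \<le> \<epsilon>' * (L + 1) * t"
    using branch[of "-1"] by blast
  \<comment> \<open>\<open>Y1 + Y2\<close> has mass at least \<open>2 * t\<close>, while on
    \<open>A\<close> its mixture is at most
    \<open>2 * \<epsilon>' * (L + 1) * t \<le> \<kappa> * t\<close>, half of what the gap
    requires.\<close>
  have "\<exists>j\<in>A. \<kappa> * (\<Sum>i\<in>K. Y1 i + Y2 i) \<le> \<bar>\<Sum>i\<in>K. (Y1 i + Y2 i) * R i j\<bar>"
    using Y1(1,2) Y2(1,2) by (intro gap) auto
  then obtain j where j: "j \<in> A" "\<kappa> * (\<Sum>i\<in>K. Y1 i + Y2 i) \<le> \<bar>\<Sum>i\<in>K. (Y1 i + Y2 i) * R i j\<bar>" by blast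
  have "\<kappa> * (2 * t) \<le> \<kappa> * (\<Sum>i\<in>K. Y1 i + Y2 i)"
    using Y1(3) Y2(3) \<kappa> by (intro mult_left_mono) (auto simp: sum.distrib)
  moreover have "\<epsilon>' * (L + 1) * t \<le> \<kappa> / 2 * t" using \<epsilon>'\<kappa> t by (intro mult_right_mono) auto
  moreover have "(\<Sum>i\<in>K. (Y1 i + Y2 i) * R i j) = (\<Sum>i\<in>K. Y1 i * R i j) + (\<Sum>i\<in>K. Y2 i * R i j)"
    by (simp add: distrib_right sum.distrib)
  moreover have "\<kappa> * t > 0" using \<kappa> t by simp
  ultimately show False using j(2) Y1(4)[OF j(1)] Y2(4)[OF j(1)] by (simp add: abs_le_iff) linarith
qed

lemma extendable: "orthant_bd K p \<Longrightarrow> extendable K R p"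
proof (induction "card {j\<in>K. p j = 0}" arbitrary: p rule: less_induct)
  case less
  then show ?case using extendable_if_smaller_zero_sets by blast
qed

lemma long_path:
  assumes "orthant_bd K p" "0 < L" "0 < \<delta>"
  shows "\<exists>Z e u. lcp_path K R p Z e u \<and> L \<le> sum Z K \<and> e \<le> \<delta>"
proof -
  have "0 < \<delta> / (L + 1)" using assms by simp
  from maximal_path[OF assms(1) this zero_less_one assms(2)]
  obtain Z e u where Z: "lcp_path K R p Z e u" and
    "(sum Z K \<ge> L \<and> e \<le> \<delta> / (L + 1) * (L + 1)) \<or> \<not> extendable K R u"
    by blast
  moreover have "extendable K R u" using extendable lcp_path_orthant_bd Z assms(1) by blast
  ultimately have "L \<le> sum Z K" "e \<le> \<delta>" using assms by auto
  then show ?thesis using Z by blast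
qed

end

section \<open>Payoffs of quitting games\<close>

text \<open>Expectation of \<open>f\<close> at the random set of quitters when the members of
  \<open>A\<close> quit independently with probabilities \<open>x\<close>. The set \<open>A\<close>
  is arbitrary so that single players can be split off.\<close>

definition stage_val :: "'a set \<Rightarrow> ('a \<Rightarrow> real) \<Rightarrow> ('a set \<Rightarrow> real) \<Rightarrow> real" where
  "stage_val A x f = (\<Sum>S\<in>Pow A. (\<Prod>i\<in>S. x i) * (\<Prod>i\<in>A - S. 1 - x i) * f S)"

lemma stage_val_empty [simp]: "stage_val {} x f = f {}"
  by (simp add: stage_val_def)

text \<open>Conditioning on whether \<open>j\<close> quits. This recursion drives the inductive
  evaluations and expansions below.\<close>

lemma stage_val_insert:
  assumes "finite A" "j \<notin> A"
  shows "stage_val (insert j A) x f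
    = (1 - x j) * stage_val A x f + x j * stage_val A x (\<lambda>S. f (insert j S))"
proof -
  let ?p = "\<lambda>B S. (\<Prod>i\<in>S. x i) * (\<Prod>i\<in>B - S. 1 - x i)"
  have "stage_val (insert j A) x f = (\<Sum>S\<in>Pow A. ?p (insert j A) S * f S)
      + (\<Sum>S\<in>insert j ` Pow A. ?p (insert j A) S * f S)"
    unfolding stage_val_def Pow_insert using assms by (intro sum.union_disjoint) auto
  also have "(\<Sum>S\<in>insert j ` Pow A. ?p (insert j A) S * f S)
      = (\<Sum>S\<in>Pow A. ?p (insert j A) (insert j S) * f (insert j S))"
    using assms(2) by (intro sum.reindex[unfolded o_def] inj_onI) (auto simp: insert_ident)
  also have "(\<Sum>S\<in>Pow A. ?p (insert j A) S * f S) = (1 - x j) * stage_val A x f"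
    unfolding stage_val_def sum_distrib_left
  proof (intro sum.cong refl)
    fix S assume S: "S \<in> Pow A"
    then have "insert j A - S = insert j (A - S)" "j \<notin> A - S" using assms by auto
    then show "?p (insert j A) S * f S = (1 - x j) * (?p A S * f S)" using assms by simp
  qed
  also have "(\<Sum>S\<in>Pow A. ?p (insert j A) (insert j S) * f (insert j S))
      = x j * stage_val A x (\<lambda>S. f (insert j S))"
    unfolding stage_val_def sum_distrib_left
  proof (intro sum.cong refl)
    fix S assume S: "S \<in> Pow A"
    then have "insert j A - insert j S = A - S" "j \<notin> S" "finite S"
      using assms by (auto intro: finite_subset)
    then show "?p (insert j A) (insert j S) * f (insert j S) = x j * (?p A S * f (insert j S))" by simp
  qed
  finally show ?thesis .
qed

lemma stage_val_remove:
  assumes "finite A" "j \<in> A"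
  shows "stage_val A x f
    = (1 - x j) * stage_val (A - {j}) x f + x j * stage_val (A - {j}) x (\<lambda>S. f (insert j S))"
  using stage_val_insert[of "A - {j}" j x f] assms by (simp add: insert_absorb)

lemma stage_val_cong:
  assumes "\<And>i. i \<in> A \<Longrightarrow> x i = y i" "\<And>S. S \<subseteq> A \<Longrightarrow> f S = g S"
  shows "stage_val A x f = stage_val A y g"
  unfolding stage_val_def
proof (intro sum.cong refl)
  fix S assume "S \<in> Pow A"
  then have "(\<Prod>i\<in>S. x i) = (\<Prod>i\<in>S. y i)" "(\<Prod>i\<in>A - S. 1 - x i) = (\<Prod>i\<in>A - S. 1 - y i)" "f S = g S"
    using assms by (auto intro!: prod.cong)
  then show "(\<Prod>i\<in>S. x i) * (\<Prod>i\<in>A - S. 1 - x i) * f S = (\<Prod>i\<in>S. y i) * (\<Prod>i\<in>A - S. 1 - y i) * g S"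
    by simp
qed

lemma stage_val_const:
  assumes "finite A"
  shows "stage_val A x (\<lambda>_. c) = c"
  using assms by induction (simp_all add: stage_val_insert algebra_simps)

lemma stage_val_zero:
  assumes "finite A" "\<And>i. i \<in> A \<Longrightarrow> x i = 0"
  shows "stage_val A x f = f {}"
  using assms by (induction arbitrary: f) (auto simp: stage_val_insert)

lemma stage_val_one_active:
  assumes "finite A" "j \<in> A" "\<And>l. l \<in> A \<Longrightarrow> l \<noteq> j \<Longrightarrow> x l = 0"
  shows "stage_val A x f = (1 - x j) * f {} + x j * f {j}"
proof -
  have "stage_val (A - {j}) x g = g {}" for g using assms by (intro stage_val_zero) auto
  then show ?thesis using assms(1,2) by (subst stage_val_remove[of _ j]) simp_all
qed

lemma stage_val_mono:
  assumes "\<And>i. i \<in> A \<Longrightarrow> 0 \<le> x i \<and> x i \<le> 1" "\<And>S. S \<subseteq> A \<Longrightarrow> f S \<le> g S"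
  shows "stage_val A x f \<le> stage_val A x g"
  unfolding stage_val_def using assms
  by (intro sum_mono mult_left_mono mult_nonneg_nonneg prod_nonneg) auto

lemma stage_val_uminus: "stage_val A x (\<lambda>S. - f S) = - stage_val A x f"
  by (simp add: stage_val_def sum_negf)

text \<open>Turns one stage into a one-shot game in which unanimous continuation is worth
  \<open>c\<close>.\<close>

definition with_cont :: "(nat set \<Rightarrow> nat \<Rightarrow> real) \<Rightarrow> nat \<Rightarrow> real \<Rightarrow> nat set \<Rightarrow> real" where
  "with_cont r j c S = (if S = {} then c else r S j)"

lemma stage_val_others_idle:
  assumes "i < N" "\<And>l. l < N \<Longrightarrow> l \<noteq> i \<Longrightarrow> x l = 0"
  shows "stage_val {..<N} x (with_cont \<rho> i V) = (1 - x i) * V + x i * \<rho> {i} i"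
  using assms by (subst stage_val_one_active[of _ i]) (auto simp: with_cont_def)

lemma stage_val_two_active:
  assumes "i < N" "j < N" "j \<noteq> i" "\<And>l. l < N \<Longrightarrow> l \<noteq> i \<Longrightarrow> l \<noteq> j \<Longrightarrow> x l = 0"
  shows "stage_val {..<N} x (with_cont \<rho> i V) = (1 - x i) * ((1 - x j) * V + x j * \<rho> {j} i)
    + x i * ((1 - x j) * \<rho> {i} i + x j * \<rho> {i, j} i)"
proof -
  have "stage_val ({..<N} - {i}) x f = (1 - x j) * f {} + x j * f {j}" for f
    using assms by (intro stage_val_one_active) auto
  then show ?thesis using assms(1) by (subst stage_val_remove[of _ i]) (simp_all add: with_cont_def)
qed

definition stage_payoff :: "nat \<Rightarrow> (nat set \<Rightarrow> nat \<Rightarrow> real) \<Rightarrow> (nat \<Rightarrow> nat \<Rightarrow> real) \<Rightarrow> nat \<Rightarrow> nat \<Rightarrow> real" where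
  "stage_payoff N r x j t = (\<Sum>S\<in>Pow {..<N} - {{}}. quit_prob N x t S * r S j)"

text \<open>The link between the payoff series and one-shot games; the potential arguments for fixed
  profiles and for sunspots both rest on it.\<close>

lemma stage_payoff_cont:
  "stage_payoff N r x j t + cont_prob N x (Suc t) * c
    = cont_prob N x t * stage_val {..<N} (\<lambda>i. x i t) (with_cont r j c)"
proof -
  have "stage_val {..<N} (\<lambda>i. x i t) (with_cont r j c)
      = (\<Prod>i<N. 1 - x i t) * c + (\<Sum>S\<in>Pow {..<N} - {{}}. (\<Prod>i\<in>S. x i t) * (\<Prod>i\<in>{..<N} - S. 1 - x i t) * r S j)"
    unfolding stage_val_def by (subst sum.remove[of _ "{}"]) (auto simp: with_cont_def intro!: sum.cong)
  then show ?thesis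
    by (simp add: stage_payoff_def quit_prob_def cont_prob_def sum_distrib_left algebra_simps)
qed

lemma profileD: "profile N x \<Longrightarrow> i < N \<Longrightarrow> 0 \<le> x i t \<and> x i t \<le> 1"
  by (simp add: profile_def strat_def)

lemma cont_prob_0 [simp]: "cont_prob N x 0 = 1"
  by (simp add: cont_prob_def)

lemma cont_prob_Suc: "cont_prob N x (Suc t) = cont_prob N x t * (\<Prod>i<N. 1 - x i t)"
  by (simp add: cont_prob_def)

lemma cont_prob_bounds:
  assumes "profile N x"
  shows "0 \<le> cont_prob N x t" "cont_prob N x t \<le> 1" "cont_prob N x (Suc t) \<le> cont_prob N x t"
proof -
  have *: "0 \<le> (\<Prod>i<N. 1 - x i s)" "(\<Prod>i<N. 1 - x i s) \<le> 1" for s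
    using profileD[OF assms] by (auto intro!: prod_nonneg prod_le_1)
  show 0: "0 \<le> cont_prob N x t" unfolding cont_prob_def by (rule prod_nonneg) (rule *(1))
  show "cont_prob N x t \<le> 1" unfolding cont_prob_def by (rule prod_le_1) (rule conjI[OF *])
  show "cont_prob N x (Suc t) \<le> cont_prob N x t"
    unfolding cont_prob_Suc using * 0 by (intro mult_left_le) auto
qed

lemma cont_prob_tendsto_lim:
  assumes "profile N x"
  shows "cont_prob N x \<longlonglongrightarrow> lim (cont_prob N x)"
proof -
  have "decseq (cont_prob N x)" using cont_prob_bounds(3)[OF assms] by (rule decseq_SucI)
  then have "convergent (cont_prob N x)"
    using cont_prob_bounds(1)[OF assms] decseq_convergent[of "cont_prob N x" 0] convergentI by metis
  then show ?thesis by (simp add: convergent_LIMSEQ_iff)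
qed

text \<open>The right-hand side is the probability that play stops at stage \<open>t\<close>. It
  telescopes, which gives summability and the truncation estimate.\<close>

lemma stage_payoff_bound:
  assumes "profile N x" "payoffs_ok N r" "j < N"
  shows "\<bar>stage_payoff N r x j t\<bar> \<le> cont_prob N x t - cont_prob N x (Suc t)"
proof -
  let ?x = "\<lambda>i. x i t"
  have x: "\<And>i. i \<in> {..<N} \<Longrightarrow> 0 \<le> ?x i \<and> ?x i \<le> 1" using profileD[OF assms(1)] by auto
  have one: "stage_val {..<N} ?x (\<lambda>S. if S = {} then 0 else 1) = 1 - (\<Prod>i<N. 1 - x i t)"
  proof -
    have "stage_val {..<N} ?x (\<lambda>S. 1) = (\<Prod>i<N. 1 - x i t) + stage_val {..<N} ?x (\<lambda>S. if S = {} then 0 else 1)"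
      unfolding stage_val_def by (subst (1 2) sum.remove[of _ "{}"]) (auto intro!: sum.cong)
    then show ?thesis by (simp add: stage_val_const)
  qed
  have r: "-1 \<le> r S j" "r S j \<le> 1" if "S \<subseteq> {..<N}" for S
    using assms(2,3) that by (auto simp: payoffs_ok_def)
  have "stage_val {..<N} ?x (with_cont r j 0) \<le> stage_val {..<N} ?x (\<lambda>S. if S = {} then 0 else 1)"
    using r by (intro stage_val_mono x) (auto simp: with_cont_def)
  moreover have "stage_val {..<N} ?x (\<lambda>S. - (if S = {} then 0 else 1)) \<le> stage_val {..<N} ?x (with_cont r j 0)"
    using r by (intro stage_val_mono x) (auto simp: with_cont_def)
  ultimately have "\<bar>stage_val {..<N} ?x (with_cont r j 0)\<bar> \<le> 1 - (\<Prod>i<N. 1 - x i t)"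
    using one by (simp add: stage_val_uminus)
  moreover have "stage_payoff N r x j t = cont_prob N x t * stage_val {..<N} ?x (with_cont r j 0)"
    using stage_payoff_cont[of N r x j t 0] by simp
  moreover have "cont_prob N x t - cont_prob N x (Suc t) = cont_prob N x t * (1 - (\<Prod>i<N. 1 - x i t))"
    by (simp add: cont_prob_Suc algebra_simps)
  ultimately show ?thesis
    using cont_prob_bounds(1)[OF assms(1), of t] by (simp add: abs_mult mult_left_mono)
qed

lemma stage_payoff_summable:
  assumes "profile N x" "payoffs_ok N r" "j < N"
  shows "summable (stage_payoff N r x j)"
proof (rule summable_comparison_test')
  have "(\<lambda>t. cont_prob N x (Suc t) - cont_prob N x t) sums (lim (cont_prob N x) - cont_prob N x 0)"
    using telescope_sums[OF cont_prob_tendsto_lim[OF assms(1)]] .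
  then have "(\<lambda>t. - (cont_prob N x (Suc t) - cont_prob N x t)) sums - (lim (cont_prob N x) - cont_prob N x 0)"
    by (rule sums_minus)
  then show "summable (\<lambda>t. cont_prob N x t - cont_prob N x (Suc t))" by (auto simp: sums_iff)
  show "norm (stage_payoff N r x j t) \<le> cont_prob N x t - cont_prob N x (Suc t)" for t
    using stage_payoff_bound[OF assms] by simp
qed

lemma gamma_le_truncated:
  assumes "profile N x" "payoffs_ok N r" "j < N"
  shows "gamma N r x j \<le> (\<Sum>t<T. stage_payoff N r x j t) + cont_prob N x T"
proof -
  let ?c = "cont_prob N x"
  have "(\<lambda>n. ?c (Suc n + T) - ?c (n + T)) sums (lim ?c - ?c (0 + T))"
    using telescope_sums[of "\<lambda>n. ?c (n + T)" "lim ?c"] cont_prob_tendsto_lim[OF assms(1)]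
    by (simp add: LIMSEQ_ignore_initial_segment del: add_Suc)
  from sums_minus[OF this] have tail: "(\<lambda>n. ?c (n + T) - ?c (Suc (n + T))) sums (?c T - lim ?c)" by simp
  have sm: "summable (stage_payoff N r x j)" by (rule stage_payoff_summable[OF assms])
  have "(\<Sum>t. stage_payoff N r x j t) = (\<Sum>t. stage_payoff N r x j (t + T)) + (\<Sum>t<T. stage_payoff N r x j t)"
    using sm by (rule suminf_split_initial_segment)
  moreover have "(\<Sum>t. stage_payoff N r x j (t + T)) \<le> (\<Sum>n. ?c (n + T) - ?c (Suc (n + T)))"
  proof (rule suminf_le)
    show "stage_payoff N r x j (n + T) \<le> ?c (n + T) - ?c (Suc (n + T))" for n
      using stage_payoff_bound[OF assms, of "n + T"] by linarith
    show "summable (\<lambda>n. stage_payoff N r x j (n + T))" using sm by (simp add: summable_iff_shift)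
    show "summable (\<lambda>n. ?c (n + T) - ?c (Suc (n + T)))" using tail by (rule sums_summable)
  qed
  moreover have "(\<Sum>n. ?c (n + T) - ?c (Suc (n + T))) = ?c T - lim ?c" using tail by (rule sums_unique[symmetric])
  moreover have "lim ?c * r {} j \<le> lim ?c"
  proof -
    have "0 \<le> lim ?c"
      using cont_prob_bounds(1)[OF assms(1)] by (intro LIMSEQ_le_const[OF cont_prob_tendsto_lim[OF assms(1)]]) auto
    moreover have "r {} j \<le> 1" using assms(2,3) by (auto simp: payoffs_ok_def)
    ultimately show ?thesis by (simp add: mult_left_le)
  qed
  ultimately show ?thesis unfolding gamma_def stage_payoff_def by linarith
qed

lemma payoffs_ok_uminus: "payoffs_ok N r \<Longrightarrow> payoffs_ok N (\<lambda>S j. - r S j)"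
  by (auto simp: payoffs_ok_def minus_le_iff)

text \<open>Lower bounds on payoffs are obtained as upper bounds in the game with negated
  payoffs.\<close>

lemma gamma_uminus:
  assumes "profile N x" "payoffs_ok N r" "j < N"
  shows "gamma N (\<lambda>S j. - r S j) x j = - gamma N r x j"
proof -
  have "stage_payoff N (\<lambda>S j. - r S j) x j = (\<lambda>t. - stage_payoff N r x j t)"
    by (simp add: stage_payoff_def sum_negf fun_eq_iff)
  moreover have "(\<Sum>t. - stage_payoff N r x j t) = - (\<Sum>t. stage_payoff N r x j t)"
    by (rule suminf_minus[OF stage_payoff_summable[OF assms]])
  ultimately show ?thesis unfolding gamma_def stage_payoff_def by (simp add: fun_eq_iff)
qed

lemma gamma_bounds:
  assumes "profile N x" "payoffs_ok N r" "j < N"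
  shows "\<bar>gamma N r x j\<bar> \<le> 1"
  using gamma_le_truncated[OF assms, of 0]
    gamma_le_truncated[OF assms(1) payoffs_ok_uminus[OF assms(2)] assms(3), of 0] gamma_uminus[OF assms]
  by simp

text \<open>The payoff collected so far plus \<open>V\<close> times the continuation probability is a supermartingale.\<close>
lemma gamma_le_of_stage_le:
  assumes "profile N x" "payoffs_ok N r" "j < N"
    and step: "\<And>t. stage_val {..<N} (\<lambda>i. x i t) (with_cont r j V) \<le> V"
    and abs: "cont_prob N x \<longlonglongrightarrow> 0"
  shows "gamma N r x j \<le> V"
proof (rule LIMSEQ_le_const)
  have "(\<Sum>t<T. stage_payoff N r x j t) + cont_prob N x T * V \<le> V" for T
  proof (induction T)
    case (Suc T)
    have "cont_prob N x T * stage_val {..<N} (\<lambda>i. x i T) (with_cont r j V) \<le> cont_prob N x T * V"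
      using cont_prob_bounds(1)[OF assms(1)] step by (rule mult_left_mono[rotated])
    then show ?case using Suc stage_payoff_cont[of N r x j T V] by simp
  qed simp
  then have "gamma N r x j \<le> V + cont_prob N x T * (1 - V)" for T
    using gamma_le_truncated[OF assms(1-3), of T] unfolding right_diff_distrib by (smt (verit) mult.right_neutral)
  then show "\<exists>T0. \<forall>T\<ge>T0. gamma N r x j \<le> V + cont_prob N x T * (1 - V)" by blast
  show "(\<lambda>T. V + cont_prob N x T * (1 - V)) \<longlonglongrightarrow> V"
    using tendsto_add[OF tendsto_const tendsto_mult_left_zero[OF abs]] by fastforce
qed

section \<open>The signal space and measurability of payoffs\<close>

abbreviation unif :: "real measure" where
  "unif \<equiv> uniform_measure lborel {0..1}"

lemma prob_space_unif: "prob_space unif"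
  by (rule prob_space_uniform_measure) auto

lemma sequence_space_unif: "sequence_space unif"
proof -
  interpret prob_space unif by (rule prob_space_unif)
  show ?thesis by unfold_locales
qed

lemma prob_space_signal_space: "prob_space signal_space"
  unfolding signal_space_def by (intro prob_space_PiM prob_space_unif)

lemma sets_signal_space: "sets signal_space = sets (PiM UNIV (\<lambda>_. borel))"
  unfolding signal_space_def by (rule sets_PiM_cong) auto

lemma space_signal_space [simp]: "space signal_space = UNIV"
  unfolding signal_space_def by (simp add: space_PiM)

lemma measurable_signal [measurable]: "(\<lambda>w. w t) \<in> borel_measurable signal_space"
  unfolding measurable_cong_sets[OF sets_signal_space refl] by measurable

lemma integral_signal_component:
  fixes h :: "real \<Rightarrow> real"
  assumes [measurable]: "h \<in> borel_measurable borel"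
  shows "(\<integral>w. h (w t) \<partial>signal_space) = (\<integral>u. h u \<partial>unif)"
proof -
  interpret sequence_space unif by (rule sequence_space_unif)
  have h: "h \<in> borel_measurable unif"
    unfolding measurable_cong_sets[OF sets_uniform_measure refl] using assms by simp
  have "distr S unif (\<lambda>w. w t) = unif" by (rule PiM_component) simp
  then have "(\<integral>u. h u \<partial>unif) = (\<integral>u. h u \<partial>distr S unif (\<lambda>w. w t))" by simp
  also have "\<dots> = (\<integral>w. h (w t) \<partial>S)" by (rule integral_distr) (use h in simp_all)
  finally show ?thesis by (simp add: signal_space_def)
qed

text \<open>The signal at stage \<open>t\<close> is independent of the past. Cutting at
  \<open>t\<close> with \<open>comb_seq\<close> represents the signals by two independent sequences,
  of which \<open>f\<close> sees only the first and \<open>h\<close> only the head of the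
  second.\<close>

lemma integral_past_times_signal:
  fixes h :: "real \<Rightarrow> real"
  assumes f: "f \<in> borel_measurable signal_space" "\<And>w. \<bar>f w\<bar> \<le> B"
    and past: "\<And>w w'. (\<And>s. s < t \<Longrightarrow> w s = w' s) \<Longrightarrow> f w = f w'"
    and h: "h \<in> borel_measurable borel" "\<And>u. \<bar>h u\<bar> \<le> C"
  shows "(\<integral>w. f w * h (w t) \<partial>signal_space) = (\<integral>w. f w \<partial>signal_space) * (\<integral>u. h u \<partial>unif)"
proof -
  interpret sequence_space unif by (rule sequence_space_unif)
  interpret PP: pair_prob_space S S ..
  have f' [measurable]: "f \<in> borel_measurable S" using f(1) by (simp add: signal_space_def)
  have comp [measurable]: "(\<lambda>w. w s) \<in> borel_measurable S" for s
    using measurable_signal by (simp add: signal_space_def)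
  note h(1)[measurable]
  have C: "0 \<le> C" using h(2)[of 0] by linarith
  have B: "0 \<le> B" using f(2)[of undefined] by linarith
  have "(\<integral>w. f w * h (w t) \<partial>S) = (\<integral>w. f w * h (w t) \<partial>distr (S \<Otimes>\<^sub>M S) S (\<lambda>(w, w'). comb_seq t w w'))"
    by (simp add: PiM_comb_seq)
  also have "\<dots> = (\<integral>x. f (comb_seq t (fst x) (snd x)) * h (comb_seq t (fst x) (snd x) t) \<partial>(S \<Otimes>\<^sub>M S))"
    by (subst integral_distr) (auto simp: split_beta')
  also have "\<dots> = (\<integral>x. f (fst x) * h (snd x 0) \<partial>(S \<Otimes>\<^sub>M S))"
  proof (intro Bochner_Integration.integral_cong refl)
    fix x :: "(nat \<Rightarrow> real) \<times> (nat \<Rightarrow> real)"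
    have "f (comb_seq t (fst x) (snd x)) = f (fst x)" by (rule past) (simp add: comb_seq_def)
    then show "f (comb_seq t (fst x) (snd x)) * h (comb_seq t (fst x) (snd x) t) = f (fst x) * h (snd x 0)"
      by (simp add: comb_seq_def)
  qed
  also have "\<dots> = (\<integral>x. \<integral>y. f x * h (y 0) \<partial>S \<partial>S)"
  proof -
    have "integrable (S \<Otimes>\<^sub>M S) (\<lambda>x. f (fst x) * h (snd x 0))"
    proof (rule PP.integrable_const_bound[of _ "B * C"])
      show "AE x in S \<Otimes>\<^sub>M S. norm (f (fst x) * h (snd x 0)) \<le> B * C"
        using f(2) h(2) B C by (intro AE_I2) (auto simp: abs_mult intro: mult_mono)
    qed simp
    from PP.integral_fst'[OF this] show ?thesis by simp
  qed
  also have "\<dots> = (\<integral>x. f x \<partial>S) * (\<integral>y. h (y 0) \<partial>S)" by simp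
  finally show ?thesis using integral_signal_component[OF h(1)] by (simp add: signal_space_def)
qed

lemma measurable_gamma:
  assumes "\<And>i t. i < N \<Longrightarrow> (\<lambda>w. x i t w) \<in> borel_measurable M"
  shows "(\<lambda>w. cont_prob N (\<lambda>i t. x i t w) t) \<in> borel_measurable M"
    and "(\<lambda>w. stage_payoff N r (\<lambda>i t. x i t w) j t) \<in> borel_measurable M"
    and "(\<lambda>w. gamma N r (\<lambda>i t. x i t w) j) \<in> borel_measurable M"
proof -
  show c: "(\<lambda>w. cont_prob N (\<lambda>i t. x i t w) t) \<in> borel_measurable M" for t
    unfolding cont_prob_def using assms by (intro borel_measurable_prod borel_measurable_diff) auto
  show s: "(\<lambda>w. stage_payoff N r (\<lambda>i t. x i t w) j t) \<in> borel_measurable M" for t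
    unfolding stage_payoff_def quit_prob_def
    using assms by (intro borel_measurable_sum borel_measurable_times c borel_measurable_prod
        borel_measurable_diff borel_measurable_const) auto
  have l: "(\<lambda>w. lim (cont_prob N (\<lambda>i t. x i t w))) \<in> borel_measurable M"
    using borel_measurable_lim_metric[of "\<lambda>t w. cont_prob N (\<lambda>i t. x i t w) t" M] c by simp
  have "(\<lambda>w. (\<Sum>t. stage_payoff N r (\<lambda>i t. x i t w) j t) + lim (cont_prob N (\<lambda>i t. x i t w)) * r {} j)
      \<in> borel_measurable M"
    by (intro borel_measurable_add borel_measurable_suminf s borel_measurable_times l borel_measurable_const)
  then show "(\<lambda>w. gamma N r (\<lambda>i t. x i t w) j) \<in> borel_measurable M"
    by (simp add: gamma_def stage_payoff_def)
qed

lemma sunspot_profileD: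
  assumes "sunspot_profile N \<xi>"
  shows "profile N (\<lambda>i t. \<xi> i t w)"
    and "i < N \<Longrightarrow> \<xi> i t \<in> borel_measurable signal_space"
    and "i < N \<Longrightarrow> (\<And>s. s \<le> t \<Longrightarrow> w s = w' s) \<Longrightarrow> \<xi> i t w = \<xi> i t w'"
  using assms unfolding sunspot_profile_def sunspot_strat_def profile_def strat_def by blast+

lemma gamma_sunspot_uminus:
  assumes "sunspot_profile N \<xi>" "payoffs_ok N r" "j < N"
  shows "gamma_sunspot N (\<lambda>S j. - r S j) \<xi> j = - gamma_sunspot N r \<xi> j"
  unfolding gamma_sunspot_def using gamma_uminus[OF sunspot_profileD(1)[OF assms(1)] assms(2,3)] by simp

text \<open>Quantile construction: \<open>f u\<close> counts the partial sums of \<open>p\<close>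
  that do not exceed \<open>u\<close>. A value \<open>i < m\<close> is taken on an interval of
  length \<open>p i\<close>, and the missing mass goes to \<open>m\<close>.\<close>

lemma finite_distribution_realizable:
  fixes p :: "nat \<Rightarrow> real"
  assumes p: "\<And>i. i < m \<Longrightarrow> 0 \<le> p i" "(\<Sum>i<m. p i) \<le> 1"
  shows "\<exists>f. f \<in> borel \<rightarrow>\<^sub>M count_space UNIV \<and> (\<forall>u. f u \<le> m) \<and> (\<forall>i<m. measure unif (f -` {i}) = p i)"
proof -
  define c where "c i = (\<Sum>j<i. p j)" for i
  define f where "f u = card {i\<in>{..<m}. c (Suc i) \<le> u}" for u
  have f_sum: "f u = (\<Sum>i<m. if c (Suc i) \<le> u then 1 else 0)" for u
    unfolding f_def by (simp add: sum.If_cases Int_def)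
  have "f \<in> borel \<rightarrow>\<^sub>M count_space UNIV" unfolding f_sum[abs_def] by measurable
  moreover have "f u \<le> m" for u
    unfolding f_def by (rule order_trans[OF card_mono[of "{..<m}"]]) auto
  moreover have "measure unif (f -` {i}) = p i" if i: "i < m" for i
  proof -
    have mono: "c a \<le> c b" if "a \<le> b" "b \<le> m" for a b
      unfolding c_def using that p(1) by (intro sum_mono2) auto
    have c1: "c b \<le> 1" if "b \<le> m" for b using mono[OF that] p(2) by (simp add: c_def)
    have c0: "0 \<le> c b" if "b \<le> m" for b using mono[of 0 b] that by (simp add: c_def)
    have iff: "f u = i \<longleftrightarrow> c i \<le> u \<and> u < c (Suc i)" if u: "0 \<le> u" for u
    proof
      assume *: "c i \<le> u \<and> u < c (Suc i)"
      have "{k\<in>{..<m}. c (Suc k) \<le> u} = {..<i}"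
      proof (intro equalityI subsetI)
        fix k assume k: "k \<in> {k\<in>{..<m}. c (Suc k) \<le> u}"
        then have "\<not> i \<le> k" using * mono[of "Suc i" "Suc k"] by fastforce
        then show "k \<in> {..<i}" by simp
      next
        fix k assume "k \<in> {..<i}"
        then show "k \<in> {k\<in>{..<m}. c (Suc k) \<le> u}" using * i mono[of "Suc k" i] by fastforce
      qed
      then show "f u = i" by (simp add: f_def)
    next
      assume fi: "f u = i"
      have "c i \<le> u"
      proof (rule ccontr)
        assume less: "\<not> c i \<le> u"
        have "i \<noteq> 0"
        proof
          assume "i = 0"
          then show False using less u by (simp add: c_def)
        qed
        have "{k\<in>{..<m}. c (Suc k) \<le> u} \<subseteq> {..<i - 1}"
        proof
          fix k assume k: "k \<in> {k\<in>{..<m}. c (Suc k) \<le> u}"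
          then have "\<not> i \<le> Suc k" using less mono[of i "Suc k"] by fastforce
          then show "k \<in> {..<i - 1}" by simp
        qed
        then have "f u \<le> i - 1" unfolding f_def by (metis card_lessThan card_mono finite_lessThan)
        then show False using fi \<open>i \<noteq> 0\<close> by simp
      qed
      moreover have "u < c (Suc i)"
      proof (rule ccontr)
        assume less: "\<not> u < c (Suc i)"
        have "{..i} \<subseteq> {k\<in>{..<m}. c (Suc k) \<le> u}"
        proof
          fix k assume k: "k \<in> {..i}"
          then show "k \<in> {k\<in>{..<m}. c (Suc k) \<le> u}" using less i mono[of "Suc k" "Suc i"] by fastforce
        qed
        then have "card {..i} \<le> f u" unfolding f_def by (intro card_mono) auto
        then show False using fi by simp
      qed
      ultimately show "c i \<le> u \<and> u < c (Suc i)" by blast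
    qed
    have meas: "f -` {i} \<in> sets borel"
      using measurable_sets[OF \<open>f \<in> borel \<rightarrow>\<^sub>M count_space UNIV\<close>, of "{i}"] by simp
    have sub: "{c i..<c (Suc i)} \<subseteq> {0..1}" using c0[of i] c1[of "Suc i"] i by auto
    have "{0..1} \<inter> f -` {i} = {c i..<c (Suc i)}"
    proof (intro equalityI subsetI)
      fix u assume "u \<in> {0..1} \<inter> f -` {i}"
      then show "u \<in> {c i..<c (Suc i)}" using iff[of u] by simp
    next
      fix u assume "u \<in> {c i..<c (Suc i)}"
      then show "u \<in> {0..1} \<inter> f -` {i}" using iff[of u] sub by auto
    qed
    then have "measure unif (f -` {i}) = measure lborel {c i..<c (Suc i)}"
      using meas by (subst measure_uniform_measure) auto
    also have "\<dots> = p i" using mono[of i "Suc i"] i by (simp add: c_def)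
    finally show ?thesis .
  qed
  ultimately show ?thesis by blast
qed

text \<open>Only the probabilities of the actions below \<open>m\<close> are prescribed, so the
  default action \<open>m\<close> enters as the baseline \<open>G m\<close>.\<close>

lemma integral_finite_action:
  fixes G :: "nat \<Rightarrow> real"
  assumes [measurable]: "f \<in> borel \<rightarrow>\<^sub>M count_space UNIV" and le: "\<And>u. f u \<le> m"
  shows "(\<integral>u. G (f u) \<partial>unif) = (\<Sum>i<m. measure unif (f -` {i}) * (G i - G m)) + G m"
proof -
  interpret prob_space unif by (rule prob_space_unif)
  have meas [measurable]: "f -` {i} \<in> sets borel" for i
    using measurable_sets[OF assms(1), of "{i}"] by simp
  have "G (f u) = (\<Sum>i<m. indicator (f -` {i}) u * (G i - G m)) + G m" for u
  proof (cases "f u = m")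
    case True
    then show ?thesis by (simp add: indicator_def)
  next
    case False
    then have "f u \<in> {..<m}" using le[of u] by simp
    have "(\<Sum>i<m. indicator (f -` {i}) u * (G i - G m)) = (\<Sum>i<m. if i = f u then G (f u) - G m else 0)"
      by (intro sum.cong) (auto simp: indicator_def)
    then show ?thesis using \<open>f u \<in> {..<m}\<close> by simp
  qed
  then have "(\<integral>u. G (f u) \<partial>unif) = (\<integral>u. (\<Sum>i<m. indicator (f -` {i}) u * (G i - G m)) + G m \<partial>unif)" by simp
  also have "\<dots> = (\<Sum>i<m. measure unif (f -` {i}) * (G i - G m)) + G m"
  proof -
    have int: "integrable unif (\<lambda>u. indicator (f -` {i}) u * (G i - G m))" for i
      by (intro integrable_mult_left integrable_real_indicator) (auto simp: emeasure_eq_measure)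
    have "(\<integral>u. indicator (f -` {i}) u * (G i - G m) \<partial>unif) = measure unif (f -` {i}) * (G i - G m)" for i
      by simp
    moreover have "integrable unif (\<lambda>u. \<Sum>i<m. indicator (f -` {i}) u * (G i - G m))"
      using int by (rule Bochner_Integration.integrable_sum)
    moreover have "integrable unif (\<lambda>u. G m)" by simp
    moreover have "(\<integral>u. G m \<partial>unif) = G m" using prob_space by simp
    ultimately show ?thesis
      using Bochner_Integration.integral_sum[of "{..<m}" unif "\<lambda>i u. indicator (f -` {i}) u * (G i - G m)", OF int]
      by (simp only: Bochner_Integration.integral_add)
  qed
  finally show ?thesis .
qed

section \<open>Play in phases driven by the sunspots\<close>

text \<open>Action \<open>i < N\<close> of the public randomisation asks player \<open>i\<close> to quit with probability \<open>\<eta>\<close>,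
  action \<open>N\<close> decreases the phase, and action \<open>Suc N\<close> does nothing.\<close>
locale phase_process =
  fixes N n :: nat and act :: "nat \<Rightarrow> real \<Rightarrow> nat" and \<eta> b :: real
  assumes \<eta>: "0 \<le> \<eta>" "\<eta> \<le> 1"
    and act_measurable: "\<And>k. act k \<in> borel \<rightarrow>\<^sub>M count_space UNIV"
    and act_le: "\<And>k u. act k u \<le> Suc N"
    and act_0: "\<And>u. act 0 u = Suc N"
    and b: "0 < b" "\<And>k. 0 < k \<Longrightarrow> k \<le> n \<Longrightarrow> b \<le> measure unif (act k -` {N})"
begin

fun phase :: "nat \<Rightarrow> (nat \<Rightarrow> real) \<Rightarrow> nat" where
  "phase 0 w = n"
| "phase (Suc t) w = (if act (phase t w) (w t) = N then phase t w - 1 else phase t w)"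

definition sig_strat :: "nat \<Rightarrow> nat \<Rightarrow> (nat \<Rightarrow> real) \<Rightarrow> real" where
  "sig_strat i t w = (if act (phase t w) (w t) = i then \<eta> else 0)"

lemma phase_le: "phase t w \<le> n"
  by (induction t) auto

lemma phase_past: "(\<And>s. s < t \<Longrightarrow> w s = w' s) \<Longrightarrow> phase t w = phase t w'"
  by (induction t) auto

lemma act_signal_measurable: "(\<lambda>w. act k (w t)) \<in> signal_space \<rightarrow>\<^sub>M count_space UNIV"
  using measurable_compose[OF measurable_signal act_measurable] .

lemma phase_measurable [measurable]: "phase t \<in> signal_space \<rightarrow>\<^sub>M count_space UNIV"
proof (induction t)
  case 0
  then show ?case by (simp add: phase.simps[abs_def])
next
  case (Suc t)
  have [measurable]: "(\<lambda>w. act (phase t w) (w t)) \<in> signal_space \<rightarrow>\<^sub>M count_space UNIV"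
    by (rule measurable_compose_countable[OF act_signal_measurable Suc])
  note Suc[measurable]
  show ?case unfolding phase.simps[abs_def] by measurable
qed

lemma act_phase_measurable [measurable]:
  "(\<lambda>w. act (phase t w) (w t)) \<in> signal_space \<rightarrow>\<^sub>M count_space UNIV"
  by (rule measurable_compose_countable[OF act_signal_measurable phase_measurable])

lemma sunspot_profile_sig_strat: "sunspot_profile N sig_strat"
  unfolding sunspot_profile_def sunspot_strat_def
proof (intro allI impI conjI)
  fix i t
  show "sig_strat i t \<in> borel_measurable signal_space"
    unfolding sig_strat_def[abs_def] by measurable
  show "0 \<le> sig_strat i t w" "sig_strat i t w \<le> 1" for w using \<eta> by (auto simp: sig_strat_def)
  show "sig_strat i t w = sig_strat i t w'" if "\<forall>s\<le>t. w s = w' s" for w w'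
    using that phase_past[of t w w'] by (simp add: sig_strat_def)
qed

lemma at_most_one_quits_sig_strat: "at_most_one_quits N sig_strat"
  unfolding at_most_one_quits_def
proof (intro allI)
  fix t w
  have "{i \<in> {..<N}. sig_strat i t w > 0} \<subseteq> {act (phase t w) (w t)}"
    by (auto simp: sig_strat_def split: if_splits)
  from card_mono[OF _ this] show "card {i \<in> {..<N}. sig_strat i t w > 0} \<le> 1"
    by simp
qed

lemma finite_range_bounded:
  fixes H :: "nat \<Rightarrow> nat \<Rightarrow> real"
  obtains C where "\<And>k a. k \<le> n \<Longrightarrow> a \<le> Suc N \<Longrightarrow> \<bar>H k a\<bar> \<le> C"
proof -
  have "finite ((\<lambda>(k, a). \<bar>H k a\<bar>) ` ({..n} \<times> {..Suc N}))" by simp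
  then have "\<bar>H k a\<bar> \<le> Max ((\<lambda>(k, a). \<bar>H k a\<bar>) ` ({..n} \<times> {..Suc N}))" if "k \<le> n" "a \<le> Suc N" for k a
    using that by (intro Max_ge) force+
  then show ?thesis using that by blast
qed

text \<open>The phase and \<open>c\<close> depend on earlier signals only. Splitting by the value of
  the phase therefore leaves a fresh signal, and the drift hypothesis applies to each phase
  separately.\<close>

lemma integral_stage_le_0:
  fixes H :: "nat \<Rightarrow> nat \<Rightarrow> real"
  assumes c: "c \<in> borel_measurable signal_space" "\<And>w. 0 \<le> c w \<and> c w \<le> 1"
    and past: "\<And>w w'. (\<And>s. s < t \<Longrightarrow> w s = w' s) \<Longrightarrow> c w = c w'"
    and H: "\<And>k. k \<le> n \<Longrightarrow> (\<integral>u. H k (act k u) \<partial>unif) \<le> 0"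
  shows "integrable signal_space (\<lambda>w. c w * H (phase t w) (act (phase t w) (w t)))"
    and "(\<integral>w. c w * H (phase t w) (act (phase t w) (w t)) \<partial>signal_space) \<le> 0"
proof -
  interpret SS: prob_space signal_space by (rule prob_space_signal_space)
  note c(1)[measurable]
  obtain C where C: "\<And>k a. k \<le> n \<Longrightarrow> a \<le> Suc N \<Longrightarrow> \<bar>H k a\<bar> \<le> C" by (rule finite_range_bounded[of H]) blast
  define f where "f k w = c w * (if phase t w = k then 1 else 0)" for k w
  have f_meas [measurable]: "f k \<in> borel_measurable signal_space" for k
    unfolding f_def[abs_def] by measurable
  have f_bd: "\<bar>f k w\<bar> \<le> 1" "0 \<le> f k w" for k w using c(2)[of w] by (auto simp: f_def)
  have f_past: "f k w = f k w'" if "\<And>s. s < t \<Longrightarrow> w s = w' s" for k w w'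
    using past[OF that] phase_past[OF that] by (simp add: f_def)
  have Hm [measurable]: "(\<lambda>u. H k (act k u)) \<in> borel_measurable borel" for k
    using measurable_compose[OF act_measurable, of "H k" borel k] by simp
  have Hm' [measurable]: "(\<lambda>w. H k (act k (w t))) \<in> borel_measurable signal_space" for k
    using measurable_compose[OF measurable_signal Hm] .
  have Hb: "\<bar>H k (act k u)\<bar> \<le> C" if "k \<le> n" for k u using C[OF that act_le] .
  have split: "c w * H (phase t w) (act (phase t w) (w t)) = (\<Sum>k\<le>n. f k w * H k (act k (w t)))" for w
  proof -
    have "(\<Sum>k\<le>n. f k w * H k (act k (w t)))
        = (\<Sum>k\<le>n. if phase t w = k then c w * H k (act k (w t)) else 0)"
      by (intro sum.cong) (auto simp: f_def)
    then show ?thesis using phase_le[of t w] by simp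
  qed
  have int: "integrable signal_space (\<lambda>w. f k w * H k (act k (w t)))" if "k \<le> n" for k
  proof (rule SS.integrable_const_bound[of _ C])
    have "\<bar>f k w\<bar> * \<bar>H k (act k (w t))\<bar> \<le> 1 * C" for w
      using f_bd(1) Hb[OF that] by (intro mult_mono) auto
    then show "AE w in signal_space. norm (f k w * H k (act k (w t))) \<le> C"
      by (simp add: abs_mult)
  qed simp
  show "integrable signal_space (\<lambda>w. c w * H (phase t w) (act (phase t w) (w t)))"
    unfolding split using int by (intro Bochner_Integration.integrable_sum) auto
  have "(\<integral>w. c w * H (phase t w) (act (phase t w) (w t)) \<partial>signal_space)
      = (\<Sum>k\<le>n. \<integral>w. f k w * H k (act k (w t)) \<partial>signal_space)"
    unfolding split using int by (intro Bochner_Integration.integral_sum) auto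
  also have "\<dots> = (\<Sum>k\<le>n. (\<integral>w. f k w \<partial>signal_space) * (\<integral>u. H k (act k u) \<partial>unif))"
  proof (intro sum.cong refl)
    fix k assume "k \<in> {..n}"
    then have "\<And>u. \<bar>H k (act k u)\<bar> \<le> C" using Hb by simp
    from integral_past_times_signal[OF f_meas f_bd(1) f_past Hm this]
    show "(\<integral>w. f k w * H k (act k (w t)) \<partial>signal_space)
        = (\<integral>w. f k w \<partial>signal_space) * (\<integral>u. H k (act k u) \<partial>unif)" .
  qed
  also have "\<dots> \<le> 0"
  proof (intro sum_nonpos mult_nonneg_nonpos)
    fix k assume "k \<in> {..n}"
    then show "(\<integral>u. H k (act k u) \<partial>unif) \<le> 0" using H by simp
    show "0 \<le> (\<integral>w. f k w \<partial>signal_space)" using f_bd(2) by simp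
  qed
  finally show "(\<integral>w. c w * H (phase t w) (act (phase t w) (w t)) \<partial>signal_space) \<le> 0" .
qed

lemma integrable_phase [simp]: "integrable signal_space (\<lambda>w. h (phase t w) :: real)"
proof -
  interpret SS: prob_space signal_space by (rule prob_space_signal_space)
  have m: "(\<lambda>w. h (phase t w)) \<in> borel_measurable signal_space"
    using measurable_compose[OF phase_measurable, of h borel] by simp
  have "\<bar>h k\<bar> \<le> Max ((\<lambda>k. \<bar>h k\<bar>) ` {..n})" if "k \<le> n" for k
    using that by (intro Max_ge) auto
  then show ?thesis using phase_le m by (intro SS.integrable_const_bound[where B = "Max ((\<lambda>k. \<bar>h k\<bar>) ` {..n})"]) auto
qed

text \<open>The expected phase starts at \<open>n\<close>, stays nonnegative and falls at each stage
  by at least \<open>b\<close> times the probability of a nonzero phase, so these probabilities are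
  summable.\<close>

lemma phase_nonzero_tendsto_0:
  "(\<lambda>t. \<integral>w. (if phase t w \<noteq> 0 then 1 else 0 :: real) \<partial>signal_space) \<longlonglongrightarrow> 0"
proof -
  interpret SS: prob_space signal_space by (rule prob_space_signal_space)
  define q where "q t = (\<integral>w. (if phase t w \<noteq> 0 then 1 else 0 :: real) \<partial>signal_space)" for t
  define e where "e t = (\<integral>w. real (phase t w) \<partial>signal_space)" for t
  \<comment> \<open>The change of the phase under action \<open>a\<close>, plus the expected
    decrease \<open>b\<close> guaranteed in a nonzero phase.\<close>
  define H where "H k a = real (if a = N then k - 1 else k) - real k + b * (if k \<noteq> 0 then 1 else 0)" for k a
  have int: "integrable signal_space (\<lambda>w. if phase t w \<noteq> 0 then 1 else 0 :: real)" for t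
    using integrable_phase[of "\<lambda>k. if k \<noteq> 0 then 1 else 0"] .
  have q0: "0 \<le> q t" for t unfolding q_def by simp
  have e0: "0 \<le> e t" for t unfolding e_def by simp
  have step: "b * q t \<le> e t - e (Suc t)" for t
  proof -
    have "(\<integral>w. 1 * H (phase t w) (act (phase t w) (w t)) \<partial>signal_space) \<le> 0"
    proof (rule integral_stage_le_0(2))
      fix k assume k: "k \<le> n"
      interpret U: prob_space unif by (rule prob_space_unif)
      show "(\<integral>u. H k (act k u) \<partial>unif) \<le> 0"
      proof (cases "k = 0")
        case True then show ?thesis by (simp add: H_def act_0)
      next
        case False
        have "(\<integral>u. H k (act k u) \<partial>unif)
            = (\<Sum>i<Suc N. measure unif (act k -` {i}) * (H k i - H k (Suc N))) + H k (Suc N)"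
          by (rule integral_finite_action[OF act_measurable act_le])
        also have "\<dots> = - measure unif (act k -` {N}) + b"
          using False by (simp add: H_def of_nat_diff)
        finally show ?thesis using b(2)[of k] False k by simp
      qed
    qed auto
    also have "(\<lambda>w. 1 * H (phase t w) (act (phase t w) (w t)))
        = (\<lambda>w. real (phase (Suc t) w) - real (phase t w) + b * (if phase t w \<noteq> 0 then 1 else 0))"
      by (auto simp: H_def fun_eq_iff)
    also have "(\<integral>w. real (phase (Suc t) w) - real (phase t w) + b * (if phase t w \<noteq> 0 then 1 else 0) \<partial>signal_space)
        = e (Suc t) - e t + b * q t"
      unfolding e_def q_def using int by (simp del: phase.simps)
    finally show ?thesis by simp
  qed
  have sum: "b * (\<Sum>t<T. q t) \<le> e 0 - e T" for T
  proof (induction T)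
    case (Suc T)
    then show ?case using step[of T] by (simp add: distrib_left)
  qed simp
  have "(\<Sum>t<T. q t) \<le> e 0 / b" for T
    using sum[of T] e0[of T] b(1) by (simp add: pos_le_divide_eq mult.commute)
  then have "summable q" using q0 by (intro summableI_nonneg_bounded[of q "e 0 / b"]) auto
  then show ?thesis using summable_LIMSEQ_zero unfolding q_def by blast
qed

text \<open>A potential argument: \<open>V k\<close> bounds the payoff from phase \<open>k\<close>
  on, \<open>G k a\<close> the payoff once action \<open>a\<close> is drawn. The stage hypothesis
  copes with whatever \<open>j\<close> does after seeing the signal, the integral hypothesis
  averages over the action.\<close>

lemma gamma_sunspot_le:
  assumes prof: "sunspot_profile N x" and r: "payoffs_ok N r" and j: "j < N"
    and stage: "\<And>t w. stage_val {..<N} (\<lambda>i. x i t w) (with_cont r j (V (phase (Suc t) w)))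
        \<le> G (phase t w) (act (phase t w) (w t))"
    and G: "\<And>k. k \<le> n \<Longrightarrow> (\<integral>u. G k (act k u) \<partial>unif) \<le> V k"
    and V: "1 \<le> V 0" "\<And>k. k \<le> n \<Longrightarrow> -1 \<le> V k"
  shows "gamma_sunspot N r x j \<le> V n"
proof -
  interpret SS: prob_space signal_space by (rule prob_space_signal_space)
  define c where "c t w = cont_prob N (\<lambda>i t. x i t w) t" for t w
  define sp where "sp t w = stage_payoff N r (\<lambda>i t. x i t w) j t" for t w
  \<comment> \<open>The payoff collected so far plus the potential of the present phase, weighted by
    survival. \<open>E\<close> majorises its increment and has nonpositive integral.\<close>
  define M where "M t w = (\<Sum>s<t. sp s w) + c t w * V (phase t w)" for t w
  define E where "E t w = c t w * (G (phase t w) (act (phase t w) (w t)) - V (phase t w))" for t w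
  have xm: "\<And>i t. i < N \<Longrightarrow> (\<lambda>w. x i t w) \<in> borel_measurable signal_space"
    using sunspot_profileD(2)[OF prof] by simp
  note pr = sunspot_profileD(1)[OF prof]
  have cm [measurable]: "c t \<in> borel_measurable signal_space" for t
    unfolding c_def[abs_def] by (rule measurable_gamma(1)[OF xm])
  have spm [measurable]: "sp t \<in> borel_measurable signal_space" for t
    unfolding sp_def[abs_def] by (rule measurable_gamma(2)[OF xm])
  have gm: "(\<lambda>w. gamma N r (\<lambda>i t. x i t w) j) \<in> borel_measurable signal_space"
    by (rule measurable_gamma(3)[OF xm])
  have c01: "0 \<le> c t w \<and> c t w \<le> 1" for t w unfolding c_def using cont_prob_bounds[OF pr] by blast
  have spb: "\<bar>sp t w\<bar> \<le> 1" for t w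
    using stage_payoff_bound[OF pr r j, of w t] c01[of t w] c01[of "Suc t" w] unfolding sp_def c_def by linarith
  have c_past: "c t w = c t w'" if "\<And>s. s < t \<Longrightarrow> w s = w' s" for t w w'
    unfolding c_def cont_prob_def
  proof (intro prod.cong refl)
    fix s i assume "s \<in> {..<t}" "i \<in> {..<N}"
    then show "1 - x i s w = 1 - x i s w'" using sunspot_profileD(3)[OF prof, of i s w w'] that by simp
  qed
  have E: "integrable signal_space (E t)" "(\<integral>w. E t w \<partial>signal_space) \<le> 0" for t
  proof -
    have "(\<integral>u. G k (act k u) - V k \<partial>unif) \<le> 0" if "k \<le> n" for k
    proof -
      interpret U: prob_space unif by (rule prob_space_unif)
      have "G k (act k u) - V k = (\<lambda>a. G k a - V k) (act k u)" for u by simp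
      have 1: "(\<integral>u. (\<lambda>a. G k a - V k) (act k u) \<partial>unif)
          = (\<Sum>i<Suc N. measure unif (act k -` {i}) * (G k i - V k - (G k (Suc N) - V k))) + (G k (Suc N) - V k)"
        by (rule integral_finite_action[OF act_measurable act_le])
      have 2: "(\<integral>u. G k (act k u) \<partial>unif)
          = (\<Sum>i<Suc N. measure unif (act k -` {i}) * (G k i - G k (Suc N))) + G k (Suc N)"
        by (rule integral_finite_action[OF act_measurable act_le])
      show ?thesis using 1 2 G[OF that] by simp
    qed
    note H = this
    show "integrable signal_space (E t)" unfolding E_def[abs_def]
      using integral_stage_le_0(1)[where c = "c t" and t = t and H = "\<lambda>k a. G k a - V k"] cm c01 c_past H
      by blast
    show "(\<integral>w. E t w \<partial>signal_space) \<le> 0" unfolding E_def[abs_def]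
      using integral_stage_le_0(2)[where c = "c t" and t = t and H = "\<lambda>k a. G k a - V k"] cm c01 c_past H
      by blast
  qed
  have Mint: "integrable signal_space (M t)" for t
  proof -
    define B where "B = Max ((\<lambda>k. \<bar>V k\<bar>) ` {..n})"
    have B: "\<bar>V k\<bar> \<le> B" if "k \<le> n" for k unfolding B_def using that by (intro Max_ge) auto
    have B0: "0 \<le> B" using B[of 0] by linarith
    have "integrable signal_space (sp s)" for s
      using spb by (intro SS.integrable_const_bound[where B = 1]) auto
    moreover have "integrable signal_space (\<lambda>w. c t w * V (phase t w))"
    proof (rule SS.integrable_const_bound[where B = B])
      have "\<bar>c t w\<bar> * \<bar>V (phase t w)\<bar> \<le> 1 * B" for w
        using c01[of t w] B[OF phase_le] B0 by (intro mult_mono) auto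
      then show "AE w in signal_space. norm (c t w * V (phase t w)) \<le> B" by (simp add: abs_mult)
      have [measurable]: "(\<lambda>w. V (phase t w)) \<in> borel_measurable signal_space"
        using measurable_compose[OF phase_measurable, of V borel] by simp
      show "(\<lambda>w. c t w * V (phase t w)) \<in> borel_measurable signal_space" by measurable
    qed
    ultimately show ?thesis unfolding M_def[abs_def]
      by (intro Bochner_Integration.integrable_add Bochner_Integration.integrable_sum)
  qed
  have step: "M (Suc t) w \<le> M t w + E t w" for t w
  proof -
    have "sp t w + c (Suc t) w * V (phase (Suc t) w)
        = c t w * stage_val {..<N} (\<lambda>i. x i t w) (with_cont r j (V (phase (Suc t) w)))"
      unfolding sp_def c_def by (rule stage_payoff_cont)
    also have "\<dots> \<le> c t w * G (phase t w) (act (phase t w) (w t))"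
      using stage c01 by (intro mult_left_mono) auto
    finally show ?thesis by (simp add: M_def E_def right_diff_distrib)
  qed
  have "(\<integral>w. M t w \<partial>signal_space) \<le> V n" for t
  proof (induction t)
    case 0
    then show ?case using SS.prob_space by (simp add: M_def c_def)
  next
    case (Suc t)
    have "(\<integral>w. M (Suc t) w \<partial>signal_space) \<le> (\<integral>w. M t w + E t w \<partial>signal_space)"
      using step Mint E by (intro integral_mono) auto
    also have "\<dots> = (\<integral>w. M t w \<partial>signal_space) + (\<integral>w. E t w \<partial>signal_space)"
      using Mint E by simp
    also have "\<dots> \<le> V n" using Suc E(2)[of t] by linarith
    finally show ?case .
  qed
  note EM = this
  have "gamma_sunspot N r x j \<le> V n + 2 * (\<integral>w. (if phase T w \<noteq> 0 then 1 else 0) \<partial>signal_space)" for T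
  proof -
    have pt: "gamma N r (\<lambda>i t. x i t w) j \<le> M T w + 2 * (if phase T w \<noteq> 0 then 1 else 0)" for w
    proof -
      have "gamma N r (\<lambda>i t. x i t w) j \<le> (\<Sum>s<T. sp s w) + c T w"
        unfolding sp_def c_def by (rule gamma_le_truncated[OF pr r j])
      \<comment> \<open>In phase \<open>0\<close> the potential is at least \<open>1\<close>, the
        largest payoff, so truncation costs nothing there. In other phases it costs at most
        \<open>2\<close> because \<open>V\<close> is at least \<open>-1\<close>.\<close>
      moreover have "c T w * (1 - V (phase T w)) \<le> 2 * (if phase T w \<noteq> 0 then 1 else 0)"
      proof (cases "phase T w = 0")
        case True
        then show ?thesis using c01[of T w] V(1) by (simp add: mult_nonneg_nonpos)
      next
        case False
        have "c T w * (1 - V (phase T w)) \<le> c T w * 2"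
          using c01[of T w] V(2)[OF phase_le, of T w] by (intro mult_left_mono) auto
        then show ?thesis using False c01[of T w] by simp
      qed
      ultimately show ?thesis by (simp add: M_def right_diff_distrib)
    qed
    have int: "integrable signal_space (\<lambda>w. if phase T w \<noteq> 0 then 1 else 0 :: real)"
      using integrable_phase[of "\<lambda>k. if k \<noteq> 0 then 1 else 0"] .
    have gint: "integrable signal_space (\<lambda>w. gamma N r (\<lambda>i t. x i t w) j)"
      using gamma_bounds[OF pr r j] gm by (intro SS.integrable_const_bound[where B = 1]) auto
    have "gamma_sunspot N r x j \<le> (\<integral>w. M T w + 2 * (if phase T w \<noteq> 0 then 1 else 0) \<partial>signal_space)"
      unfolding gamma_sunspot_def
      by (rule integral_mono[OF gint Bochner_Integration.integrable_add[OF Mint integrable_mult_right[OF int]] pt])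
    also have "\<dots> = (\<integral>w. M T w \<partial>signal_space) + 2 * (\<integral>w. (if phase T w \<noteq> 0 then 1 else 0) \<partial>signal_space)"
      using Mint int by (subst Bochner_Integration.integral_add) auto
    finally show ?thesis using EM[of T] by linarith
  qed
  moreover have "(\<lambda>T. V n + 2 * (\<integral>w. (if phase T w \<noteq> 0 then 1 else 0 :: real) \<partial>signal_space)) \<longlonglongrightarrow> V n + 2 * 0"
    by (intro tendsto_intros phase_nonzero_tendsto_0)
  ultimately show ?thesis using LIMSEQ_le_const[of _ "V n + 2 * 0" "gamma_sunspot N r x j"] by auto
qed

end

text \<open>\<open>W\<close> is a discretised path with all players as coordinates. Phase \<open>k > 0\<close> of the play uses
  the weights \<open>z (k - 1)\<close>, phases are visited in decreasing order, and nobody quits in phase \<open>0\<close>.\<close>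
locale payoff_path =
  fixes N n :: nat and r :: "nat set \<Rightarrow> nat \<Rightarrow> real" and z W d :: "nat \<Rightarrow> nat \<Rightarrow> real"
    and \<delta> :: "nat \<Rightarrow> real" and \<eta> :: real
  assumes r: "payoffs_ok N r" "\<And>i. i < N \<Longrightarrow> r {i} i = 0"
    and z0: "\<And>k i. k < n \<Longrightarrow> i < N \<Longrightarrow> 0 \<le> z k i"
    and W0: "\<And>i. i < N \<Longrightarrow> W 0 i = 0"
    and W_nonneg: "\<And>k i. k \<le> n \<Longrightarrow> i < N \<Longrightarrow> 0 \<le> W k i"
    and W_Suc: "\<And>k i. k < n \<Longrightarrow> i < N \<Longrightarrow> W (Suc k) i = W k i + d k i + (\<Sum>j<N. z k j * r {j} i)"
    and compl: "\<And>k i. k < n \<Longrightarrow> i < N \<Longrightarrow> z k i * W (Suc k) i = 0"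
    and d: "\<And>k i. k < n \<Longrightarrow> i < N \<Longrightarrow> \<bar>d k i\<bar> \<le> \<delta> k"
    and \<delta>0: "\<And>k. k < n \<Longrightarrow> 0 \<le> \<delta> k"
    and \<eta>: "0 < \<eta>" "\<eta> \<le> 1 / 2"
begin

section \<open>Payoff bounds along the phases\<close>

text \<open>The summand \<open>1\<close> is the weight of phase \<open>0\<close>. If everybody obeys
  the profile, phase \<open>0\<close> is reached from phase \<open>k\<close> with probability
  \<open>1 / s k\<close>.\<close>

definition s :: "nat \<Rightarrow> real" where "s k = 1 + (\<Sum>l<k. \<Sum>i<N. z l i)"

definition err :: "nat \<Rightarrow> real" where "err k = (\<Sum>l<k. \<delta> l)"

text \<open>The chance that the play reaches phase \<open>0\<close> when player \<open>i\<close> never quits.\<close>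
fun reach :: "nat \<Rightarrow> nat \<Rightarrow> real" where
  "reach i 0 = 1"
| "reach i (Suc k) = reach i k * s k / (s (Suc k) - z k i)"

text \<open>Bounds the payoff that player \<open>i\<close> can obtain from phase \<open>k\<close> on; the term \<open>4 * \<eta>\<close> makes it useless for
  player \<open>i\<close> to quit in the hope that another player quits at the same stage.\<close>
definition upper :: "nat \<Rightarrow> nat \<Rightarrow> real" where
  "upper i k = W k i / s k + reach i k + err k + 4 * \<eta>"

text \<open>The payoff of \<open>i\<close> from phase \<open>k\<close> on if everybody obeys and
  perpetual continuation is worth \<open>-1\<close>, the least possible value:
  \<open>z l j / s k\<close> is the probability that \<open>j\<close> ends the game in phase
  \<open>Suc l\<close>.\<close>

definition lower :: "nat \<Rightarrow> nat \<Rightarrow> real" where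
  "lower i k = (-1 + (\<Sum>l<k. \<Sum>j<N. z l j * r {j} i)) / s k"

lemma s_Suc: "s (Suc k) = s k + (\<Sum>i<N. z k i)"
  by (simp add: s_def)

lemma s_ge_1: "k \<le> n \<Longrightarrow> 1 \<le> s k"
  unfolding s_def using z0 by (auto intro!: sum_nonneg)

lemma s_mono: "k \<le> n \<Longrightarrow> s k \<le> s n"
  unfolding s_def using z0 by (auto intro!: sum_mono2 sum_nonneg)

lemma s_minus_ge: "k < n \<Longrightarrow> i < N \<Longrightarrow> s k \<le> s (Suc k) - z k i"
  unfolding s_Suc using member_le_sum[of i "{..<N}" "z k"] z0 by simp

lemma err_nonneg: "k \<le> n \<Longrightarrow> 0 \<le> err k"
  unfolding err_def using \<delta>0 by (auto intro!: sum_nonneg)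

lemma reach_nonneg: "k \<le> n \<Longrightarrow> i < N \<Longrightarrow> 0 \<le> reach i k"
proof (induction k)
  case (Suc k)
  then show ?case using s_minus_ge[of k i] s_ge_1[of k] by simp
qed simp

lemma upper_ge: "k \<le> n \<Longrightarrow> i < N \<Longrightarrow> 4 * \<eta> \<le> upper i k"
  unfolding upper_def using W_nonneg[of k i] s_ge_1[of k] reach_nonneg[of k i] err_nonneg[of k] by simp

text \<open>The potential inequality for a player \<open>i\<close> who ignores requests to quit; the
  factor \<open>s (Suc k) - z k i\<close> leaves these requests out. By complementarity
  \<open>z k i = 0\<close> or \<open>W (Suc k) i = 0\<close>, so the omission does not affect the
  term with \<open>W\<close>. The increase of \<open>err\<close> pays for
  \<open>d k i\<close>.\<close>

lemma upper_Suc: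
  assumes k: "k < n" and i: "i < N"
  shows "s k * upper i k + (\<Sum>j<N. z k j * r {j} i) \<le> (s (Suc k) - z k i) * upper i (Suc k)"
proof -
  have s: "1 \<le> s k" "1 \<le> s (Suc k)" "s k \<le> s (Suc k) - z k i"
    using s_ge_1[of k] s_ge_1[of "Suc k"] s_minus_ge[OF k i] k by auto
  have "(s (Suc k) - z k i) * upper i (Suc k)
      = (s (Suc k) - z k i) * (W (Suc k) i / s (Suc k)) + (s (Suc k) - z k i) * reach i (Suc k)
        + (s (Suc k) - z k i) * (err (Suc k) + 4 * \<eta>)"
    by (simp add: upper_def algebra_simps)
  also have "(s (Suc k) - z k i) * (W (Suc k) i / s (Suc k)) = W (Suc k) i"
    using compl[OF k i] s(2) by (auto simp: field_simps)
  also have "(s (Suc k) - z k i) * reach i (Suc k) = reach i k * s k" using s by simp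
  finally have eq: "(s (Suc k) - z k i) * upper i (Suc k)
      = W (Suc k) i + reach i k * s k + (s (Suc k) - z k i) * (err (Suc k) + 4 * \<eta>)" .
  have "s k * (err (Suc k) + 4 * \<eta>) \<le> (s (Suc k) - z k i) * (err (Suc k) + 4 * \<eta>)"
    using s(3) err_nonneg[of "Suc k"] k \<eta> by (intro mult_right_mono) auto
  moreover have "s k * (err (Suc k) + 4 * \<eta>) = s k * err k + s k * \<delta> k + s k * (4 * \<eta>)"
    by (simp add: err_def distrib_left)
  moreover have "\<delta> k \<le> s k * \<delta> k" using s(1) \<delta>0[OF k] mult_right_mono[of 1 "s k" "\<delta> k"] by simp
  moreover have "- d k i \<le> \<delta> k" using d[OF k i] by simp
  moreover have "s k * upper i k = W k i + reach i k * s k + s k * err k + s k * (4 * \<eta>)"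
    using s(1) by (simp add: upper_def distrib_left mult.commute)
  ultimately show ?thesis unfolding eq using W_Suc[OF k i] by linarith
qed

lemma lower_0: "lower i 0 = -1"
  by (simp add: lower_def s_def)

lemma lower_Suc: "k < n \<Longrightarrow> s (Suc k) * lower i (Suc k) = s k * lower i k + (\<Sum>j<N. z k j * r {j} i)"
  unfolding lower_def using s_ge_1[of k] s_ge_1[of "Suc k"] by simp

lemma r_le: "S \<subseteq> {..<N} \<Longrightarrow> i < N \<Longrightarrow> -1 \<le> r S i \<and> r S i \<le> 1"
  using r(1) by (auto simp: payoffs_ok_def)

lemma lower_le_1: "k \<le> n \<Longrightarrow> i < N \<Longrightarrow> lower i k \<le> 1"
proof -
  assume k: "k \<le> n" and i: "i < N"
  have "(\<Sum>l<k. \<Sum>j<N. z l j * r {j} i) \<le> (\<Sum>l<k. \<Sum>j<N. z l j)"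
    using z0 k r_le[of "{_}" i] i by (intro sum_mono mult_left_le) auto
  then show ?thesis unfolding lower_def using s_ge_1[OF k] by (simp add: divide_le_eq s_def)
qed

lemma W_eq: "k \<le> n \<Longrightarrow> i < N \<Longrightarrow> W k i = (\<Sum>l<k. d l i) + (\<Sum>l<k. \<Sum>j<N. z l j * r {j} i)"
  by (induction k) (auto simp: W0 W_Suc)

lemma upper_minus_lower:
  assumes i: "i < N"
  shows "upper i n - lower i n \<le> reach i n + err n + 4 * \<eta> + (1 + err n) / s n"
proof -
  have "\<bar>\<Sum>l<n. d l i\<bar> \<le> (\<Sum>l<n. \<bar>d l i\<bar>)" by (rule sum_abs)
  also have "\<dots> \<le> err n" unfolding err_def using d i by (intro sum_mono) auto
  finally have "W n i + 1 - (\<Sum>l<n. \<Sum>j<N. z l j * r {j} i) \<le> 1 + err n" using W_eq[of n i] i by simp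
  then have "(W n i + 1 - (\<Sum>l<n. \<Sum>j<N. z l j * r {j} i)) / s n \<le> (1 + err n) / s n"
    using s_ge_1[of n] by (intro divide_right_mono) auto
  moreover have "W n i / s n - lower i n = (W n i + 1 - (\<Sum>l<n. \<Sum>j<N. z l j * r {j} i)) / s n"
    unfolding lower_def by (simp add: diff_divide_distrib add_divide_distrib)
  ultimately show ?thesis unfolding upper_def by linarith
qed

text \<open>A player who is asked quits only with probability \<open>\<eta>\<close>, so the descent
  is scaled by \<open>\<eta>\<close> as well. Quitting by \<open>a\<close> and descending then keep
  the proportion of \<open>z k a\<close> to \<open>s k\<close>; the rest of the probability goes to
  the idle action.\<close>

definition action_prob :: "nat \<Rightarrow> nat \<Rightarrow> real" where
  "action_prob k a = (if a < N then z k a / s (Suc k) else \<eta> * s k / s (Suc k))"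

lemma phase_process_exists:
  "\<exists>act. phase_process N n act \<eta> (\<eta> / s n) \<and>
     (\<forall>k<n. \<forall>a\<le>N. measure unif (act (Suc k) -` {a}) = action_prob k a)"
proof -
  define P where "P k f \<longleftrightarrow> f \<in> borel \<rightarrow>\<^sub>M count_space UNIV \<and> (\<forall>u. f u \<le> Suc N) \<and>
    (\<forall>a\<le>N. measure unif (f -` {a}) = action_prob k a)" for k f
  have "\<exists>f. P k f" if k: "k < n" for k
  proof -
    have s: "1 \<le> s k" "1 \<le> s (Suc k)" using s_ge_1 k by auto
    have "(\<Sum>a<Suc N. action_prob k a) = ((\<Sum>a<N. z k a) + \<eta> * s k) / s (Suc k)"
      by (simp add: action_prob_def sum_divide_distrib add_divide_distrib)
    moreover have "\<eta> * s k \<le> s k" using \<eta> s by simp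
    ultimately have "(\<Sum>a<Suc N. action_prob k a) \<le> 1" using s s_Suc[of k] by (simp add: divide_le_eq)
    moreover have "0 \<le> action_prob k a" if "a < Suc N" for a
      using z0[OF k] \<eta> s by (simp add: action_prob_def)
    ultimately show ?thesis
      using finite_distribution_realizable[of "Suc N" "action_prob k"] by (auto simp: P_def less_Suc_eq_le)
  qed
  then obtain f where f: "\<And>k. k < n \<Longrightarrow> P k (f k)" by metis
  \<comment> \<open>Phase \<open>k\<close> uses the weights \<open>z (k - 1)\<close>, hence the
    shift. Phase \<open>0\<close> is idle forever, which makes it absorbing.\<close>
  define act where "act k = (if 0 < k \<and> k \<le> n then f (k - 1) else (\<lambda>_. Suc N))" for k
  have fP: "P (k - 1) (f (k - 1))" if "0 < k" "k \<le> n" for k using f[of "k - 1"] that by simp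
  have "phase_process N n act \<eta> (\<eta> / s n)"
  proof
    show "0 \<le> \<eta>" "\<eta> \<le> 1" using \<eta> by auto
    show "act k \<in> borel \<rightarrow>\<^sub>M count_space UNIV" for k using fP[of k] by (auto simp: act_def P_def)
    show "act k u \<le> Suc N" for k u using fP[of k] by (auto simp: act_def P_def)
    show "act 0 u = Suc N" for u by (simp add: act_def)
    show "0 < \<eta> / s n" using \<eta> s_ge_1[of n] by simp
    fix k assume k: "0 < k" "k \<le> n"
    then obtain l where l: "k = Suc l" "l < n" by (cases k) auto
    have "measure unif (act k -` {N}) = \<eta> * s l / s k" using f[of l] l by (simp add: act_def P_def action_prob_def)
    moreover have "\<eta> * 1 / s n \<le> \<eta> * s l / s k"
      using \<eta> s_ge_1[of l] s_ge_1[of k] s_mono[of k] l by (intro frac_le mult_mono) auto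
    ultimately show "\<eta> / s n \<le> measure unif (act k -` {N})" by simp
  qed
  moreover have "\<forall>k<n. \<forall>a\<le>N. measure unif (act (Suc k) -` {a}) = action_prob k a"
    using f by (simp add: act_def P_def)
  ultimately show ?thesis by blast
qed

lemma sum_except: "i < N \<Longrightarrow> (\<Sum>a<N. if a = i then 0 else f a) = (\<Sum>a<N. f a) - (f i :: real)"
  by (simp add: sum.remove[of "{..<N}" i] cong: sum.cong) (rule sum.cong, auto)

theorem sunspot_strategy:
  "\<exists>\<xi>. sunspot_profile N \<xi> \<and> at_most_one_quits N \<xi> \<and>
    (\<forall>i<N. \<forall>y. sunspot_strat y \<longrightarrow> gamma_sunspot N r (\<xi>(i := y)) i \<le> gamma_sunspot N r \<xi> i
        + (reach i n + err n + 4 * \<eta> + (1 + err n) / s n))"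
proof -
  obtain act where act: "phase_process N n act \<eta> (\<eta> / s n)"
    and prob: "\<And>k a. k < n \<Longrightarrow> a \<le> N \<Longrightarrow> measure unif (act (Suc k) -` {a}) = action_prob k a"
    using phase_process_exists by blast
  note \<eta>_bounds = \<eta>
  interpret phase_process N n act \<eta> "\<eta> / s n" by (rule act)
  have prof: "sunspot_profile N sig_strat" by (rule sunspot_profile_sig_strat)
  have integral_act: "(\<integral>u. G (act (Suc k) u) \<partial>unif)
      = (\<Sum>a<N. z k a / s (Suc k) * (G a - G (Suc N))) + \<eta> * s k / s (Suc k) * (G N - G (Suc N)) + G (Suc N)"
    if "k < n" for k and G :: "nat \<Rightarrow> real"
    using integral_finite_action[OF act_measurable act_le, of G "Suc k"] prob[OF that]
    by (simp add: action_prob_def)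
  have integral_act_0: "(\<integral>u. G (act 0 u) \<partial>unif) = G (Suc N)" for G :: "nat \<Rightarrow> real"
  proof -
    interpret U: prob_space unif by (rule prob_space_unif)
    show ?thesis using U.prob_space by (simp add: act_0)
  qed
  have low: "lower i n \<le> gamma_sunspot N r sig_strat i" if i: "i < N" for i
  proof -
    \<comment> \<open>Nobody deviates here, so the one-stage values equal \<open>G\<close>. The
      potential \<open>- lower\<close> in the game with negated payoffs yields the lower
      bound.\<close>
    define G where "G k a = (if a < N then \<eta> * (- r {a} i) + (1 - \<eta>) * (- lower i k)
        else if a = N then - lower i (k - 1) else - lower i k)" for k a
    have "gamma_sunspot N (\<lambda>S j. - r S j) sig_strat i \<le> - lower i n"
    proof (rule gamma_sunspot_le[OF prof payoffs_ok_uminus[OF r(1)] i, where G = G])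
      show "1 \<le> - lower i 0" by (simp add: lower_0)
      show "-1 \<le> - lower i k" if "k \<le> n" for k using lower_le_1[OF that i] by simp
      show "(\<integral>u. G k (act k u) \<partial>unif) \<le> - lower i k" if k: "k \<le> n" for k
      proof (cases k)
        case 0
        then show ?thesis using integral_act_0[of "G 0"] by (simp add: G_def[of 0 "Suc N"])
      next
        case (Suc l)
        then have l: "l < n" using k by simp
        have s: "1 \<le> s (Suc l)" using s_ge_1[of "Suc l"] l by simp
        have Z: "(\<Sum>a<N. z l a) = s (Suc l) - s l" by (simp add: s_Suc)
        have "(\<integral>u. G k (act k u) \<partial>unif)
          = (\<Sum>a<N. z l a / s (Suc l) * (\<eta> * (lower i k - r {a} i))) + \<eta> * s l / s (Suc l) * (lower i k - lower i l) - lower i k"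
          unfolding Suc by (subst integral_act[OF l]) (simp add: G_def algebra_simps)
        also have "(\<Sum>a<N. z l a / s (Suc l) * (\<eta> * (lower i k - r {a} i)))
            = \<eta> / s (Suc l) * (lower i k * (\<Sum>a<N. z l a) - (\<Sum>a<N. z l a * r {a} i))"
          by (simp add: sum_distrib_left sum_distrib_right sum_subtractf sum_divide_distrib algebra_simps)
        also have "\<eta> / s (Suc l) * (lower i k * (\<Sum>a<N. z l a) - (\<Sum>a<N. z l a * r {a} i))
            + \<eta> * s l / s (Suc l) * (lower i k - lower i l)
            = \<eta> / s (Suc l) * (s (Suc l) * lower i k - (s l * lower i l + (\<Sum>a<N. z l a * r {a} i)))"
          unfolding Z using s by (simp add: algebra_simps add_divide_distrib diff_divide_distrib)
        also have "\<dots> = 0" using lower_Suc[OF l, of i] Suc by simp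
        finally show ?thesis by simp
      qed
      show "stage_val {..<N} (\<lambda>j. sig_strat j t \<omega>) (with_cont (\<lambda>S j. - r S j) i (- lower i (phase (Suc t) \<omega>)))
          \<le> G (phase t \<omega>) (act (phase t \<omega>) (\<omega> t))" for t \<omega>
      proof -
        define k where "k = phase t \<omega>"
        define a where "a = act k (\<omega> t)"
        have x: "sig_strat j t \<omega> = (if a = j then \<eta> else 0)" for j by (simp add: sig_strat_def a_def k_def)
        have ph: "phase (Suc t) \<omega> = (if a = N then k - 1 else k)" by (simp add: a_def k_def)
        have "stage_val {..<N} (\<lambda>j. sig_strat j t \<omega>) (with_cont (\<lambda>S j. - r S j) i (- lower i (phase (Suc t) \<omega>))) = G k a"
        proof (cases "a < N \<and> a \<noteq> i")
          case True
          then show ?thesis unfolding ph x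
            by (subst stage_val_two_active[where j = a and i = i]) (use i in \<open>auto simp: G_def\<close>)
        next
          case False
          then show ?thesis unfolding ph x
            by (subst stage_val_others_idle[where i = i]) (use i r(2) in \<open>auto simp: G_def\<close>)
        qed
        then show ?thesis by (simp add: a_def k_def del: phase.simps)
      qed
    qed
    then show ?thesis using gamma_sunspot_uminus[OF prof r(1) i] by simp
  qed
  have up: "gamma_sunspot N r (sig_strat(i := y)) i \<le> upper i n" if i: "i < N" and y: "sunspot_strat y" for i y
  proof -
    \<comment> \<open>A request to \<open>i\<close> counts as an idle stage: quitting alone yields
      \<open>r {i} i = 0\<close>, which does not exceed \<open>upper\<close>.\<close>
    define G where "G k a = (if a < N \<and> a \<noteq> i then \<eta> * r {a} i + (1 - \<eta>) * upper i k
        else if a = N then upper i (k - 1) else upper i k)" for k a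
    have prof': "sunspot_profile N (sig_strat(i := y))" using prof y by (simp add: sunspot_profile_def)
    show ?thesis
    proof (rule gamma_sunspot_le[OF prof' r(1) i, where G = G])
      show "1 \<le> upper i 0" using W0[OF i] \<eta> by (simp add: upper_def err_def)
      show "-1 \<le> upper i k" if "k \<le> n" for k using upper_ge[OF that i] \<eta> by linarith
      show "(\<integral>u. G k (act k u) \<partial>unif) \<le> upper i k" if k: "k \<le> n" for k
      proof (cases k)
        case 0
        then show ?thesis using i integral_act_0[of "G 0"] by (simp add: G_def[of 0 "Suc N"])
      next
        case (Suc l)
        then have l: "l < n" using k by simp
        have s: "1 \<le> s (Suc l)" using s_ge_1[of "Suc l"] l by simp
        have Z: "(\<Sum>a<N. z l a) = s (Suc l) - s l" by (simp add: s_Suc)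
        have "(\<integral>u. G k (act k u) \<partial>unif)
          = (\<Sum>a<N. z l a / s (Suc l) * (G k a - G k (Suc N))) + \<eta> * s l / s (Suc l) * (upper i l - upper i k) + upper i k"
          unfolding Suc using i by (subst integral_act[OF l]) (simp add: G_def)
        also have "(\<Sum>a<N. z l a / s (Suc l) * (G k a - G k (Suc N)))
            = (\<Sum>a<N. if a = i then 0 else \<eta> / s (Suc l) * (z l a * r {a} i - z l a * upper i k))"
          using i by (intro sum.cong) (auto simp: G_def algebra_simps add_divide_distrib diff_divide_distrib)
        also have "\<dots> = \<eta> / s (Suc l) * ((\<Sum>a<N. z l a * r {a} i) - ((\<Sum>a<N. z l a) - z l i) * upper i k)"
          unfolding sum_except[OF i] using r(2)[OF i]
          by (simp add: sum_distrib_left sum_distrib_right sum_subtractf sum_divide_distrib algebra_simps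
              diff_divide_distrib add_divide_distrib)
        also have "\<dots> + \<eta> * s l / s (Suc l) * (upper i l - upper i k)
            = \<eta> / s (Suc l) * (s l * upper i l + (\<Sum>a<N. z l a * r {a} i) - (s (Suc l) - z l i) * upper i k)"
          unfolding Z using s by (simp add: algebra_simps add_divide_distrib diff_divide_distrib)
        finally have "(\<integral>u. G k (act k u) \<partial>unif)
            = \<eta> / s (Suc l) * (s l * upper i l + (\<Sum>a<N. z l a * r {a} i) - (s (Suc l) - z l i) * upper i k) + upper i k" .
        moreover have "\<eta> / s (Suc l) * (s l * upper i l + (\<Sum>a<N. z l a * r {a} i) - (s (Suc l) - z l i) * upper i k) \<le> 0"
          using upper_Suc[OF l i] Suc \<eta> s by (intro mult_nonneg_nonpos) auto
        ultimately show ?thesis by linarith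
      qed
      show "stage_val {..<N} (\<lambda>j. (sig_strat(i := y)) j t \<omega>) (with_cont r i (upper i (phase (Suc t) \<omega>)))
          \<le> G (phase t \<omega>) (act (phase t \<omega>) (\<omega> t))" for t \<omega>
      proof -
        define k where "k = phase t \<omega>"
        define a where "a = act k (\<omega> t)"
        define v where "v = y t \<omega>"
        define x where "x j = (sig_strat(i := y)) j t \<omega>" for j
        have v: "0 \<le> v" "v \<le> 1" using y by (auto simp: sunspot_strat_def v_def)
        have x: "x j = (if j = i then v else if a = j then \<eta> else 0)" for j
          by (simp add: x_def v_def sig_strat_def a_def k_def)
        have ph: "phase (Suc t) \<omega> = (if a = N then k - 1 else k)" by (simp add: a_def k_def)
        have kn: "k \<le> n" using phase_le by (simp add: k_def)
        have "stage_val {..<N} x (with_cont r i (upper i (phase (Suc t) \<omega>))) \<le> G k a"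
        proof (cases "a < N \<and> a \<noteq> i")
          case True
          then have "stage_val {..<N} x (with_cont r i (upper i (phase (Suc t) \<omega>)))
              = (1 - v) * G k a + v * (\<eta> * r {i, a} i)"
            unfolding ph by (subst stage_val_two_active[where j = a and i = i])
              (use i r(2) in \<open>auto simp: G_def x algebra_simps\<close>)
          moreover have "\<eta> * r {i, a} i \<le> G k a"
          proof -
            have "\<eta> * r {i, a} i \<le> \<eta> * 1" "\<eta> * (-1) \<le> \<eta> * r {a} i"
              using r_le[of "{i, a}" i] r_le[of "{a}" i] True i \<eta> by (intro mult_left_mono; simp)+
            \<comment> \<open>Origin of the constant \<open>4\<close>: since
              \<open>\<eta> \<le> 1 / 2\<close>, continuing is worth at least
              \<open>2 * \<eta>\<close>. This outweighs the loss of at most \<open>\<eta>\<close> if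
              \<open>a\<close> quits alone together with the profit of at most \<open>\<eta>\<close>
              from quitting along with \<open>a\<close>.\<close>
            moreover have "1 / 2 * (4 * \<eta>) \<le> (1 - \<eta>) * upper i k"
              using \<eta>_bounds upper_ge[OF kn i] by (intro mult_mono) auto
            ultimately show ?thesis using True by (simp add: G_def)
          qed
          then have "v * (\<eta> * r {i, a} i) \<le> v * G k a" using v by (intro mult_left_mono)
          ultimately show ?thesis by (simp add: left_diff_distrib)
        next
          case False
          have "stage_val {..<N} x (with_cont r i (upper i (phase (Suc t) \<omega>))) = (1 - v) * upper i (phase (Suc t) \<omega>)"
            using i r(2)[OF i] False by (subst stage_val_others_idle[where i = i]) (auto simp: x)
          also have "\<dots> \<le> upper i (phase (Suc t) \<omega>)"
            using v upper_ge[OF phase_le i, of "Suc t" \<omega>] \<eta>(1) by (simp add: mult_left_le_one_le del: phase.simps)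
          also have "\<dots> = G k a" using False i unfolding ph by (auto simp: G_def)
          finally show ?thesis .
        qed
        then show ?thesis unfolding x_def[abs_def] a_def k_def .
      qed
    qed
  qed
  show ?thesis
  proof (intro exI conjI allI impI)
    show "sunspot_profile N sig_strat" by (rule prof)
    show "at_most_one_quits N sig_strat" by (rule at_most_one_quits_sig_strat)
    show "gamma_sunspot N r (sig_strat(i := y)) i \<le> gamma_sunspot N r sig_strat i
        + (reach i n + err n + 4 * \<eta> + (1 + err n) / s n)" if "i < N" "sunspot_strat y" for i y
      using up[OF that] low[OF that(1)] upper_minus_lower[OF that(1)] by linarith
  qed
qed

end

lemma lcp_path_sequence:
  assumes "lcp_path K R p Z e u"
  shows "\<exists>n W z d \<delta>. W 0 = p \<and> W n = u
    \<and> (\<forall>k<n. lcp_sol K R (\<lambda>j. W k j + d k j) (z k) (W (Suc k)) \<and> 0 \<le> \<delta> k \<and> (\<forall>j\<in>K. \<bar>d k j\<bar> \<le> \<delta> k))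
    \<and> (\<Sum>k<n. \<delta> k) = e \<and> (\<forall>i. (\<Sum>k<n. z k i) = Z i)"
  using assms
proof induction
  case (nil p)
  show ?case by (rule exI[of _ 0], rule exI[of _ "\<lambda>_. p"]) auto
next
  case (step p Z e u \<delta>' d' w z')
  then obtain n W z d \<delta> where IH: "W 0 = p" "W n = u"
    "\<And>k. k < n \<Longrightarrow> lcp_sol K R (\<lambda>j. W k j + d k j) (z k) (W (Suc k)) \<and> 0 \<le> \<delta> k \<and> (\<forall>j\<in>K. \<bar>d k j\<bar> \<le> \<delta> k)"
    "(\<Sum>k<n. \<delta> k) = e" "\<And>i. (\<Sum>k<n. z k i) = Z i" by blast
  define W2 where "W2 = W(Suc n := w)"
  define z2 where "z2 = z(n := z')"
  define d2 where "d2 = d(n := d')"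
  define \<delta>2 where "\<delta>2 = \<delta>(n := \<delta>')"
  have "W2 0 = p" "W2 (Suc n) = w" using IH by (simp_all add: W2_def)
  moreover have "lcp_sol K R (\<lambda>j. W2 k j + d2 k j) (z2 k) (W2 (Suc k)) \<and> 0 \<le> \<delta>2 k \<and> (\<forall>j\<in>K. \<bar>d2 k j\<bar> \<le> \<delta>2 k)"
    if "k < Suc n" for k
  proof (cases "k = n")
    case True
    then show ?thesis using step.hyps IH(2) by (simp add: W2_def z2_def d2_def \<delta>2_def)
  next
    case False
    then show ?thesis using IH(3)[of k] that by (simp add: W2_def z2_def d2_def \<delta>2_def)
  qed
  moreover have "(\<Sum>k<Suc n. \<delta>2 k) = e + \<delta>'" using IH(4) by (simp add: \<delta>2_def)
  moreover have "(\<Sum>k<Suc n. z2 k i) = Z i + z' i" for i using IH(5)[of i] by (simp add: z2_def)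
  ultimately show ?case by blast
qed

section \<open>Phase 0 is reached rarely even if one player refuses to quit\<close>

context payoff_path
begin

definition mass_others :: "nat \<Rightarrow> nat \<Rightarrow> real" where
  "mass_others i k = s k - (\<Sum>l<k. z l i)"

lemma mass_others_ge_1:
  assumes "k \<le> n" "i < N"
  shows "1 \<le> mass_others i k"
  using assms
proof (induction k)
  case (Suc k)
  then show ?case using s_minus_ge[of k i] by (simp add: mass_others_def s_Suc)
qed (simp add: mass_others_def s_def)

text \<open>Let \<open>y\<close> be the weight of the others in a phase. The phase divides
  \<open>reach\<close> by \<open>1 + y / s k\<close> and multiplies \<open>mass_others\<close> by
  \<open>1 + y / mass_others i k\<close>. By the hypothesis and Bernoulli's inequality the latter
  factor is at most \<open>(1 + y / s k) ^ m\<close>, so \<open>reach ^ m * mass_others\<close> does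
  not increase.\<close>

lemma reach_power_le:
  assumes i: "i < N" and m: "\<And>k. k \<le> n \<Longrightarrow> s k \<le> real m * mass_others i k"
  shows "reach i n ^ m \<le> real m / s n"
proof -
  have "reach i k ^ m \<le> 1 / mass_others i k" if "k \<le> n" for k
    using that
  proof (induction k)
    case 0
    then show ?case by (simp add: mass_others_def s_def)
  next
    case (Suc k)
    define y where "y = s (Suc k) - z k i - s k"
    have k: "k < n" using Suc by simp
    have y: "0 \<le> y" using s_minus_ge[OF k i] by (simp add: y_def)
    have s: "1 \<le> s k" using s_ge_1 k by simp
    have o: "1 \<le> mass_others i k" using mass_others_ge_1[of k i] k i by simp
    have "mass_others i (Suc k) = mass_others i k + y" by (simp add: mass_others_def y_def)
    then have "mass_others i (Suc k) / mass_others i k = 1 + y / mass_others i k"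
      using o by (simp add: add_divide_distrib)
    also have "y / mass_others i k \<le> real m * (y / s k)"
    proof -
      have "y * s k \<le> y * (real m * mass_others i k)" using m[of k] k y by (intro mult_left_mono) auto
      then show ?thesis using s o by (simp add: divide_le_eq le_divide_eq mult.commute mult.left_commute)
    qed
    also have "1 + real m * (y / s k) \<le> (1 + y / s k) ^ m"
      using y s by (intro Bernoulli_inequality) (simp add: order_trans[of _ 0])
    finally have B: "mass_others i (Suc k) / mass_others i k \<le> (1 + y / s k) ^ m" by simp
    have "s (Suc k) - z k i = s k * (1 + y / s k)" using s by (simp add: y_def distrib_left)
    then have "reach i (Suc k) = reach i k / (1 + y / s k)" using s by simp
    then have "reach i (Suc k) ^ m = reach i k ^ m / (1 + y / s k) ^ m" by (simp add: power_divide)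
    also have "\<dots> \<le> (1 / mass_others i k) / (mass_others i (Suc k) / mass_others i k)"
      using B Suc o mass_others_ge_1[of "Suc k" i] i reach_nonneg[of k i] by (intro frac_le) auto
    also have "\<dots> = 1 / mass_others i (Suc k)" using o by simp
    finally show ?case .
  qed
  then have "reach i n ^ m \<le> 1 / mass_others i n" by simp
  also have "\<dots> \<le> real m / s n"
    using m[of n] s_ge_1[of n] mass_others_ge_1[of n i] i by (simp add: divide_le_eq le_divide_eq)
  finally show ?thesis .
qed

text \<open>Weight on column \<open>i\<close> lowers coordinate \<open>j\<close> at rate at least
  \<open>c\<close>, and the other columns raise it at rate at most \<open>1\<close>. Since
  \<open>W k j\<close> stays nonnegative, the weight of \<open>i\<close> is at most
  \<open>1 / c\<close> times \<open>mass_others\<close>, whose initial unit absorbs the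
  perturbations.\<close>

lemma s_le_mass_others:
  assumes i: "i < N" and j: "j < N" and c: "0 < c" "r {i} j \<le> - c" and e: "err n \<le> 1" and k: "k \<le> n"
  shows "s k \<le> (1 + 1 / c) * mass_others i k"
proof -
  have "(\<Sum>l<k. d l j) \<le> (\<Sum>l<k. \<delta> l)" using d[of _ j] j k by (intro sum_mono) (simp add: abs_le_iff)
  also have "\<dots> \<le> err n" unfolding err_def using \<delta>0 k by (intro sum_mono2) auto
  finally have D: "(\<Sum>l<k. d l j) \<le> 1" using e by simp
  have "(\<Sum>l<k. \<Sum>a<N. z l a * r {a} j) \<le> (\<Sum>l<k. (\<Sum>a<N. z l a) - z l i - c * z l i)"
  proof (intro sum_mono)
    fix l assume "l \<in> {..<k}"
    then have l: "l < n" using k by simp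
    have "(\<Sum>a<N. z l a * r {a} j) = z l i * r {i} j + (\<Sum>a\<in>{..<N} - {i}. z l a * r {a} j)"
      using i by (simp add: sum.remove)
    also have "z l i * r {i} j \<le> z l i * (- c)" using c z0[OF l i] by (intro mult_left_mono)
    also have "(\<Sum>a\<in>{..<N} - {i}. z l a * r {a} j) \<le> (\<Sum>a\<in>{..<N} - {i}. z l a)"
      using z0[OF l] r_le[of "{_}" j] j by (intro sum_mono mult_left_le) auto
    also have "(\<Sum>a\<in>{..<N} - {i}. z l a) = (\<Sum>a<N. z l a) - z l i"
      using i by (simp add: sum.remove[of "{..<N}" i])
    finally show "(\<Sum>a<N. z l a * r {a} j) \<le> (\<Sum>a<N. z l a) - z l i - c * z l i" by (simp add: mult.commute)
  qed
  also have "\<dots> = mass_others i k - 1 - c * (\<Sum>l<k. z l i)"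
    by (simp add: sum_subtractf mass_others_def s_def sum_distrib_left)
  finally have "0 \<le> mass_others i k - c * (\<Sum>l<k. z l i)"
    using W_nonneg[OF k j] W_eq[OF k j] D by linarith
  then have "(\<Sum>l<k. z l i) \<le> mass_others i k / c" using c(1) by (simp add: le_divide_eq mult.commute)
  then show ?thesis by (simp add: mass_others_def distrib_right)
qed

end

section \<open>Normal players\<close>

lemma I_star_subset: "I_star N r \<subseteq> I_l N r l"
  by (auto simp: I_star_def)

lemma I_l_Suc: "I_l N r (Suc l) = normal_step r (I_l N r l)"
  by (simp add: I_l_def)

lemma I_l_0: "I_l N r 0 = {..<N}"
  by (simp add: I_l_def)

lemma I_l_Suc_subset: "I_l N r (Suc l) \<subseteq> I_l N r l"
  unfolding I_l_Suc by (auto simp: normal_step_def)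

lemma I_l_antimono: "a \<le> b \<Longrightarrow> I_l N r b \<subseteq> I_l N r a"
  by (rule lift_Suc_antimono_le[of "I_l N r"]) (use I_l_Suc_subset in auto)

lemma finite_I_l: "finite (I_l N r l)"
  using I_l_antimono[of 0 l] by (auto simp: I_l_0 intro: finite_subset)

text \<open>The levels decrease, so the sequence is constant from a level of least cardinality
  on.\<close>

lemma I_star_stable: "\<exists>l. I_star N r = I_l N r l"
proof -
  obtain l where l: "\<And>m. card (I_l N r l) \<le> card (I_l N r m)"
    using arg_min_nat_le[of "\<lambda>_. True" _ "\<lambda>l. card (I_l N r l)"] by blast
  have "I_l N r l \<subseteq> I_l N r m" for m
  proof (cases "l \<le> m")
    case True
    then show ?thesis using card_seteq[OF finite_I_l I_l_antimono[OF True]] l by blast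
  qed (use I_l_antimono[of m l] in simp)
  then show ?thesis by (auto simp: I_star_def)
qed

lemma I_star_normal:
  assumes "i \<in> I_star N r"
  shows "\<exists>j\<in>I_star N r. j \<noteq> i \<and> r {j} i \<le> 0"
proof -
  obtain l where l: "I_star N r = I_l N r l" using I_star_stable by blast
  then have "i \<in> I_l N r (Suc l)" using assms I_star_subset by blast
  then show ?thesis unfolding l I_l_Suc by (simp add: normal_step_def)
qed

lemma I_star_le: "I_star N r \<subseteq> {..<N}"
  using I_star_subset[of N r 0] by (simp add: I_l_0)

text \<open>Take the last level containing \<open>i\<close>. All normal players belong to it, so
  each of them gives \<open>i\<close> a positive payoff by quitting alone.\<close>

lemma not_I_star_level:
  assumes "i < N" "i \<notin> I_star N r"
  obtains l where "i \<in> I_l N r l" "\<And>j. j \<in> I_l N r l \<Longrightarrow> j \<noteq> i \<Longrightarrow> 0 < r {j} i"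
proof -
  obtain m where m: "i \<notin> I_l N r m" using assms(2) by (auto simp: I_star_def)
  define l where "l = (LEAST m. i \<notin> I_l N r m) - 1"
  have "i \<notin> I_l N r (LEAST m. i \<notin> I_l N r m)" using m by (rule LeastI)
  moreover then have "(LEAST m. i \<notin> I_l N r m) \<noteq> 0" using assms(1) I_l_0 by (metis lessThan_iff)
  ultimately have "i \<notin> I_l N r (Suc l)" "i \<in> I_l N r l"
    using not_less_Least[of l "\<lambda>m. i \<notin> I_l N r m"] by (auto simp: l_def)
  then show ?thesis using that[of l] unfolding I_l_Suc normal_step_def by fastforce
qed

text \<open>A nonzero homogeneous solution divided by its mass is a solution with
  \<open>z0 = 0\<close>, which the hypothesis excludes.\<close>

lemma R0_matrix_of_lcp:
  assumes "payoffs_ok N r" "\<forall>i<N. r {i} i = 0"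
    and no: "\<not> (\<exists>w z0 z. lcp_solution (I_star N r) (r_hat r) (\<lambda>_. 0) w z0 z \<and> z0 < 1)"
  shows "R0_matrix (I_star N r) (\<lambda>i j. r {i} j)"
proof
  let ?K = "I_star N r"
  show fin: "finite ?K" using I_star_le finite_subset by blast
  show "\<bar>r {i} j\<bar> \<le> 1" if "i \<in> ?K" "j \<in> ?K" for i j
  proof -
    have "{i} \<subseteq> {..<N}" "j < N" using that I_star_le[of N r] by auto
    then show ?thesis using assms(1) unfolding payoffs_ok_def by (simp add: abs_le_iff minus_le_iff)
  qed
  show "r {i} i = 0" if "i \<in> ?K" for i using assms(2) that I_star_le by blast
  show "\<forall>i\<in>?K. z i = 0" if sol: "lcp_sol ?K (\<lambda>i j. r {i} j) (\<lambda>_. 0) z w" for z w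
  proof (rule ccontr)
    assume "\<not> ?thesis"
    then obtain i where i: "i \<in> ?K" "z i \<noteq> 0" by blast
    define m where "m = sum z ?K"
    have z0: "0 \<le> z i" if "i \<in> ?K" for i using sol that by (simp add: lcp_sol_def)
    have "0 < m" unfolding m_def using i z0[OF i(1)] fin z0 by (intro sum_pos2[of _ i]) (auto simp: less_le)
    have "lcp_solution ?K (r_hat r) (\<lambda>_. 0) (\<lambda>j. w j / m) 0 (\<lambda>i. z i / m)"
      unfolding lcp_solution_def
    proof (intro conjI ballI)
      show "0 + (\<Sum>i\<in>?K. z i / m) = 1" using \<open>0 < m\<close> by (simp add: sum_divide_distrib[symmetric] m_def)
      fix j assume j: "j \<in> ?K"
      then have *: "0 \<le> z j" "0 \<le> w j" "z j * w j = 0" and w: "w j = 0 + (\<Sum>i\<in>?K. z i * r {i} j)"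
        using sol unfolding lcp_sol_def by blast+
      show "0 \<le> w j / m" "0 \<le> z j / m" "z j / m = 0 \<or> w j / m = 0"
        using * \<open>0 < m\<close> by simp_all
      show "w j / m = 0 * 0 + (\<Sum>i\<in>?K. z i / m * r_hat r i j)"
        unfolding w by (simp add: r_hat_def sum_divide_distrib)
    qed simp
    then show False using no zero_less_one by blast
  qed
qed

text \<open>Otherwise the unit vector at \<open>i\<close> solves the homogeneous problem with the
  column itself as \<open>w\<close>; complementarity holds because the diagonal entry is
  \<open>0\<close>.\<close>

lemma (in R0_matrix) column_negative:
  assumes "i \<in> K"
  shows "\<exists>j\<in>K. R i j < 0"
proof (rule ccontr)
  assume neg: "\<not> ?thesis"
  define z where "z a = (if a = i then 1 else 0 :: real)" for a
  have "(\<Sum>a\<in>K. z a * R a j) = R i j" for j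
    using assms fin by (simp add: z_def if_distrib[of "\<lambda>x. x * _"] cong: if_cong)
  then have "lcp_sol K R (\<lambda>_. 0) z (R i)"
    using neg assms R_diag by (auto simp: lcp_sol_def z_def not_less)
  then show False using R0 assms by (force simp: z_def)
qed

lemma (in R0_matrix) columns_uniformly_negative:
  "\<exists>c>0. \<forall>i\<in>K. \<exists>j\<in>K. R i j \<le> - c"
proof (cases "K = {}")
  case False
  obtain f where f: "\<And>i. i \<in> K \<Longrightarrow> f i \<in> K \<and> R i (f i) < 0" using column_negative by metis
  define c where "c = Min ((\<lambda>i. - R i (f i)) ` K)"
  have "0 < c" unfolding c_def using fin False f by (subst Min_gr_iff) auto
  moreover have "R i (f i) \<le> - c" if "i \<in> K" for i
  proof -
    have "c \<le> - R i (f i)" unfolding c_def using fin that by (intro Min_le) auto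
    then show ?thesis by simp
  qed
  ultimately show ?thesis using f by blast
qed (auto intro: exI[of _ 1])

theorem sunspot_equilibrium_exists:
  assumes r: "payoffs_ok N r" and diag: "\<forall>i<N. r {i} i = 0"
    and ne: "I_star N r \<noteq> {}"
    and no: "\<not> (\<exists>w z0 z. lcp_solution (I_star N r) (r_hat r) (\<lambda>_. 0) w z0 z \<and> z0 < 1)"
    and Q: "Q_matrix (I_star N r) (R_hat r)" and \<epsilon>: "0 < \<epsilon>"
  shows "\<exists>\<xi>. sunspot_eps_equilibrium N r \<epsilon> \<xi> \<and> at_most_one_quits N \<xi>"
proof -
  define K where "K = I_star N r"
  define R where "R = (\<lambda>i j. r {i} j)"
  have KN: "K \<subseteq> {..<N}" unfolding K_def by (rule I_star_le)
  interpret R0_matrix K R unfolding K_def R_def by (rule R0_matrix_of_lcp[OF r diag no])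
  interpret QR0_matrix K R
  proof
    fix q
    obtain z w where "\<forall>i\<in>K. 0 \<le> z i \<and> 0 \<le> w i \<and> z i * w i = 0"
      "\<forall>j\<in>K. w j = q j + (\<Sum>i\<in>K. R_hat r j i * z i)"
      using Q unfolding Q_matrix_def K_def by blast
    then show "\<exists>z w. lcp_sol K R q z w"
      by (intro exI[of _ z] exI[of _ w]) (simp add: lcp_sol_def R_hat_def r_hat_def R_def mult.commute)
  qed
  obtain c where c: "0 < c" "\<And>i. i \<in> K \<Longrightarrow> \<exists>j\<in>K. R i j \<le> - c" using columns_uniformly_negative by blast
  \<comment> \<open>The ratio from \<open>s_le_mass_others\<close> is rounded up because
    \<open>reach_power_le\<close> uses it as an exponent.\<close>
  obtain m :: nat where m: "1 + 1 / c \<le> real m" using real_arch_simple by blast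
  have m1: "1 \<le> real m" using m c(1) by (smt (verit) divide_pos_pos)
  define \<eta> where "\<eta> = min (1 / 2) (\<epsilon> / 32)"
  define e0 where "e0 = min 1 (\<epsilon> / 8)"
  \<comment> \<open>The first term makes \<open>(1 + err n) / s n\<close> at most
    \<open>\<epsilon> / 4\<close>; the second makes the bound \<open>m / s n\<close> on
    \<open>reach ^ m\<close> at most \<open>(\<epsilon> / 8) ^ m\<close>.\<close>
  define L where "L = max (8 / \<epsilon>) (real m / (\<epsilon> / 8) ^ m)"
  have L0: "0 < L" "8 / \<epsilon> \<le> L" "real m / (\<epsilon> / 8) ^ m \<le> L" using \<epsilon> by (auto simp: L_def less_max_iff_disj)
  have "0 < e0" "orthant_bd K (\<lambda>_. 0)" using \<epsilon> ne by (auto simp: e0_def orthant_bd_def K_def)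
  then obtain Z e u where path: "lcp_path K R (\<lambda>_. 0) Z e u" "L \<le> sum Z K" "e \<le> e0"
    using long_path L0(1) by blast
  obtain n W z d \<delta> where seq: "W 0 = (\<lambda>_. 0)"
    "\<And>k. k < n \<Longrightarrow> lcp_sol K R (\<lambda>j. W k j + d k j) (z k) (W (Suc k)) \<and> 0 \<le> \<delta> k \<and> (\<forall>j\<in>K. \<bar>d k j\<bar> \<le> \<delta> k)"
    "(\<Sum>k<n. \<delta> k) = e" "\<And>i. (\<Sum>k<n. z k i) = Z i"
    using lcp_path_sequence[OF path(1)] by blast
  define z' where "z' k i = (if i \<in> K then z k i else 0)" for k i
  define d' where "d' k i = (if i \<in> K then d k i else 0)" for k i
  \<comment> \<open>Players who are not normal carry no weight. Their coordinates accumulate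
    positive entries of columns of normal players and so stay nonnegative without
    perturbation.\<close>
  define W' where "W' k i = (if i \<in> K then W k i else (\<Sum>l<k. \<Sum>j<N. z' l j * r {j} i))" for k i
  have z'_sum: "(\<Sum>j<N. z' k j * f j) = (\<Sum>j\<in>K. z k j * f j)" for k and f :: "nat \<Rightarrow> real"
    by (rule sum.mono_neutral_cong_right) (use KN in \<open>auto simp: z'_def\<close>)
  have z'0: "0 \<le> z' k i" if "k < n" for k i using seq(2)[OF that] by (auto simp: z'_def lcp_sol_def)
  interpret payoff_path N n r z' W' d' \<delta> \<eta>
  proof
    show "payoffs_ok N r" by (rule r)
    show "r {i} i = 0" if "i < N" for i using diag that by blast
    show "0 \<le> z' k i" if "k < n" "i < N" for k i using z'0[OF that(1)] .
    show "W' 0 i = 0" for i by (simp add: W'_def seq(1))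
    show "0 \<le> W' k i" if k: "k \<le> n" and i: "i < N" for k i
    proof (cases "i \<in> K")
      case True
      then show ?thesis using seq(1) seq(2)[of "k - 1"] k by (cases k) (auto simp: W'_def lcp_sol_def)
    next
      case False
      obtain l where l: "\<And>j. j \<in> I_l N r l \<Longrightarrow> j \<noteq> i \<Longrightarrow> 0 < r {j} i"
        using not_I_star_level[of i N r] False i unfolding K_def by metis
      have "0 \<le> z' a j * r {j} i" if "a < n" for a j
      proof (cases "j \<in> K")
        case True
        then have "0 < r {j} i" using l[of j] I_star_subset[of N r l] False by (auto simp: K_def)
        then show ?thesis using z'0[OF that] by simp
      qed (simp add: z'_def)
      then show ?thesis using False k by (auto simp: W'_def intro!: sum_nonneg)
    qed
    show "W' (Suc k) i = W' k i + d' k i + (\<Sum>j<N. z' k j * r {j} i)" if "k < n" "i < N" for k i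
      using seq(2)[OF that(1)] by (auto simp: W'_def d'_def z'_sum lcp_sol_def R_def)
    show "z' k i * W' (Suc k) i = 0" if "k < n" "i < N" for k i
      using seq(2)[OF that(1)] by (auto simp: W'_def z'_def lcp_sol_def)
    show "\<bar>d' k i\<bar> \<le> \<delta> k" if "k < n" "i < N" for k i using seq(2)[OF that(1)] by (auto simp: d'_def)
    show "0 \<le> \<delta> k" if "k < n" for k using seq(2)[OF that] by simp
    show "0 < \<eta>" "\<eta> \<le> 1 / 2" using \<epsilon> by (auto simp: \<eta>_def)
  qed
  have err: "err n \<le> 1" "err n \<le> \<epsilon> / 8" using path(3) seq(3) by (auto simp: err_def e0_def)
  have "s n = 1 + (\<Sum>k<n. \<Sum>i\<in>K. z k i)" unfolding s_def using z'_sum[of _ "\<lambda>_. 1"] by simp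
  also have "\<dots> = 1 + sum Z K" by (subst sum.swap) (simp add: seq(4))
  finally have sL: "L \<le> s n" using path(2) by simp
  have others: "s k \<le> real m * mass_others i k" if i: "i < N" and k: "k \<le> n" for i k
  proof (cases "i \<in> K")
    case True
    then obtain j where j: "j \<in> K" "r {i} j \<le> - c" using c(2) by (auto simp: R_def)
    have "s k \<le> (1 + 1 / c) * mass_others i k"
      using s_le_mass_others[OF i _ c(1) j(2) err(1) k] j(1) KN by blast
    also have "\<dots> \<le> real m * mass_others i k"
      using m mass_others_ge_1[OF k i] by (intro mult_right_mono) auto
    finally show ?thesis .
  next
    case False
    then have "s k = 1 * mass_others i k" by (simp add: mass_others_def z'_def)
    also have "\<dots> \<le> real m * mass_others i k"
      using m1 mass_others_ge_1[OF k i] by (intro mult_right_mono) auto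
    finally show ?thesis .
  qed
  have gain: "reach i n + err n + 4 * \<eta> + (1 + err n) / s n \<le> \<epsilon>" if i: "i < N" for i
  proof -
    have sn: "0 < s n" using s_ge_1[of n] by simp
    have "reach i n ^ m \<le> real m / s n" by (rule reach_power_le[OF i others[OF i]])
    also have "\<dots> \<le> (\<epsilon> / 8) ^ m"
    proof -
      have "real m \<le> L * (\<epsilon> / 8) ^ m" using L0(3) \<epsilon> by (simp add: pos_divide_le_eq)
      also have "\<dots> \<le> s n * (\<epsilon> / 8) ^ m" using sL \<epsilon> by (intro mult_right_mono) auto
      finally show ?thesis using sn by (simp add: pos_divide_le_eq mult.commute)
    qed
    finally have "reach i n \<le> \<epsilon> / 8"
      using \<epsilon> m1 power_mono_iff[of "reach i n" "\<epsilon> / 8" m] reach_nonneg[of n i] i by simp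
    moreover have "4 * \<eta> \<le> \<epsilon> / 8" by (simp add: \<eta>_def)
    moreover have "(1 + err n) / s n \<le> 2 * (\<epsilon> / 8)"
    proof -
      have "1 \<le> L * (\<epsilon> / 8)" using L0(2) \<epsilon> by (simp add: pos_divide_le_eq)
      also have "\<dots> \<le> s n * (\<epsilon> / 8)" using sL \<epsilon> by (intro mult_right_mono) auto
      finally have "2 \<le> 2 * (\<epsilon> / 8) * s n" by (simp add: mult.commute)
      then have "1 + err n \<le> 2 * (\<epsilon> / 8) * s n" using err(1) by linarith
      then show ?thesis using sn by (simp add: pos_divide_le_eq)
    qed
    ultimately show ?thesis using err(2) \<epsilon> by linarith
  qed
  obtain \<xi> where \<xi>: "sunspot_profile N \<xi>" "at_most_one_quits N \<xi>"
    "\<And>i y. i < N \<Longrightarrow> sunspot_strat y \<Longrightarrow> gamma_sunspot N r (\<xi>(i := y)) i \<le> gamma_sunspot N r \<xi> i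
        + (reach i n + err n + 4 * \<eta> + (1 + err n) / s n)"
    using sunspot_strategy by blast
  have "sunspot_eps_equilibrium N r \<epsilon> \<xi>"
    unfolding sunspot_eps_equilibrium_def using \<xi>(1,3) gain by (smt (verit))
  then show ?thesis using \<xi>(2) by blast
qed

section \<open>Stationary equilibria\<close>

text \<open>Kuhn's combinatorial lemma on ever finer grids. Away from the faces, label
  \<open>0\<close> records \<open>F i \<ge> 0\<close> and label \<open>1\<close> records
  \<open>F i < 0\<close>; on the faces the label is forced. Cells carrying both labels in each
  coordinate shrink to \<open>x\<close>. If \<open>F i x\<close> is positive, label \<open>1\<close>
  near \<open>x\<close> can only be forced by the upper face, so \<open>x i = 1\<close>; the other
  sign is symmetric.\<close>

lemma complementary_point:
  fixes F :: "nat \<Rightarrow> (nat \<Rightarrow> real) \<Rightarrow> real"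
  assumes cont: "\<And>i X x. i < N \<Longrightarrow> (\<And>j. j < N \<Longrightarrow> (\<lambda>n. X n j) \<longlonglongrightarrow> x j) \<Longrightarrow> (\<lambda>n. F i (X n)) \<longlonglongrightarrow> F i x"
  shows "\<exists>x. \<forall>i<N. 0 \<le> x i \<and> x i \<le> 1 \<and> (0 < F i x \<longrightarrow> x i = 1) \<and> (F i x < 0 \<longrightarrow> x i = 0)"
proof -
  define lab :: "nat \<Rightarrow> (nat \<Rightarrow> nat) \<Rightarrow> nat \<Rightarrow> nat" where
    "lab p y i = (if y i = 0 \<or> (y i \<noteq> p \<and> 0 \<le> F i (\<lambda>j. real (y j) / real p)) then 0 else 1)" for p y i
  define near where "near q y \<longleftrightarrow> (\<forall>j<N. q j \<le> y j \<and> y j \<le> q j + 1)" for q y :: "nat \<Rightarrow> nat"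
  define P where "P n q a b \<longleftrightarrow> (\<forall>i<N. q i < Suc n) \<and> (\<forall>i<N. near q (a i) \<and> near q (b i) \<and>
      lab (Suc n) (a i) i = 0 \<and> lab (Suc n) (b i) i = 1)" for n q a b
  have "\<exists>q a b. P n q a b" for n
  proof -
    obtain q where q: "\<forall>i<N. q i < Suc n"
      "\<forall>i<N. \<exists>y y'. near q y \<and> near q y' \<and> lab (Suc n) y i \<noteq> lab (Suc n) y' i"
      unfolding near_def by (rule kuhn_lemma[of "Suc n" N "lab (Suc n)"]) (auto simp: lab_def)
    have "\<forall>i. \<exists>a b. i < N \<longrightarrow> near q a \<and> near q b \<and> lab (Suc n) a i = 0 \<and> lab (Suc n) b i = 1"
    proof
      fix i
      show "\<exists>a b. i < N \<longrightarrow> near q a \<and> near q b \<and> lab (Suc n) a i = 0 \<and> lab (Suc n) b i = 1"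
      proof (cases "i < N")
        case True
        then obtain y y' where "near q y" "near q y'" "lab (Suc n) y i \<noteq> lab (Suc n) y' i" using q(2) by blast
        moreover have "lab (Suc n) y i = 0 \<or> lab (Suc n) y i = 1" "lab (Suc n) y' i = 0 \<or> lab (Suc n) y' i = 1"
          by (auto simp: lab_def)
        ultimately show ?thesis by metis
      qed simp
    qed
    then obtain a b where "\<And>i. i < N \<Longrightarrow> near q (a i) \<and> near q (b i) \<and> lab (Suc n) (a i) i = 0 \<and> lab (Suc n) (b i) i = 1"
      by metis
    then have "P n q a b" using q(1) unfolding P_def by blast
    then show ?thesis by blast
  qed
  then obtain q a b where P: "\<And>n. P n (q n) (a n) (b n)" by metis
  define Q where "Q n j = real (q n j) / real (Suc n)" for n j
  have Q01: "0 \<le> Q n j" "Q n j \<le> 1" if "j < N" for n j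
    using P[of n] that by (auto simp: Q_def P_def divide_le_eq less_imp_le)
  then have "\<bar>Q n j\<bar> \<le> 1" if "j \<in> {..<N}" for n j using that by auto
  then obtain s x where s: "strict_mono s" and x: "\<And>j. j \<in> {..<N} \<Longrightarrow> (\<lambda>n. Q (s n) j) \<longlonglongrightarrow> x j"
    using finite_subseq_convergent[of "{..<N}" Q 1] by blast
  have inv0: "(\<lambda>n. 1 / real (Suc (s n))) \<longlonglongrightarrow> 0"
    using LIMSEQ_subseq_LIMSEQ[OF LIMSEQ_inverse_real_of_nat s] by (simp add: o_def inverse_eq_divide)
  have conv: "(\<lambda>n. real (y n j) / real (Suc (s n))) \<longlonglongrightarrow> x j"
    if "\<And>n. near (q (s n)) (y n)" "j < N" for y j
  proof (rule tendsto_sandwich[OF always_eventually always_eventually])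
    show "(\<lambda>n. Q (s n) j) \<longlonglongrightarrow> x j" using x that(2) by simp
    show "(\<lambda>n. Q (s n) j + 1 / real (Suc (s n))) \<longlonglongrightarrow> x j"
      using tendsto_add[OF x[of j] inv0] that(2) by simp
    have nr: "q (s n) j \<le> y n j" "y n j \<le> q (s n) j + 1" for n using that by (auto simp: near_def)
    show "\<forall>n. Q (s n) j \<le> real (y n j) / real (Suc (s n))"
      using nr by (auto simp: Q_def intro!: divide_right_mono)
    show "\<forall>n. real (y n j) / real (Suc (s n)) \<le> Q (s n) j + 1 / real (Suc (s n))"
    proof
      fix n
      have "real (y n j) / real (Suc (s n)) \<le> (real (q (s n) j) + 1) / real (Suc (s n))"
        using nr[of n] by (intro divide_right_mono) linarith+
      then show "real (y n j) / real (Suc (s n)) \<le> Q (s n) j + 1 / real (Suc (s n))"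
        by (simp add: Q_def add_divide_distrib)
    qed
  qed
  have "0 \<le> x i \<and> x i \<le> 1 \<and> (0 < F i x \<longrightarrow> x i = 1) \<and> (F i x < 0 \<longrightarrow> x i = 0)" if i: "i < N" for i
  proof (intro conjI impI)
    show "0 \<le> x i" using Q01(1)[OF i] i by (intro LIMSEQ_le_const[OF x]) auto
    show "x i \<le> 1" using Q01(2)[OF i] i by (intro LIMSEQ_le_const2[OF x]) auto
    have na: "near (q (s n)) (a (s n) i)" and nb: "near (q (s n)) (b (s n) i)"
      and la: "lab (Suc (s n)) (a (s n) i) i = 0" and lb: "lab (Suc (s n)) (b (s n) i) i = 1" for n
      using P[of "s n"] i by (auto simp: P_def)
    note ca = conv[of "\<lambda>n. a (s n) i", OF na] and cb = conv[of "\<lambda>n. b (s n) i", OF nb]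
    have Fa: "(\<lambda>n. F i (\<lambda>j. real (a (s n) i j) / real (Suc (s n)))) \<longlonglongrightarrow> F i x" using i ca by (rule cont)
    have Fb: "(\<lambda>n. F i (\<lambda>j. real (b (s n) i j) / real (Suc (s n)))) \<longlonglongrightarrow> F i x" using i cb by (rule cont)
    show "x i = 1" if pos: "0 < F i x"
    proof -
      have "\<forall>\<^sub>F n in sequentially. real (b (s n) i i) / real (Suc (s n)) = 1"
        using order_tendstoD(1)[OF Fb pos]
      proof eventually_elim
        case (elim n)
        then have "b (s n) i i = Suc (s n)" using lb[of n] by (auto simp: lab_def split: if_splits)
        then show ?case by simp
      qed
      then have "(\<lambda>n. real (b (s n) i i) / real (Suc (s n))) \<longlonglongrightarrow> 1" by (rule tendsto_eventually)
      then show ?thesis using cb[OF i] LIMSEQ_unique by blast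
    qed
    show "x i = 0" if neg: "F i x < 0"
    proof -
      have "\<forall>\<^sub>F n in sequentially. real (a (s n) i i) / real (Suc (s n)) = 0"
        using order_tendstoD(2)[OF Fa neg]
      proof eventually_elim
        case (elim n)
        then have "a (s n) i i = 0" using la[of n] by (auto simp: lab_def split: if_splits)
        then show ?case by simp
      qed
      then have "(\<lambda>n. real (a (s n) i i) / real (Suc (s n))) \<longlonglongrightarrow> 0" by (rule tendsto_eventually)
      then show ?thesis using ca[OF i] LIMSEQ_unique by blast
    qed
  qed
  then show ?thesis by blast
qed

section \<open>Stage values for small quitting probabilities\<close>

lemma tendsto_stage_val:
  assumes "\<And>j. j \<in> A \<Longrightarrow> (\<lambda>n. X n j) \<longlonglongrightarrow> x j"
  shows "(\<lambda>n. stage_val A (X n) f) \<longlonglongrightarrow> stage_val A x f"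
  unfolding stage_val_def using assms
  by (intro tendsto_sum tendsto_mult tendsto_prod tendsto_diff tendsto_const) auto

lemma stage_val_abs_le:
  assumes "finite A" "\<And>i. i \<in> A \<Longrightarrow> 0 \<le> x i \<and> x i \<le> 1" "\<And>S. S \<subseteq> A \<Longrightarrow> \<bar>f S\<bar> \<le> B"
  shows "\<bar>stage_val A x f\<bar> \<le> B"
proof -
  have "stage_val A x f \<le> stage_val A x (\<lambda>_. B)" "stage_val A x (\<lambda>_. - B) \<le> stage_val A x f"
    using assms(2,3) by (auto intro!: stage_val_mono simp: abs_le_iff minus_le_iff)
  then show ?thesis using stage_val_const[OF assms(1)] by (simp add: abs_le_iff)
qed

lemma stage_val_zeroth_order:
  assumes "finite A" "\<And>i. i \<in> A \<Longrightarrow> 0 \<le> x i \<and> x i \<le> 1" "\<And>S. S \<subseteq> A \<Longrightarrow> \<bar>f S\<bar> \<le> 1"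
  shows "\<bar>stage_val A x f - f {}\<bar> \<le> 2 * sum x A"
  using assms
proof (induction A arbitrary: f)
  case (insert a A)
  have xA: "\<And>i. i \<in> A \<Longrightarrow> 0 \<le> x i \<and> x i \<le> 1" using insert.prems(1) by blast
  have fA: "\<bar>f S\<bar> \<le> 1" "\<bar>f (insert a S)\<bar> \<le> 1" if "S \<subseteq> A" for S
    using that by (intro insert.prems(2); blast)+
  have xa: "0 \<le> x a" "x a \<le> 1" using insert.prems(1) by auto
  have IH: "\<bar>stage_val A x f - f {}\<bar> \<le> 2 * sum x A" using xA fA(1) by (rule insert.IH)
  have "\<bar>stage_val A x (\<lambda>S. f (insert a S))\<bar> \<le> 1" using insert.hyps(1) xA fA(2) by (rule stage_val_abs_le)
  then have g: "\<bar>stage_val A x (\<lambda>S. f (insert a S)) - f {}\<bar> \<le> 2" using insert.prems(2)[of "{}"] by simp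
  have "stage_val (insert a A) x f - f {}
      = (1 - x a) * (stage_val A x f - f {}) + x a * (stage_val A x (\<lambda>S. f (insert a S)) - f {})"
    using insert.hyps by (simp add: stage_val_insert algebra_simps)
  also have "\<bar>\<dots>\<bar> \<le> (1 - x a) * \<bar>stage_val A x f - f {}\<bar> + x a * \<bar>stage_val A x (\<lambda>S. f (insert a S)) - f {}\<bar>"
    using xa by (intro order_trans[OF abs_triangle_ineq]) (simp add: abs_mult)
  also have "\<dots> \<le> 1 * (2 * sum x A) + x a * 2"
    using xa IH g xA by (intro add_mono mult_mono) (auto intro!: sum_nonneg)
  finally show ?case using insert.hyps by simp
qed simp

text \<open>Simultaneous quitting by two players is a second-order event, so to first order only
  single quitters count.\<close>

lemma stage_val_first_order:
  assumes "finite A" "\<And>i. i \<in> A \<Longrightarrow> 0 \<le> x i \<and> x i \<le> 1" "\<And>S. S \<subseteq> A \<Longrightarrow> \<bar>f S\<bar> \<le> 1" "f {} = 0"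
  shows "\<bar>stage_val A x f - (\<Sum>i\<in>A. x i * f {i})\<bar> \<le> 2 * (sum x A)\<^sup>2"
  using assms
proof (induction A)
  case (insert a A)
  define \<sigma> where "\<sigma> = sum x A"
  have xA: "\<And>i. i \<in> A \<Longrightarrow> 0 \<le> x i \<and> x i \<le> 1" using insert.prems(1) by blast
  have fA: "\<bar>f S\<bar> \<le> 1" "\<bar>f (insert a S)\<bar> \<le> 1" if "S \<subseteq> A" for S
    using that by (intro insert.prems(2); blast)+
  have xa: "0 \<le> x a" "x a \<le> 1" using insert.prems(1) by auto
  have \<sigma>: "0 \<le> \<sigma>" unfolding \<sigma>_def using xA by (intro sum_nonneg) auto
  have IH: "\<bar>stage_val A x f - (\<Sum>i\<in>A. x i * f {i})\<bar> \<le> 2 * \<sigma>\<^sup>2"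
    unfolding \<sigma>_def using xA fA(1) insert.prems(3) by (rule insert.IH)
  have T: "\<bar>stage_val A x f\<bar> \<le> 2 * \<sigma>"
    using stage_val_zeroth_order[of A x f, OF insert.hyps(1) xA fA(1)] insert.prems(3) unfolding \<sigma>_def by simp
  have G: "\<bar>stage_val A x (\<lambda>S. f (insert a S)) - f {a}\<bar> \<le> 2 * \<sigma>"
    using stage_val_zeroth_order[of A x "\<lambda>S. f (insert a S)", OF insert.hyps(1) xA fA(2)] unfolding \<sigma>_def by simp
  have "stage_val (insert a A) x f - (\<Sum>i\<in>insert a A. x i * f {i})
      = (stage_val A x f - (\<Sum>i\<in>A. x i * f {i})) + (x a * (stage_val A x (\<lambda>S. f (insert a S)) - f {a}) - x a * stage_val A x f)"
    using insert.hyps by (simp add: stage_val_insert algebra_simps)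
  also have "\<bar>\<dots>\<bar> \<le> 2 * \<sigma>\<^sup>2 + (x a * (2 * \<sigma>) + x a * (2 * \<sigma>))"
  proof -
    have "\<bar>x a * (stage_val A x (\<lambda>S. f (insert a S)) - f {a})\<bar> \<le> x a * (2 * \<sigma>)"
      "\<bar>x a * stage_val A x f\<bar> \<le> x a * (2 * \<sigma>)"
      using G T xa by (auto simp: abs_mult intro!: mult_left_mono)
    then show ?thesis using IH by linarith
  qed
  also have "\<dots> \<le> 2 * (x a + \<sigma>)\<^sup>2" using xa \<sigma> by (simp add: power2_eq_square algebra_simps)
  finally show ?case using insert.hyps by (simp add: \<sigma>_def)
qed simp

lemma stage_val_with_cont:
  assumes "finite A"
  shows "stage_val A x (with_cont r i V) = stage_val A x (with_cont r i 0) + (\<Prod>j\<in>A. 1 - x j) * V"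
  unfolding stage_val_def using assms
  by (subst (1 2) sum.remove[of _ "{}"]) (auto simp: with_cont_def intro!: sum.cong)

lemma one_minus_prod_le_sum:
  fixes x :: "'a \<Rightarrow> real"
  assumes "finite A" "\<And>i. i \<in> A \<Longrightarrow> 0 \<le> x i \<and> x i \<le> 1"
  shows "1 - (\<Prod>i\<in>A. 1 - x i) \<le> sum x A"
  using assms
proof induction
  case (insert a A)
  have "x a * (\<Prod>i\<in>A. 1 - x i) \<le> x a"
    using insert.prems by (intro mult_left_le prod_le_1) auto
  then show ?case using insert by (simp add: algebra_simps)
qed simp

section \<open>Best replies to stationary strategies\<close>

text \<open>Together with \<open>cont_val\<close> and \<open>stay_prob\<close> this describes the
  one-stage problem of \<open>i\<close> against the others; none of the three depends on
  \<open>x i\<close>, and \<open>cont_val\<close> counts unanimous continuation as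
  \<open>0\<close>.\<close>

definition quit_val :: "nat \<Rightarrow> (nat set \<Rightarrow> nat \<Rightarrow> real) \<Rightarrow> nat \<Rightarrow> (nat \<Rightarrow> real) \<Rightarrow> real" where
  "quit_val N r i x = stage_val ({..<N} - {i}) x (\<lambda>S. r (insert i S) i)"

definition cont_val :: "nat \<Rightarrow> (nat set \<Rightarrow> nat \<Rightarrow> real) \<Rightarrow> nat \<Rightarrow> (nat \<Rightarrow> real) \<Rightarrow> real" where
  "cont_val N r i x = stage_val ({..<N} - {i}) x (with_cont r i 0)"

definition stay_prob :: "nat \<Rightarrow> nat \<Rightarrow> (nat \<Rightarrow> real) \<Rightarrow> real" where
  "stay_prob N i x = (\<Prod>j\<in>{..<N} - {i}. 1 - x j)"

text \<open>The sign tells whether player \<open>i\<close> prefers quitting at once to never quitting, in the game in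
  which at each stage the play is in addition stopped at rate \<open>l\<close> with payoff \<open>q\<close>.\<close>
definition incentive :: "nat \<Rightarrow> (nat set \<Rightarrow> nat \<Rightarrow> real) \<Rightarrow> (nat \<Rightarrow> real) \<Rightarrow> real \<Rightarrow> nat \<Rightarrow> (nat \<Rightarrow> real) \<Rightarrow> real" where
  "incentive N r q l i x = (l + 1 - stay_prob N i x) * quit_val N r i x - l * q i - cont_val N r i x"

lemma stage_val_split:
  assumes "i < N"
  shows "stage_val {..<N} x (with_cont r i V)
    = (1 - x i) * (cont_val N r i x + stay_prob N i x * V) + x i * quit_val N r i x"
proof -
  have "(\<lambda>S. with_cont r i V (insert i S)) = (\<lambda>S. r (insert i S) i)" by (simp add: with_cont_def)
  then show ?thesis using assms
    by (subst stage_val_remove[of _ i])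
      (simp_all add: stage_val_with_cont[of "{..<N} - {i}" x r i V] cont_val_def quit_val_def stay_prob_def)
qed

lemma vals_cong:
  assumes "\<And>j. j < N \<Longrightarrow> j \<noteq> i \<Longrightarrow> x j = y j"
  shows "quit_val N r i x = quit_val N r i y" "cont_val N r i x = cont_val N r i y"
    "stay_prob N i x = stay_prob N i y"
  unfolding quit_val_def cont_val_def stay_prob_def
  using assms by (auto intro!: stage_val_cong prod.cong)

lemma stay_prob_bounds:
  assumes "\<And>j. j < N \<Longrightarrow> 0 \<le> x j \<and> x j \<le> 1"
  shows "0 \<le> stay_prob N i x" "stay_prob N i x \<le> 1"
  unfolding stay_prob_def using assms by (auto intro!: prod_nonneg prod_le_1)

lemma stay_prob_le:
  assumes "\<And>j. j < N \<Longrightarrow> 0 \<le> x j \<and> x j \<le> 1" "j < N" "j \<noteq> i"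
  shows "stay_prob N i x \<le> 1 - x j"
proof -
  have "stay_prob N i x = (1 - x j) * (\<Prod>j\<in>{..<N} - {i} - {j}. 1 - x j)"
    unfolding stay_prob_def using assms(2,3) by (subst prod.remove[of _ j]) auto
  also have "\<dots> \<le> 1 - x j" using assms by (intro mult_left_le prod_le_1) auto
  finally show ?thesis .
qed

text \<open>The other players alone stop the game at a geometric rate, so no strategy of
  \<open>i\<close> can obtain the payoff \<open>r {} i\<close>.\<close>

lemma cont_prob_tendsto_0:
  assumes y: "profile N y" "\<And>j t. j < N \<Longrightarrow> j \<noteq> i \<Longrightarrow> y j t = x j"
    and x: "\<And>j. j < N \<Longrightarrow> 0 \<le> x j \<and> x j \<le> 1" and i: "i < N" and stay: "stay_prob N i x < 1"
  shows "cont_prob N y \<longlonglongrightarrow> 0"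
proof (rule tendsto_sandwich[where f = "\<lambda>_. 0" and h = "\<lambda>t. stay_prob N i x ^ t", OF always_eventually always_eventually])
  have "cont_prob N y t \<le> stay_prob N i x ^ t" for t
  proof (induction t)
    case (Suc t)
    have "(\<Prod>j<N. 1 - y j t) = (1 - y i t) * stay_prob N i x"
      unfolding stay_prob_def using i y(2) by (subst prod.remove[of _ i]) (auto intro!: prod.cong)
    also have "\<dots> \<le> stay_prob N i x"
      using profileD[OF y(1) i, of t] stay_prob_bounds(1)[of N x i, OF x] by (simp add: mult_left_le_one_le)
    finally have "cont_prob N y (Suc t) \<le> stay_prob N i x ^ t * stay_prob N i x"
      unfolding cont_prob_Suc using Suc profileD[OF y(1)] stay_prob_bounds(1)[of N x i, OF x]
      by (intro mult_mono) (auto intro!: prod_nonneg)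
    then show ?case by (simp add: mult.commute)
  qed simp
  then show "\<forall>t. cont_prob N y t \<le> stay_prob N i x ^ t" by blast
  show "(\<lambda>t. stay_prob N i x ^ t) \<longlonglongrightarrow> 0"
    using stay stay_prob_bounds(1)[of N x i, OF x] by (intro LIMSEQ_power_zero) auto
  show "\<forall>t. 0 \<le> cont_prob N y t" using cont_prob_bounds(1)[OF y(1)] by blast
qed auto

lemma deviation_le:
  assumes r: "payoffs_ok N r" and x: "\<And>j. j < N \<Longrightarrow> 0 \<le> x j \<and> x j \<le> 1"
    and i: "i < N" and stay: "stay_prob N i x < 1" and y: "strat y"
    and V: "quit_val N r i x \<le> V" "cont_val N r i x \<le> (1 - stay_prob N i x) * V"
  shows "gamma N r ((\<lambda>j t. x j)(i := y)) i \<le> V"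
proof (rule gamma_le_of_stage_le[OF _ r i])
  let ?y = "(\<lambda>j t. x j)(i := y)"
  show prof: "profile N ?y" using x y by (auto simp: profile_def strat_def)
  show "cont_prob N ?y \<longlonglongrightarrow> 0" by (rule cont_prob_tendsto_0[where x = x, OF prof _ x i stay]) auto
  fix t
  have y01: "0 \<le> y t" "y t \<le> 1" using y by (auto simp: strat_def)
  have "stage_val {..<N} (\<lambda>j. ?y j t) (with_cont r i V)
      = (1 - y t) * (cont_val N r i x + stay_prob N i x * V) + y t * quit_val N r i x"
    using vals_cong[where N = N and i = i and x = "\<lambda>j. ?y j t" and y = x] by (simp add: stage_val_split[OF i])
  also have "\<dots> \<le> (1 - y t) * V + y t * V"
    using y01 V by (intro add_mono mult_left_mono) (auto simp: algebra_simps)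
  finally show "stage_val {..<N} (\<lambda>j. ?y j t) (with_cont r i V) \<le> V" by (simp add: algebra_simps)
qed

text \<open>The solution of the stationarity equation
  \<open>V = x i * quit_val + (1 - x i) * (cont_val + stay_prob * V)\<close>.\<close>

definition stat_val :: "nat \<Rightarrow> (nat set \<Rightarrow> nat \<Rightarrow> real) \<Rightarrow> nat \<Rightarrow> (nat \<Rightarrow> real) \<Rightarrow> real" where
  "stat_val N r i x = (x i * quit_val N r i x + (1 - x i) * cont_val N r i x) / (1 - (1 - x i) * stay_prob N i x)"

lemma stat_val_denom_pos:
  assumes "\<And>j. j < N \<Longrightarrow> 0 \<le> x j \<and> x j \<le> 1" "i < N" "stay_prob N i x < 1"
  shows "0 < 1 - (1 - x i) * stay_prob N i x"
proof -
  have "(1 - x i) * stay_prob N i x \<le> stay_prob N i x"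
    using assms(1)[OF assms(2)] stay_prob_bounds(1)[of N x i, OF assms(1)] by (simp add: mult_left_le_one_le)
  then show ?thesis using assms(3) by linarith
qed

lemma gamma_stationary:
  assumes r: "payoffs_ok N r" and x: "\<And>j. j < N \<Longrightarrow> 0 \<le> x j \<and> x j \<le> 1"
    and i: "i < N" and stay: "stay_prob N i x < 1"
  shows "gamma N r (\<lambda>j t. x j) i = stat_val N r i x"
proof -
  define V where "V = stat_val N r i x"
  have prof: "profile N (\<lambda>j t. x j)" using x by (simp add: profile_def strat_def)
  have abs: "cont_prob N (\<lambda>j t. x j) \<longlonglongrightarrow> 0" by (rule cont_prob_tendsto_0[where x = x, OF prof _ x i stay]) auto
  have "0 < 1 - (1 - x i) * stay_prob N i x" by (rule stat_val_denom_pos[where x = x, OF x i stay])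
  then have "V * (1 - (1 - x i) * stay_prob N i x) = x i * quit_val N r i x + (1 - x i) * cont_val N r i x"
    unfolding V_def stat_val_def by simp
  then have eq: "stage_val {..<N} x (with_cont r i V) = V"
    unfolding stage_val_split[OF i] by (simp add: algebra_simps)
  have "gamma N r (\<lambda>j t. x j) i \<le> V"
    using eq by (intro gamma_le_of_stage_le[OF prof r i _ abs]) simp
  moreover have "gamma N (\<lambda>S j. - r S j) (\<lambda>j t. x j) i \<le> - V"
  proof (rule gamma_le_of_stage_le[OF prof payoffs_ok_uminus[OF r] i _ abs])
    have "with_cont (\<lambda>S j. - r S j) i (- V) = (\<lambda>S. - with_cont r i V S)" by (auto simp: with_cont_def)
    then show "stage_val {..<N} x (with_cont (\<lambda>S j. - r S j) i (- V)) \<le> - V"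
      using eq by (simp add: stage_val_uminus)
  qed
  ultimately show ?thesis using gamma_uminus[OF prof r i] by (simp add: V_def)
qed

text \<open>\<open>stat_val\<close> is an average of \<open>quit_val\<close> and of
  \<open>cont_val / (1 - stay_prob)\<close>, the value of never quitting, with weights proportional
  to \<open>x i\<close> and \<open>(1 - x i) * (1 - stay_prob)\<close>. The sign conditions put no
  weight on the smaller one.\<close>

lemma complementary_imp_best_reply:
  assumes x: "\<And>j. j < N \<Longrightarrow> 0 \<le> x j \<and> x j \<le> 1" and i: "i < N" and stay: "stay_prob N i x < 1"
    and compl: "0 < incentive N r q 0 i x \<Longrightarrow> x i = 1" "incentive N r q 0 i x < 0 \<Longrightarrow> x i = 0"
  shows "quit_val N r i x \<le> stat_val N r i x"
    and "cont_val N r i x \<le> (1 - stay_prob N i x) * stat_val N r i x"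
proof -
  define A C P where "A = quit_val N r i x" and "C = cont_val N r i x" and "P = stay_prob N i x"
  define D where "D = 1 - (1 - x i) * P"
  have D: "0 < D" unfolding D_def P_def by (rule stat_val_denom_pos[where x = x, OF x i stay])
  have V: "stat_val N r i x = (x i * A + (1 - x i) * C) / D"
    by (simp add: stat_val_def A_def C_def P_def D_def)
  have F: "incentive N r q 0 i x = (1 - P) * A - C" by (simp add: incentive_def A_def C_def P_def)
  have "0 \<le> x i" "x i \<le> 1" using x[OF i] by auto
  then have "(1 - x i) * ((1 - P) * A - C) \<le> 0" "0 \<le> x i * ((1 - P) * A - C)"
    using compl unfolding F by (cases "(1 - P) * A - C" "0 :: real" rule: linorder_cases; simp add: mult_nonneg_nonpos)+
  then have "A * D \<le> x i * A + (1 - x i) * C" "C * D \<le> (1 - P) * (x i * A + (1 - x i) * C)"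
    by (simp_all add: D_def algebra_simps)
  then show "quit_val N r i x \<le> stat_val N r i x"
    "cont_val N r i x \<le> (1 - stay_prob N i x) * stat_val N r i x"
    using D unfolding V A_def[symmetric] C_def[symmetric] P_def[symmetric] by (simp_all add: pos_le_divide_eq)
qed

lemma stationary_eps_equilibriumI:
  assumes r: "payoffs_ok N r" and x: "\<And>j. j < N \<Longrightarrow> 0 \<le> x j \<and> x j \<le> 1"
    and stay: "\<And>i. i < N \<Longrightarrow> stay_prob N i x < 1"
    and V: "\<And>i. i < N \<Longrightarrow> quit_val N r i x \<le> stat_val N r i x + \<epsilon>"
      "\<And>i. i < N \<Longrightarrow> cont_val N r i x \<le> (1 - stay_prob N i x) * (stat_val N r i x + \<epsilon>)"
  shows "\<exists>x. stationary N x \<and> eps_equilibrium N r \<epsilon> x"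
proof (intro exI conjI)
  show "stationary N (\<lambda>i t. x i)" by (simp add: stationary_def)
  show "eps_equilibrium N r \<epsilon> (\<lambda>i t. x i)"
    unfolding eps_equilibrium_def
  proof (intro conjI allI impI)
    show "profile N (\<lambda>i t. x i)" using x by (simp add: profile_def strat_def)
    show "gamma N r ((\<lambda>i t. x i)(i := y)) i \<le> gamma N r (\<lambda>i t. x i) i + \<epsilon>" if "i < N" "strat y" for i y
      using deviation_le[where x = x, OF r x that(1) stay[OF that(1)] that(2) V[OF that(1)]]
        gamma_stationary[where x = x, OF r x that(1) stay[OF that(1)]] by simp
  qed
qed

section \<open>Vanishing extra stopping\<close>

lemma tendsto_vals:
  assumes "\<And>j. j < N \<Longrightarrow> j \<noteq> i \<Longrightarrow> (\<lambda>n. X n j) \<longlonglongrightarrow> x j"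
  shows "(\<lambda>n. quit_val N r i (X n)) \<longlonglongrightarrow> quit_val N r i x"
    "(\<lambda>n. cont_val N r i (X n)) \<longlonglongrightarrow> cont_val N r i x"
    "(\<lambda>n. stay_prob N i (X n)) \<longlonglongrightarrow> stay_prob N i x"
  unfolding quit_val_def cont_val_def stay_prob_def using assms
  by (auto intro!: tendsto_stage_val tendsto_prod tendsto_diff)

lemma tendsto_incentive:
  assumes "l \<longlonglongrightarrow> l'" "\<And>j. j < N \<Longrightarrow> (\<lambda>n. X n j) \<longlonglongrightarrow> x j"
  shows "(\<lambda>n. incentive N r q (l n) i (X n)) \<longlonglongrightarrow> incentive N r q l' i x"
  unfolding incentive_def using assms by (intro tendsto_intros tendsto_vals) auto

text \<open>\<open>quit_val\<close> tends to \<open>r {i} i = 0\<close> and its factor is at most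
  \<open>l\<close> plus the quitting rates of the others, so this product is negligible. Only the
  others have to vanish, since \<open>incentive\<close> ignores \<open>X n i\<close>; the case of a
  lone quitter \<open>i\<close> is thereby covered.\<close>

lemma incentive_first_order:
  assumes r: "payoffs_ok N r" "r {i} i = 0" and i: "i < N"
    and X: "\<And>n j. j < N \<Longrightarrow> 0 \<le> X n j \<and> X n j \<le> 1"
    and X0: "\<And>j. j < N \<Longrightarrow> j \<noteq> i \<Longrightarrow> (\<lambda>n. X n j) \<longlonglongrightarrow> 0"
    and l: "\<And>n. 0 < l n" and c: "0 < (c::real)"
  shows "\<forall>\<^sub>F n in sequentially.
    \<bar>incentive N r q (l n) i (X n) + l n * q i + (\<Sum>j\<in>{..<N} - {i}. X n j * r {j} i)\<bar>
      \<le> c * (l n + sum (X n) ({..<N} - {i}))"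
proof -
  let ?J = "{..<N} - {i}"
  have "(\<lambda>n. quit_val N r i (X n)) \<longlonglongrightarrow> quit_val N r i (\<lambda>_. 0)" using X0 by (intro tendsto_vals) auto
  moreover have "quit_val N r i (\<lambda>_. 0) = 0" unfolding quit_val_def using r(2) by (subst stage_val_zero) auto
  ultimately have A0: "(\<lambda>n. \<bar>quit_val N r i (X n)\<bar>) \<longlonglongrightarrow> 0" using tendsto_rabs_zero by metis
  have S0: "(\<lambda>n. \<Sum>j\<in>?J. X n j) \<longlonglongrightarrow> 0" using X0 by (intro tendsto_null_sum) auto
  have rb: "\<bar>r S i\<bar> \<le> 1" if "S \<subseteq> {..<N}" for S using r(1) that i by (auto simp: payoffs_ok_def abs_le_iff minus_le_iff)
  have "\<forall>\<^sub>F n in sequentially. \<bar>quit_val N r i (X n)\<bar> < c / 2" using order_tendstoD(2)[OF A0, of "c / 2"] c by simp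
  moreover have "\<forall>\<^sub>F n in sequentially. (sum (X n) ?J) < c / 4" using order_tendstoD(2)[OF S0, of "c / 4"] c by simp
  ultimately show ?thesis
  proof eventually_elim
    case (elim n)
    define \<sigma> where "\<sigma> = sum (X n) ?J"
    define A where "A = quit_val N r i (X n)"
    define P where "P = stay_prob N i (X n)"
    have \<sigma>: "0 \<le> \<sigma>" unfolding \<sigma>_def using X by (intro sum_nonneg) auto
    have P: "P \<le> 1" "1 - P \<le> \<sigma>"
      using stay_prob_bounds(2)[of N "X n" i] X one_minus_prod_le_sum[of ?J "X n"]
      unfolding P_def \<sigma>_def by (auto simp: stay_prob_def)
    have C: "\<bar>cont_val N r i (X n) - (\<Sum>j\<in>?J. X n j * r {j} i)\<bar> \<le> 2 * \<sigma>\<^sup>2"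
    proof -
      have "\<bar>with_cont r i 0 S\<bar> \<le> 1" if "S \<subseteq> ?J" for S
        using rb[of S] that by (auto simp: with_cont_def)
      then have "\<bar>stage_val ?J (X n) (with_cont r i 0) - (\<Sum>j\<in>?J. X n j * with_cont r i 0 {j})\<bar> \<le> 2 * (sum (X n) ?J)\<^sup>2"
        using X by (intro stage_val_first_order) (auto simp: with_cont_def)
      then show ?thesis by (simp add: cont_val_def \<sigma>_def with_cont_def)
    qed
    have "\<bar>(l n + 1 - P) * A\<bar> \<le> (l n + \<sigma>) * (c / 2)"
      unfolding abs_mult using P l[of n] \<sigma> elim(1) by (intro mult_mono) (auto simp: A_def)
    moreover have "2 * \<sigma>\<^sup>2 \<le> \<sigma> * (c / 2)"
    proof -
      have "\<sigma> * \<sigma> \<le> \<sigma> * (c / 4)" using elim(2) \<sigma> by (intro mult_left_mono) (auto simp: \<sigma>_def)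
      then show ?thesis by (simp add: power2_eq_square)
    qed
    moreover have "incentive N r q (l n) i (X n) + l n * q i + (\<Sum>j\<in>?J. X n j * r {j} i)
        = (l n + 1 - P) * A - (cont_val N r i (X n) - (\<Sum>j\<in>?J. X n j * r {j} i))"
      by (simp add: incentive_def P_def A_def)
    moreover have "(l n + \<sigma>) * (c / 2) + \<sigma> * (c / 2) \<le> c * (l n + \<sigma>)"
      using mult_pos_pos[OF c l[of n]] by (simp add: algebra_simps add_divide_distrib)
    ultimately show ?case using C unfolding \<sigma>_def[symmetric] by linarith
  qed
qed

text \<open>The value \<open>q i = 1\<close> and the positive entries make waiting worth a fixed
  positive multiple of the total rate, while the quitting term is of smaller order. So the incentive
  becomes negative.\<close>

lemma eventually_not_quitting:
  assumes r: "payoffs_ok N r" "r {i} i = 0" and i: "i < N"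
    and X: "\<And>n j. j < N \<Longrightarrow> 0 \<le> X n j \<and> X n j \<le> 1"
    and X0: "\<And>j. j < N \<Longrightarrow> j \<noteq> i \<Longrightarrow> (\<lambda>n. X n j) \<longlonglongrightarrow> 0"
    and l: "\<And>n. 0 < l n" and q: "q i = 1"
    and pos: "\<And>j. j \<in> B \<Longrightarrow> j \<noteq> i \<Longrightarrow> 0 < r {j} i"
    and off: "\<And>j. j < N \<Longrightarrow> j \<noteq> i \<Longrightarrow> j \<notin> B \<Longrightarrow> \<forall>\<^sub>F n in sequentially. X n j = 0"
    and compl: "\<And>n. incentive N r q (l n) i (X n) < 0 \<Longrightarrow> X n i = 0"
  shows "\<forall>\<^sub>F n in sequentially. X n i = 0"
proof -
  let ?J = "{..<N} - {i}"
  define \<rho> where "\<rho> = Min (insert 1 ((\<lambda>j. r {j} i) ` (?J \<inter> B)))"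
  have \<rho>: "0 < \<rho>" unfolding \<rho>_def using pos by (subst Min_gr_iff) auto
  have \<rho>1: "\<rho> \<le> 1" unfolding \<rho>_def by (intro Min_le) auto
  have \<rho>r: "\<rho> \<le> r {j} i" if "j \<in> ?J \<inter> B" for j unfolding \<rho>_def using that by (intro Min_le) auto
  have "\<forall>j\<in>?J - B. \<forall>\<^sub>F n in sequentially. X n j = 0" using off by auto
  then have "\<forall>\<^sub>F n in sequentially. \<forall>j\<in>?J - B. X n j = 0" by (simp add: eventually_ball_finite_distrib)
  moreover have "\<forall>\<^sub>F n in sequentially.
      \<bar>incentive N r q (l n) i (X n) + l n * q i + (\<Sum>j\<in>?J. X n j * r {j} i)\<bar>
        \<le> \<rho> / 2 * (l n + sum (X n) ?J)"
    using X X0 l \<rho> by (intro incentive_first_order r i) auto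
  ultimately show ?thesis
  proof eventually_elim
    case (elim n)
    have "(\<Sum>j\<in>?J. \<rho> * X n j) \<le> (\<Sum>j\<in>?J. X n j * r {j} i)"
    proof (intro sum_mono)
      fix j assume j: "j \<in> ?J"
      show "\<rho> * X n j \<le> X n j * r {j} i"
      proof (cases "j \<in> B")
        case True
        then have "X n j * \<rho> \<le> X n j * r {j} i" using j \<rho>r X by (intro mult_left_mono) auto
        then show ?thesis by (simp add: mult.commute)
      next
        case False
        then show ?thesis using elim(1) j by simp
      qed
    qed
    then have s: "\<rho> * sum (X n) ?J \<le> (\<Sum>j\<in>?J. X n j * r {j} i)" by (simp add: sum_distrib_left)
    have "\<rho> * l n \<le> l n" using \<rho>1 l[of n] by (simp add: mult_left_le_one_le \<rho> less_imp_le)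
    moreover have "0 \<le> sum (X n) ?J" using X by (intro sum_nonneg) auto
    then have "0 < \<rho> / 2 * (l n + sum (X n) ?J)" using \<rho> l[of n] by (simp add: add_pos_nonneg)
    moreover have "\<rho> / 2 * (l n + sum (X n) ?J) = \<rho> * l n / 2 + \<rho> * sum (X n) ?J / 2"
      by (simp add: algebra_simps)
    ultimately have "incentive N r q (l n) i (X n) < 0"
      using abs_le_D1[OF elim(2)] s unfolding q mult_1_right by linarith
    then show ?case by (rule compl)
  qed
qed

lemma no_vanishing_stationary_limit:
  assumes r: "payoffs_ok N r" and diag: "\<And>i. i < N \<Longrightarrow> r {i} i = 0"
    and no: "\<not> (\<exists>w z0 z. lcp_solution (I_star N r) (r_hat r) (\<lambda>_. 0) w z0 z \<and> z0 < 1)"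
    and q: "\<not> (\<exists>z w. lcp_sol (I_star N r) (\<lambda>i j. r {i} j) q z w)"
    and q1: "\<And>i. i < N \<Longrightarrow> i \<notin> I_star N r \<Longrightarrow> q i = 1"
    and l: "\<And>n. 0 < l n" "l \<longlonglongrightarrow> 0"
    and X: "\<And>n j. j < N \<Longrightarrow> 0 \<le> X n j \<and> X n j \<le> 1"
    and X0: "\<And>j. j < N \<Longrightarrow> (\<lambda>n. X n j) \<longlonglongrightarrow> 0"
    and compl: "\<And>n i. i < N \<Longrightarrow> 0 < incentive N r q (l n) i (X n) \<Longrightarrow> X n i = 1"
      "\<And>n i. i < N \<Longrightarrow> incentive N r q (l n) i (X n) < 0 \<Longrightarrow> X n i = 0"
  shows False
proof -
  define K where "K = I_star N r"
  have KN: "K \<subseteq> {..<N}" unfolding K_def by (rule I_star_le)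
  interpret R0_matrix K "\<lambda>i j. r {i} j"
    unfolding K_def using diag by (intro R0_matrix_of_lcp[OF r _ no]) auto
  \<comment> \<open>Induction along the levels: those outside \<open>I_l N r m\<close> are already
    inactive, and a player dropped at the next step gets a positive payoff whenever another member
    of the level quits alone.\<close>
  have off: "\<forall>j. j < N \<longrightarrow> j \<notin> I_l N r m \<longrightarrow> (\<forall>\<^sub>F n in sequentially. X n j = 0)" for m
  proof (induction m)
    case 0
    then show ?case by (simp add: I_l_0)
  next
    case (Suc m)
    show ?case
    proof (intro allI impI)
      fix i assume i: "i < N" "i \<notin> I_l N r (Suc m)"
      show "\<forall>\<^sub>F n in sequentially. X n i = 0"
      proof (cases "i \<in> I_l N r m")
        case True
        have pos: "0 < r {j} i" if "j \<in> I_l N r m" "j \<noteq> i" for j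
          using i(2) True that unfolding I_l_Suc normal_step_def by fastforce
        have "i \<notin> K" using i(2) I_star_subset unfolding K_def by blast
        then have "q i = 1" using q1 i(1) by (simp add: K_def)
        show ?thesis
        proof (rule eventually_not_quitting[where B = "I_l N r m" and l = l and q = q])
          show "r {i} i = 0" by (rule diag[OF i(1)])
          show "\<forall>\<^sub>F n in sequentially. X n j = 0" if "j < N" "j \<noteq> i" "j \<notin> I_l N r m" for j
            using Suc that by blast
          show "q i = 1" by fact
          show "X n i = 0" if "incentive N r q (l n) i (X n) < 0" for n by (rule compl(2)[OF i(1) that])
        qed (use r X X0 l(1) i(1) pos in auto)
      qed (use Suc i(1) in blast)
    qed
  qed
  obtain m where m: "K = I_l N r m" unfolding K_def using I_star_stable by blast
  define T where "T n = l n + (\<Sum>j<N. X n j)" for n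
  have T: "0 < T n" "l n \<le> T n" for n
    unfolding T_def using l(1)[of n] X by (auto intro!: add_pos_nonneg sum_nonneg)
  have XT: "X n j \<le> T n" if "j < N" for n j
  proof -
    have "X n j \<le> (\<Sum>j<N. X n j)" using that X by (intro member_le_sum) auto
    then show ?thesis using l(1)[of n] by (simp add: T_def)
  qed
  have "\<bar>X n j / T n\<bar> \<le> 1" if "j \<in> {..<N}" for n j
    using XT[of j n] T(1)[of n] X[of j n] that by simp
  then obtain s u where s: "strict_mono s" and u: "\<And>j. j \<in> {..<N} \<Longrightarrow> (\<lambda>n. X (s n) j / T (s n)) \<longlonglongrightarrow> u j"
    using finite_subseq_convergent[of "{..<N}" "\<lambda>n j. X n j / T n" 1] by blast
  define u0 where "u0 = 1 - (\<Sum>j<N. u j)"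
  have "l n / T n = 1 - (\<Sum>j<N. X n j / T n)" for n
    using T(1)[of n] by (simp add: T_def sum_divide_distrib[symmetric] field_simps)
  then have u0: "(\<lambda>n. l (s n) / T (s n)) \<longlonglongrightarrow> u0"
    unfolding u0_def using u by (auto intro!: tendsto_intros)
  have u0_nonneg: "0 \<le> u0"
    using T(1) l(1) by (intro LIMSEQ_le_const[OF u0]) (auto intro!: exI[of _ 0] divide_nonneg_pos less_imp_le)
  have u_nonneg: "0 \<le> u j" if "j < N" for j
    using T(1) X[OF that] that by (intro LIMSEQ_le_const[OF u]) (auto intro!: exI[of _ 0] divide_nonneg_pos)
  have subseq: "\<forall>\<^sub>F n in sequentially. P (s n)" if "\<forall>\<^sub>F n in sequentially. P n" for P
    using eventually_subseq[OF s that] .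
  have u_off: "u j = 0" if "j < N" "j \<notin> K" for j
  proof -
    have "\<forall>\<^sub>F n in sequentially. X n j = 0" using off[of m] that m by blast
    from subseq[OF this] have "\<forall>\<^sub>F n in sequentially. X (s n) j / T (s n) = 0" by eventually_elim simp
    then have "(\<lambda>n. X (s n) j / T (s n)) \<longlonglongrightarrow> 0" by (rule tendsto_eventually)
    then show ?thesis using u[of j] that LIMSEQ_unique by blast
  qed
  define v where "v i = u0 * q i + (\<Sum>j\<in>K. u j * r {j} i)" for i
  \<comment> \<open>To first order \<open>incentive\<close> is minus the candidate
    \<open>w\<close>-vector \<open>v\<close>, so the sign conditions turn into complementarity of
    \<open>u\<close> and \<open>v\<close>.\<close>
  have F: "(\<lambda>n. incentive N r q (l (s n)) i (X (s n)) / T (s n)) \<longlonglongrightarrow> - v i" if i: "i < N" for i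
  proof -
    define g where "g n = l n / T n * q i + (\<Sum>j\<in>{..<N} - {i}. X n j / T n * r {j} i)" for n
    define f where "f n = incentive N r q (l n) i (X n) / T n" for n
    have "(\<Sum>j\<in>{..<N} - {i}. u j * r {j} i) = (\<Sum>j<N. u j * r {j} i)"
      using i diag[OF i] by (simp add: sum.remove[of "{..<N}" i])
    also have "\<dots> = (\<Sum>j\<in>K. u j * r {j} i)"
      using KN u_off by (intro sum.mono_neutral_right) auto
    finally have eq: "v i = u0 * q i + (\<Sum>j\<in>{..<N} - {i}. u j * r {j} i)" by (simp add: v_def)
    have "(\<lambda>n. g (s n)) \<longlonglongrightarrow> v i"
      unfolding g_def eq by (intro tendsto_intros u u0) simp
    moreover have "(\<lambda>n. f n + g n) \<longlonglongrightarrow> 0"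
    proof (rule tendstoI)
      fix e :: real assume e: "0 < e"
      have "\<forall>\<^sub>F n in sequentially.
        \<bar>incentive N r q (l n) i (X n) + l n * q i + (\<Sum>j\<in>{..<N} - {i}. X n j * r {j} i)\<bar>
          \<le> e / 2 * (l n + sum (X n) ({..<N} - {i}))"
        using X X0 l(1) e by (intro incentive_first_order r diag i) auto
      then show "\<forall>\<^sub>F n in sequentially. dist (f n + g n) 0 < e"
      proof eventually_elim
        case (elim n)
        have "f n + g n = (incentive N r q (l n) i (X n) + l n * q i + (\<Sum>j\<in>{..<N} - {i}. X n j * r {j} i)) / T n"
          by (simp add: f_def g_def add_divide_distrib sum_divide_distrib)
        then have "\<bar>f n + g n\<bar> = \<bar>incentive N r q (l n) i (X n) + l n * q i + (\<Sum>j\<in>{..<N} - {i}. X n j * r {j} i)\<bar> / T n"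
          using T(1)[of n] by simp
        also have "\<dots> \<le> (e / 2 * T n) / T n"
        proof (rule divide_right_mono[OF order_trans[OF elim]])
          have "(sum (X n) ({..<N} - {i})) \<le> (\<Sum>j<N. X n j)" using X by (intro sum_mono2) auto
          then show "e / 2 * (l n + sum (X n) ({..<N} - {i})) \<le> e / 2 * T n"
            unfolding T_def using e by (intro mult_left_mono) auto
          show "0 \<le> T n" using T(1)[of n] by simp
        qed
        also have "\<dots> < e" using T(1)[of n] e by simp
        finally show ?case by (simp add: dist_real_def)
      qed
    qed
    then have "(\<lambda>n. f (s n) + g (s n)) \<longlonglongrightarrow> 0" using LIMSEQ_subseq_LIMSEQ[OF _ s] by (force simp: o_def)
    ultimately have "(\<lambda>n. (f (s n) + g (s n)) - g (s n)) \<longlonglongrightarrow> 0 - v i" by (intro tendsto_diff)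
    then show ?thesis by (simp add: f_def)
  qed
  have le0: "\<forall>\<^sub>F n in sequentially. incentive N r q (l (s n)) i (X (s n)) \<le> 0" if i: "i < N" for i
  proof -
    have "\<forall>\<^sub>F n in sequentially. X n i < 1" using order_tendstoD(2)[OF X0[OF i]] by simp
    from subseq[OF this] show ?thesis
    proof eventually_elim
      case (elim n)
      then show ?case using compl(1)[OF i, of "s n"] by (force simp: not_less[symmetric])
    qed
  qed
  have sol: "0 \<le> u i \<and> 0 \<le> v i \<and> u i * v i = 0" if "i \<in> K" for i
  proof -
    have i: "i < N" using that KN by blast
    have "\<forall>\<^sub>F n in sequentially. incentive N r q (l (s n)) i (X (s n)) / T (s n) \<le> 0"
      using le0[OF i] by eventually_elim (use T(1) in \<open>simp add: divide_nonpos_pos\<close>)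
    from tendsto_upperbound[OF F[OF i] this] have "- v i \<le> 0" by simp
    moreover have "v i = 0" if "u i \<noteq> 0"
    proof -
      have "0 < u i" using that u_nonneg[OF i] by simp
      then have "\<forall>\<^sub>F n in sequentially. 0 < X (s n) i / T (s n)" using order_tendstoD(1)[OF u[of i]] i by simp
      then have "\<forall>\<^sub>F n in sequentially. incentive N r q (l (s n)) i (X (s n)) / T (s n) = 0"
        using le0[OF i]
      proof eventually_elim
        case (elim n)
        then have "X (s n) i \<noteq> 0" by auto
        then have "\<not> incentive N r q (l (s n)) i (X (s n)) < 0" using compl(2)[OF i, of "s n"] by blast
        then show ?case using elim(2) by simp
      qed
      then have "(\<lambda>n. incentive N r q (l (s n)) i (X (s n)) / T (s n)) \<longlonglongrightarrow> 0" by (rule tendsto_eventually)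
      then show ?thesis using F[OF i] LIMSEQ_unique by force
    qed
    ultimately show ?thesis using u_nonneg[OF i] by auto
  qed
  have sumK: "(sum u K) = 1 - u0"
  proof -
    have "(sum u K) = (\<Sum>j<N. u j)" using KN u_off by (intro sum.mono_neutral_left) auto
    then show ?thesis by (simp add: u0_def)
  qed
  show False
  proof (cases "u0 = 0")
    case True
    then have "lcp_sol K (\<lambda>i j. r {i} j) (\<lambda>_. 0) u v" using sol by (auto simp: lcp_sol_def v_def)
    then have "\<forall>i\<in>K. u i = 0" by (rule R0)
    then show False using sumK True by simp
  next
    case False
    then have pos: "0 < u0" using u0_nonneg by simp
    have "lcp_sol K (\<lambda>i j. r {i} j) q (\<lambda>i. u i / u0) (\<lambda>i. v i / u0)"
      unfolding lcp_sol_def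
    proof (intro ballI conjI)
      fix j assume j: "j \<in> K"
      show "0 \<le> u j / u0" "0 \<le> v j / u0" "u j / u0 * (v j / u0) = 0" using sol[OF j] pos by auto
      show "v j / u0 = q j + (\<Sum>i\<in>K. u i / u0 * r {i} j)"
        using pos by (simp add: v_def add_divide_distrib sum_divide_distrib)
    qed
    then show False using q unfolding K_def by blast
  qed
qed

text \<open>With \<open>j\<close> quitting rarely, perpetual waiting brings \<open>i\<close> only
  \<open>r {j} i \<le> 0\<close>, and the payoff of \<open>i\<close> stays close to
  \<open>r {i} i = 0\<close>. Every other player faces the quitting of \<open>i\<close>, so all
  values are continuous there and the slack \<open>\<epsilon>\<close> absorbs the change.\<close>

lemma single_quitter_perturbation:
  assumes r: "payoffs_ok N r" and diag: "r {i} i = 0"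
    and x: "\<And>k. k < N \<Longrightarrow> 0 \<le> x k \<and> x k \<le> 1"
    and i: "i < N" "0 < x i" and only: "\<And>k. k < N \<Longrightarrow> k \<noteq> i \<Longrightarrow> x k = 0"
    and j: "j < N" "j \<noteq> i" "r {j} i \<le> 0"
    and compl: "\<And>k. k < N \<Longrightarrow> 0 < incentive N r q 0 k x \<Longrightarrow> x k = 1"
      "\<And>k. k < N \<Longrightarrow> incentive N r q 0 k x < 0 \<Longrightarrow> x k = 0"
    and \<epsilon>: "0 < \<epsilon>"
  shows "\<exists>x. stationary N x \<and> eps_equilibrium N r \<epsilon> x"
proof -
  define \<delta> where "\<delta> n = 1 / real (Suc n)" for n
  have \<delta>: "0 < \<delta> n" "\<delta> n \<le> 1" for n by (auto simp: \<delta>_def)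
  have \<delta>0: "\<delta> \<longlonglongrightarrow> 0"
    using LIMSEQ_inverse_real_of_nat by (simp add: \<delta>_def[abs_def] inverse_eq_divide)
  define Y where "Y n = x(j := \<delta> n)" for n
  have Y01: "0 \<le> Y n k \<and> Y n k \<le> 1" if "k < N" for n k using x[OF that] \<delta>[of n] by (simp add: Y_def)
  have Yi: "Y n i = x i" for n using j by (simp add: Y_def)
  have Ylim: "(\<lambda>n. Y n k) \<longlonglongrightarrow> x k" if "k < N" for k
    using \<delta>0 only[OF j(1,2)] by (cases "k = j") (auto simp: Y_def)
  have r1: "\<bar>r S i\<bar> \<le> 1" if "S \<subseteq> {..<N}" for S
    using r that i(1) by (auto simp: payoffs_ok_def abs_le_iff minus_le_iff)
  have stayY: "stay_prob N k (Y n) < 1" if k: "k < N" for n k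
  proof (cases "k = i")
    case True
    then show ?thesis using stay_prob_le[of N "Y n" j i, OF Y01] j \<delta>[of n] by (force simp: Y_def)
  next
    case False
    then show ?thesis using stay_prob_le[of N "Y n" i k, OF Y01] i Yi[of n] by force
  qed
  have good: "\<forall>\<^sub>F n in sequentially. quit_val N r k (Y n) \<le> stat_val N r k (Y n) + \<epsilon>
      \<and> cont_val N r k (Y n) \<le> (1 - stay_prob N k (Y n)) * (stat_val N r k (Y n) + \<epsilon>)" if k: "k < N" for k
  proof (cases "k = i")
    case True
    have vals: "quit_val N r i (Y n) = \<delta> n * r {i, j} i" "cont_val N r i (Y n) = \<delta> n * r {j} i"
      "stay_prob N i (Y n) = 1 - \<delta> n" for n
    proof -
      have one: "stage_val ({..<N} - {i}) (Y n) f = (1 - \<delta> n) * f {} + \<delta> n * f {j}" for f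
        using j only by (subst stage_val_one_active[of _ j]) (auto simp: Y_def)
      show "quit_val N r i (Y n) = \<delta> n * r {i, j} i" "cont_val N r i (Y n) = \<delta> n * r {j} i"
        unfolding quit_val_def cont_val_def one by (simp_all add: diag with_cont_def)
      have "stay_prob N i (Y n) = (1 - \<delta> n) * (\<Prod>k\<in>{..<N} - {i} - {j}. 1 - Y n k)"
        unfolding stay_prob_def using j by (subst prod.remove[of _ j]) (auto simp: Y_def)
      also have "(\<Prod>k\<in>{..<N} - {i} - {j}. 1 - Y n k) = 1"
        using only by (intro prod.neutral) (auto simp: Y_def)
      finally show "stay_prob N i (Y n) = 1 - \<delta> n" by simp
    qed
    have "(\<lambda>n. \<delta> n * r {i, j} i) \<longlonglongrightarrow> 0 * r {i, j} i" "(\<lambda>n. \<delta> n * r {j} i) \<longlonglongrightarrow> 0 * r {j} i"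
      by (intro tendsto_intros \<delta>0)+
    \<comment> \<open>Here \<open>0 < x i\<close> keeps the denominator away from \<open>0\<close>
      although \<open>stay_prob\<close> tends to \<open>1\<close>.\<close>
    moreover have "(\<lambda>n. stat_val N r i (Y n)) \<longlonglongrightarrow>
        (x i * (0 * r {i, j} i) + (1 - x i) * (0 * r {j} i)) / (1 - (1 - x i) * (1 - 0))"
      unfolding stat_val_def vals Yi using \<delta>0 i(2) by (intro tendsto_intros) auto
    ultimately have 1: "(\<lambda>n. quit_val N r i (Y n) - stat_val N r i (Y n)) \<longlonglongrightarrow> 0"
      and 2: "(\<lambda>n. stat_val N r i (Y n)) \<longlonglongrightarrow> 0"
      unfolding vals using tendsto_diff by force+
    have "\<forall>\<^sub>F n in sequentially. quit_val N r i (Y n) - stat_val N r i (Y n) < \<epsilon>"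
      using order_tendstoD(2)[OF 1 \<epsilon>] .
    moreover have "\<forall>\<^sub>F n in sequentially. - \<epsilon> < stat_val N r i (Y n)"
      using order_tendstoD(1)[OF 2, of "- \<epsilon>"] \<epsilon> by simp
    ultimately show ?thesis
    proof eventually_elim
      case (elim n)
      have "cont_val N r i (Y n) \<le> 0" unfolding vals using \<delta>(1)[of n] j(3) by (simp add: mult_nonneg_nonpos)
      also have "0 \<le> (1 - stay_prob N i (Y n)) * (stat_val N r i (Y n) + \<epsilon>)"
        unfolding vals(3) using \<delta>(1)[of n] elim(2) by simp
      finally show ?case using elim(1) True by simp
    qed
  next
    case False
    have stay: "stay_prob N k x < 1" using stay_prob_le[of N x i k, OF x] i False by force
    note best = complementary_imp_best_reply[where x = x and q = q and r = r, OF x k stay compl[OF k]]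
    have D: "0 < 1 - (1 - x k) * stay_prob N k x" by (rule stat_val_denom_pos[where x = x, OF x k stay])
    have lims: "(\<lambda>n. quit_val N r k (Y n)) \<longlonglongrightarrow> quit_val N r k x"
      "(\<lambda>n. cont_val N r k (Y n)) \<longlonglongrightarrow> cont_val N r k x"
      "(\<lambda>n. stay_prob N k (Y n)) \<longlonglongrightarrow> stay_prob N k x"
      using Ylim by (auto intro!: tendsto_vals)
    have V: "(\<lambda>n. stat_val N r k (Y n)) \<longlonglongrightarrow> stat_val N r k x"
      unfolding stat_val_def using D by (intro tendsto_intros lims Ylim k) auto
    have lim1: "(\<lambda>n. stat_val N r k (Y n) + \<epsilon> - quit_val N r k (Y n)) \<longlonglongrightarrow> stat_val N r k x + \<epsilon> - quit_val N r k x"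
      by (intro tendsto_intros V lims)
    have pos1: "0 < stat_val N r k x + \<epsilon> - quit_val N r k x" using best(1) \<epsilon> by simp
    have lim2: "(\<lambda>n. (1 - stay_prob N k (Y n)) * (stat_val N r k (Y n) + \<epsilon>) - cont_val N r k (Y n))
        \<longlonglongrightarrow> (1 - stay_prob N k x) * (stat_val N r k x + \<epsilon>) - cont_val N r k x"
      by (intro tendsto_intros V lims)
    have "0 < (1 - stay_prob N k x) * \<epsilon>" using stay \<epsilon> by simp
    then have pos2: "0 < (1 - stay_prob N k x) * (stat_val N r k x + \<epsilon>) - cont_val N r k x"
      using best(2) unfolding distrib_left by linarith
    show ?thesis
      using order_tendstoD(1)[OF lim1 pos1] order_tendstoD(1)[OF lim2 pos2] by eventually_elim simp
  qed
  have "\<forall>\<^sub>F n in sequentially. \<forall>k\<in>{..<N}. quit_val N r k (Y n) \<le> stat_val N r k (Y n) + \<epsilon>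
      \<and> cont_val N r k (Y n) \<le> (1 - stay_prob N k (Y n)) * (stat_val N r k (Y n) + \<epsilon>)"
    using good by (simp add: eventually_ball_finite_distrib)
  then obtain n where n: "\<forall>k\<in>{..<N}. quit_val N r k (Y n) \<le> stat_val N r k (Y n) + \<epsilon>
      \<and> cont_val N r k (Y n) \<le> (1 - stay_prob N k (Y n)) * (stat_val N r k (Y n) + \<epsilon>)"
    using eventually_happens'[OF sequentially_bot] by blast
  show ?thesis using n by (intro stationary_eps_equilibriumI[where x = "Y n", OF r Y01 stayY]) auto
qed

theorem stationary_equilibrium_exists:
  assumes r: "payoffs_ok N r" and diag: "\<forall>i<N. r {i} i = 0"
    and no: "\<not> (\<exists>w z0 z. lcp_solution (I_star N r) (r_hat r) (\<lambda>_. 0) w z0 z \<and> z0 < 1)"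
    and nQ: "\<not> Q_matrix (I_star N r) (R_hat r)" and \<epsilon>: "0 < \<epsilon>"
  shows "\<exists>x. stationary N x \<and> eps_equilibrium N r \<epsilon> x"
proof -
  let ?K = "I_star N r"
  obtain q' where q': "\<not> (\<exists>z w. (\<forall>i\<in>?K. 0 \<le> z i \<and> 0 \<le> w i \<and> z i * w i = 0) \<and>
      (\<forall>j\<in>?K. w j = q' j + (\<Sum>i\<in>?K. R_hat r j i * z i)))"
    using nQ unfolding Q_matrix_def by blast
  define q where "q i = (if i \<in> ?K then q' i else 1)" for i
  have q: "\<not> (\<exists>z w. lcp_sol ?K (\<lambda>i j. r {i} j) q z w)"
  proof
    assume "\<exists>z w. lcp_sol ?K (\<lambda>i j. r {i} j) q z w"
    then obtain z w where "lcp_sol ?K (\<lambda>i j. r {i} j) q z w" by blast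
    then have "\<forall>i\<in>?K. 0 \<le> z i \<and> 0 \<le> w i \<and> z i * w i = 0"
      "\<forall>j\<in>?K. w j = q j + (\<Sum>i\<in>?K. z i * r {i} j)"
      unfolding lcp_sol_def by blast+
    moreover from calculation(2) have "\<forall>j\<in>?K. w j = q' j + (\<Sum>i\<in>?K. R_hat r j i * z i)"
      by (simp add: R_hat_def r_hat_def q_def mult.commute)
    ultimately show False using q' by blast
  qed
  define L where "L n = 1 / real (Suc n)" for n
  have "\<exists>x. \<forall>i<N. 0 \<le> x i \<and> x i \<le> 1 \<and> (0 < incentive N r q (L n) i x \<longrightarrow> x i = 1)
      \<and> (incentive N r q (L n) i x < 0 \<longrightarrow> x i = 0)" for n
    by (rule complementary_point) (auto intro!: tendsto_incentive)
  then obtain Y where Y: "\<And>n. \<forall>i<N. 0 \<le> Y n i \<and> Y n i \<le> 1 \<and> (0 < incentive N r q (L n) i (Y n) \<longrightarrow> Y n i = 1)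
      \<and> (incentive N r q (L n) i (Y n) < 0 \<longrightarrow> Y n i = 0)" by metis
  have "\<bar>Y n i\<bar> \<le> 1" if "i \<in> {..<N}" for n i using Y[of n] that by auto
  then obtain s x where s: "strict_mono s" and x: "\<And>i. i \<in> {..<N} \<Longrightarrow> (\<lambda>n. Y (s n) i) \<longlonglongrightarrow> x i"
    using finite_subseq_convergent[of "{..<N}" Y 1] by blast
  define l where "l n = L (s n)" for n
  define X where "X n = Y (s n)" for n
  have l: "0 < l n" for n by (simp add: l_def L_def)
  have l0: "l \<longlonglongrightarrow> 0"
    using LIMSEQ_subseq_LIMSEQ[OF LIMSEQ_inverse_real_of_nat s]
    by (simp add: l_def[abs_def] L_def o_def inverse_eq_divide)
  have X: "0 \<le> X n i \<and> X n i \<le> 1" "0 < incentive N r q (l n) i (X n) \<Longrightarrow> X n i = 1"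
    "incentive N r q (l n) i (X n) < 0 \<Longrightarrow> X n i = 0" if "i < N" for n i
    using Y[of "s n"] that by (auto simp: X_def l_def)
  have Xx: "(\<lambda>n. X n i) \<longlonglongrightarrow> x i" if "i < N" for i using x that by (simp add: X_def)
  have x01: "0 \<le> x i \<and> x i \<le> 1" if "i < N" for i
  proof
    show "0 \<le> x i" using X(1)[OF that] by (intro LIMSEQ_le_const[OF Xx[OF that]]) auto
    show "x i \<le> 1" using X(1)[OF that] by (intro LIMSEQ_le_const2[OF Xx[OF that]]) auto
  qed
  have inc: "(\<lambda>n. incentive N r q (l n) i (X n)) \<longlonglongrightarrow> incentive N r q 0 i x" for i
    by (rule tendsto_incentive[OF l0 Xx])
  have compl1: "x i = 1" if i: "i < N" and pos: "0 < incentive N r q 0 i x" for i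
  proof -
    have "\<forall>\<^sub>F n in sequentially. X n i = 1"
      using order_tendstoD(1)[OF inc pos] by eventually_elim (rule X(2)[OF i])
    from LIMSEQ_unique[OF Xx[OF i] tendsto_eventually[OF this]] show ?thesis .
  qed
  have compl0: "x i = 0" if i: "i < N" and neg: "incentive N r q 0 i x < 0" for i
  proof -
    have "\<forall>\<^sub>F n in sequentially. X n i = 0"
      using order_tendstoD(2)[OF inc neg] by eventually_elim (rule X(3)[OF i])
    from LIMSEQ_unique[OF Xx[OF i] tendsto_eventually[OF this]] show ?thesis .
  qed
  have "\<exists>i<N. x i \<noteq> 0"
  proof (rule ccontr)
    assume "\<not> ?thesis"
    then have "(\<lambda>n. X n j) \<longlonglongrightarrow> 0" if "j < N" for j using Xx[OF that] that by simp
    note X0 = this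
    show False
    proof (rule no_vanishing_stationary_limit[where q = q and l = l and X = X])
      show "r {i} i = 0" if "i < N" for i using diag that by blast
      show "q i = 1" if "i \<notin> ?K" for i using that by (simp add: q_def)
    qed (use r no q l l0 X X0 in \<open>assumption | blast\<close>)+
  qed
  then obtain i where i: "i < N" "0 < x i" using x01 by force
  show ?thesis
  proof (cases "\<exists>j<N. j \<noteq> i \<and> x j \<noteq> 0")
    case True
    then obtain j where j: "j < N" "j \<noteq> i" "0 < x j" using x01 by force
    \<comment> \<open>Two active players keep \<open>stay_prob\<close> below \<open>1\<close> for
      everybody, so the best-reply inequalities hold at the limit without any slack.\<close>
    have stay: "stay_prob N k x < 1" if "k < N" for k
      using stay_prob_le[of N x i k, OF x01] stay_prob_le[of N x j k, OF x01] i j by force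
    show ?thesis
    proof (rule stationary_eps_equilibriumI[where x = x, OF r x01 stay])
      fix k assume k: "k < N"
      note best = complementary_imp_best_reply[where x = x and q = q and r = r, OF x01 k stay[OF k] compl1[OF k] compl0[OF k]]
      show "quit_val N r k x \<le> stat_val N r k x + \<epsilon>" using best(1) \<epsilon> by simp
      have "(1 - stay_prob N k x) * stat_val N r k x \<le> (1 - stay_prob N k x) * (stat_val N r k x + \<epsilon>)"
        using stay[OF k] \<epsilon> by (intro mult_left_mono) auto
      then show "cont_val N r k x \<le> (1 - stay_prob N k x) * (stat_val N r k x + \<epsilon>)"
        using best(2) by simp
    qed
  next
    case False
    then have only: "x k = 0" if "k < N" "k \<noteq> i" for k using that by blast
    \<comment> \<open>If every other player gave \<open>i\<close> a positive payoff,
      \<open>i\<close> would not be normal and \<open>q i\<close> would be \<open>1\<close>. Along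
      the sequence \<open>i\<close> would then prefer to wait, forcing
      \<open>x i = 0\<close>.\<close>
    have "\<exists>j<N. j \<noteq> i \<and> r {j} i \<le> 0"
    proof (rule ccontr)
      assume none: "\<not> ?thesis"
      then have "i \<notin> ?K" using I_star_normal[of i N r] I_star_le[of N r] by blast
      then have "q i = 1" by (simp add: q_def)
      have "\<forall>\<^sub>F n in sequentially. X n i = 0"
      proof (rule eventually_not_quitting[where B = "{..<N}" and l = l and q = q])
        show "payoffs_ok N r" "r {i} i = 0" "i < N" "q i = 1" using r diag i \<open>q i = 1\<close> by auto
        show "(\<lambda>n. X n j) \<longlonglongrightarrow> 0" if "j < N" "j \<noteq> i" for j using Xx[OF that(1)] only[OF that] by simp
        show "0 < r {j} i" if "j \<in> {..<N}" "j \<noteq> i" for j using none that by force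
      qed (use X l i in auto)
      from LIMSEQ_unique[OF Xx[OF i(1)] tendsto_eventually[OF this]] have "x i = 0" .
      then show False using i(2) by simp
    qed
    then obtain j where "j < N" "j \<noteq> i" "r {j} i \<le> 0" by blast
    then show ?thesis
      using diag i(1)
      by (intro single_quitter_perturbation[where x = x and q = q, OF r _ x01 i only _ _ _ compl1 compl0 \<epsilon>]) auto
  qed
qed

theorem theorem2:
  fixes N :: nat and r :: "nat set \<Rightarrow> nat \<Rightarrow> real"
  assumes "payoffs_ok N r"
    and "\<forall>i<N. r {i} i = 0"
    and "I_star N r \<noteq> {}"
    and "\<not> (\<exists>w z0 z. lcp_solution (I_star N r) (r_hat r) (\<lambda>_. 0) w z0 z \<and> z0 < 1)"
  shows "(\<not> Q_matrix (I_star N r) (R_hat r) \<longrightarrow>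
            (\<forall>\<epsilon>>0. \<exists>x. stationary N x \<and> eps_equilibrium N r \<epsilon> x))
       \<and> (Q_matrix (I_star N r) (R_hat r) \<longrightarrow>
            (\<forall>\<epsilon>>0. \<exists>\<xi>. sunspot_eps_equilibrium N r \<epsilon> \<xi> \<and> at_most_one_quits N \<xi>))"
  using stationary_equilibrium_exists[OF assms(1,2,4)] sunspot_equilibrium_exists[OF assms] by blast

end
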